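(* Let $\mathcal A$ be an abelian length category with only finitely many simple objects up to isomorphism. Then $\mathcal A$ is brick-finite if and only if for every torsion pair $(\mathbf t,\mathbf f)$ in $\mathcal A$ there exist wide subcategories $\mathcal W$ and $\mathcal W'$ of $\mathcal A$ with $\mathbf t=\mathbf T(\mathcal W)$ and $\mathbf f=\mathbf F(\mathcal W')$.
   Context: An abelian length category is an essentially small abelian category in which every object has a finite composition series. All subcategories are full and closed under isomorphism. An object $B$ is a brick if its endomorphism ring is a skew-field; $\mathcal A$ is brick-finite if it has only finitely many isomorphism classes of bricks. A torsion pair in $\mathcal A$ is a pair $(\mathbf t,\mathbf f)$ of subcategories such that $\operatorname{Hom}(T,F)=0$ for all $T\in\mathbf t$, $F\in\mathbf f$, and every object $M$ admits a short exact sequence $0\to T\to M\to F\to 0$ with $T\in\mathbf t$, $F\in\mathbf f$; $\mathbf t$ is called the torsion class and $\mathbf f$ the torsionfree class. A subcategory is wide if it is closed under kernels, cokernels and extensions. For a class of objects $\mathcal S$, $\mathbf T(\mathcal S)$ denotes the smallest torsion class containing $\mathcal S$ (the objects having a finite filtration whose factors are quotients of finite direct sums of objects of $\mathcal S$), and $\mathbf F(\mathcal S)$ denotes the smallest torsionfree class containing $\mathcal S$ (the objects having a finite filtration whose factors are subobjects of finite direct sums of objects of $\mathcal S$). *)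

theory Defs
  imports "HOL-Algebra.Ring"
begin

section \<open>Preadditive categories\<close>

text \<open>
  Objects and arrows are taken from two arbitrary types, so every category below is small; an
  essentially small category is represented by an equivalent small one. The term \<open>Cmp C g f\<close> is the
  composite ``first \<open>f\<close>, then \<open>g\<close>''. Values of the operations outside their natural domain (objects,
  arrows, composable pairs, parallel pairs) are irrelevant.
\<close>

record ('o, 'm) precat =
  Obj :: "'o set"
  Arr :: "'m set"
  Dom :: "'m \<Rightarrow> 'o"
  Cod :: "'m \<Rightarrow> 'o"
  Idt :: "'o \<Rightarrow> 'm"
  Cmp :: "'m \<Rightarrow> 'm \<Rightarrow> 'm"  (infixl \<open>\<cdot>\<index>\<close> 70)
  Add :: "'m \<Rightarrow> 'm \<Rightarrow> 'm"
  Zer :: "'o \<Rightarrow> 'o \<Rightarrow> 'm"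

definition Hom :: "('o, 'm) precat \<Rightarrow> 'o \<Rightarrow> 'o \<Rightarrow> 'm set" where
  "Hom C X Y = {f \<in> Arr C. Dom C f = X \<and> Cod C f = Y}"

definition hom_group :: "('o, 'm) precat \<Rightarrow> 'o \<Rightarrow> 'o \<Rightarrow> 'm monoid" where
  "hom_group C X Y = \<lparr>carrier = Hom C X Y, monoid.mult = Add C, one = Zer C X Y\<rparr>"

definition end_ring :: "('o, 'm) precat \<Rightarrow> 'o \<Rightarrow> 'm ring" where
  "end_ring C X =
     \<lparr>carrier = Hom C X X, monoid.mult = Cmp C, one = Idt C X, zero = Zer C X X, add = Add C\<rparr>"

locale preadditive_category =
  fixes C :: "('o, 'm) precat" (structure)
  assumes Dom_Obj: "f \<in> Arr C \<Longrightarrow> Dom C f \<in> Obj C"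
    and Cod_Obj: "f \<in> Arr C \<Longrightarrow> Cod C f \<in> Obj C"
    and Idt_Hom: "X \<in> Obj C \<Longrightarrow> Idt C X \<in> Hom C X X"
    and Cmp_Hom: "\<lbrakk>f \<in> Hom C X Y; g \<in> Hom C Y Z\<rbrakk> \<Longrightarrow> g \<cdot> f \<in> Hom C X Z"
    and Cmp_assoc: "\<lbrakk>f \<in> Hom C X Y; g \<in> Hom C Y Z; h \<in> Hom C Z V\<rbrakk> \<Longrightarrow> h \<cdot> g \<cdot> f = h \<cdot> (g \<cdot> f)"
    and Cmp_Idt: "f \<in> Hom C X Y \<Longrightarrow> f \<cdot> Idt C X = f"
    and Idt_Cmp: "f \<in> Hom C X Y \<Longrightarrow> Idt C Y \<cdot> f = f"
    and hom_comm_group: "\<lbrakk>X \<in> Obj C; Y \<in> Obj C\<rbrakk> \<Longrightarrow> comm_group (hom_group C X Y)"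
    and Cmp_Add: "\<lbrakk>f \<in> Hom C X Y; f' \<in> Hom C X Y; g \<in> Hom C Y Z\<rbrakk>
                    \<Longrightarrow> g \<cdot> Add C f f' = Add C (g \<cdot> f) (g \<cdot> f')"
    and Add_Cmp: "\<lbrakk>f \<in> Hom C X Y; g \<in> Hom C Y Z; g' \<in> Hom C Y Z\<rbrakk>
                    \<Longrightarrow> Add C g g' \<cdot> f = Add C (g \<cdot> f) (g' \<cdot> f)"

section \<open>Abelian length categories\<close>

definition zero_obj :: "('o, 'm) precat \<Rightarrow> 'o \<Rightarrow> bool" where
  "zero_obj C Z \<longleftrightarrow> Z \<in> Obj C \<and>
     (\<forall>X\<in>Obj C. (\<exists>!f. f \<in> Hom C Z X) \<and> (\<exists>!f. f \<in> Hom C X Z))"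

definition is_mono :: "('o, 'm) precat \<Rightarrow> 'm \<Rightarrow> bool" where
  "is_mono C f \<longleftrightarrow> f \<in> Arr C \<and>
     (\<forall>W. \<forall>u\<in>Hom C W (Dom C f). \<forall>v\<in>Hom C W (Dom C f). f \<cdot>\<^bsub>C\<^esub> u = f \<cdot>\<^bsub>C\<^esub> v \<longrightarrow> u = v)"

definition is_epi :: "('o, 'm) precat \<Rightarrow> 'm \<Rightarrow> bool" where
  "is_epi C f \<longleftrightarrow> f \<in> Arr C \<and>
     (\<forall>W. \<forall>u\<in>Hom C (Cod C f) W. \<forall>v\<in>Hom C (Cod C f) W. u \<cdot>\<^bsub>C\<^esub> f = v \<cdot>\<^bsub>C\<^esub> f \<longrightarrow> u = v)"

definition is_iso :: "('o, 'm) precat \<Rightarrow> 'm \<Rightarrow> bool" where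
  "is_iso C f \<longleftrightarrow> f \<in> Arr C \<and>
     (\<exists>g\<in>Hom C (Cod C f) (Dom C f). g \<cdot>\<^bsub>C\<^esub> f = Idt C (Dom C f) \<and> f \<cdot>\<^bsub>C\<^esub> g = Idt C (Cod C f))"

definition iso_rel :: "('o, 'm) precat \<Rightarrow> ('o \<times> 'o) set" where
  "iso_rel C = {(X, Y). X \<in> Obj C \<and> Y \<in> Obj C \<and> (\<exists>f\<in>Hom C X Y. is_iso C f)}"

text \<open>\<open>is_kernel C f k\<close>: the arrow \<open>k\<close> (not just its domain) is a kernel of \<open>f\<close>; dually for cokernels.\<close>

definition is_kernel :: "('o, 'm) precat \<Rightarrow> 'm \<Rightarrow> 'm \<Rightarrow> bool" where
  "is_kernel C f k \<longleftrightarrow> f \<in> Arr C \<and> k \<in> Arr C \<and> Cod C k = Dom C f \<and>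
     f \<cdot>\<^bsub>C\<^esub> k = Zer C (Dom C k) (Cod C f) \<and>
     (\<forall>W. \<forall>h\<in>Hom C W (Dom C f). f \<cdot>\<^bsub>C\<^esub> h = Zer C W (Cod C f) \<longrightarrow>
        (\<exists>!u. u \<in> Hom C W (Dom C k) \<and> k \<cdot>\<^bsub>C\<^esub> u = h))"

definition is_cokernel :: "('o, 'm) precat \<Rightarrow> 'm \<Rightarrow> 'm \<Rightarrow> bool" where
  "is_cokernel C f c \<longleftrightarrow> f \<in> Arr C \<and> c \<in> Arr C \<and> Dom C c = Cod C f \<and>
     c \<cdot>\<^bsub>C\<^esub> f = Zer C (Dom C f) (Cod C c) \<and>
     (\<forall>W. \<forall>h\<in>Hom C (Cod C f) W. h \<cdot>\<^bsub>C\<^esub> f = Zer C (Dom C f) W \<longrightarrow>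
        (\<exists>!u. u \<in> Hom C (Cod C c) W \<and> u \<cdot>\<^bsub>C\<^esub> c = h))"

definition is_biproduct :: "('o, 'm) precat \<Rightarrow> 'o \<Rightarrow> 'o \<Rightarrow> 'o \<Rightarrow> bool" where
  "is_biproduct C X Y P \<longleftrightarrow>
     (\<exists>i\<in>Hom C X P. \<exists>j\<in>Hom C Y P. \<exists>p\<in>Hom C P X. \<exists>q\<in>Hom C P Y.
        p \<cdot>\<^bsub>C\<^esub> i = Idt C X \<and> q \<cdot>\<^bsub>C\<^esub> j = Idt C Y \<and> Add C (i \<cdot>\<^bsub>C\<^esub> p) (j \<cdot>\<^bsub>C\<^esub> q) = Idt C P)"

locale abelian_category = preadditive_category +
  assumes ex_zero_obj: "\<exists>Z. zero_obj C Z"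
    and ex_biproduct: "\<lbrakk>X \<in> Obj C; Y \<in> Obj C\<rbrakk> \<Longrightarrow> \<exists>P\<in>Obj C. is_biproduct C X Y P"
    and ex_kernel: "f \<in> Arr C \<Longrightarrow> \<exists>k. is_kernel C f k"
    and ex_cokernel: "f \<in> Arr C \<Longrightarrow> \<exists>c. is_cokernel C f c"
    and mono_is_kernel: "is_mono C f \<Longrightarrow> \<exists>g. is_kernel C g f"
    and epi_is_cokernel: "is_epi C f \<Longrightarrow> \<exists>g. is_cokernel C g f"

text \<open>\<open>0 \<rightarrow> Dom i \<rightarrow> Cod i = Dom p \<rightarrow> Cod p \<rightarrow> 0\<close> is exact.\<close>

definition short_exact :: "('o, 'm) precat \<Rightarrow> 'm \<Rightarrow> 'm \<Rightarrow> bool" where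
  "short_exact C i p \<longleftrightarrow> is_kernel C p i \<and> is_cokernel C i p"

definition simple_obj :: "('o, 'm) precat \<Rightarrow> 'o \<Rightarrow> bool" where
  "simple_obj C S \<longleftrightarrow> S \<in> Obj C \<and> \<not> zero_obj C S \<and>
     (\<forall>i. is_mono C i \<and> Cod C i = S \<longrightarrow> zero_obj C (Dom C i) \<or> is_iso C i)"

text \<open>
  A composition series \<open>0 = X 0 \<subset> X 1 \<subset> \<dots> \<subset> X n = M\<close>, the inclusions being given by monomorphisms
  \<open>X k \<rightarrow> X (k + 1)\<close> with simple cokernels.
\<close>

definition has_composition_series :: "('o, 'm) precat \<Rightarrow> 'o \<Rightarrow> bool" where
  "has_composition_series C M \<longleftrightarrow>
     (\<exists>(n::nat) X. zero_obj C (X 0) \<and> X n = M \<and>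
        (\<forall>k<n. \<exists>S i p. simple_obj C S \<and> i \<in> Hom C (X k) (X (Suc k)) \<and> p \<in> Hom C (X (Suc k)) S \<and>
                       short_exact C i p))"

locale abelian_length_category = abelian_category +
  assumes ex_composition_series: "M \<in> Obj C \<Longrightarrow> has_composition_series C M"

definition finitely_many_simples :: "('o, 'm) precat \<Rightarrow> bool" where
  "finitely_many_simples C \<longleftrightarrow> finite ({S. simple_obj C S} // iso_rel C)"

section \<open>Bricks\<close>

locale skew_field = ring +
  assumes skew_field_Units: "Units R = carrier R - {\<zero>}"

definition brick :: "('o, 'm) precat \<Rightarrow> 'o \<Rightarrow> bool" where
  "brick C B \<longleftrightarrow> B \<in> Obj C \<and> skew_field (end_ring C B)"

definition brick_finite :: "('o, 'm) precat \<Rightarrow> bool" where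
  "brick_finite C \<longleftrightarrow> finite ({B. brick C B} // iso_rel C)"

section \<open>Subcategories\<close>

text \<open>A full subcategory closed under isomorphism is represented by its class of objects.\<close>

definition subcategory :: "('o, 'm) precat \<Rightarrow> 'o set \<Rightarrow> bool" where
  "subcategory C S \<longleftrightarrow> S \<subseteq> Obj C \<and> (\<forall>X Y. X \<in> S \<and> (X, Y) \<in> iso_rel C \<longrightarrow> Y \<in> S)"

definition wide :: "('o, 'm) precat \<Rightarrow> 'o set \<Rightarrow> bool" where
  "wide C W \<longleftrightarrow> subcategory C W \<and>
     (\<forall>f k. Dom C f \<in> W \<and> Cod C f \<in> W \<and> is_kernel C f k \<longrightarrow> Dom C k \<in> W) \<and>
     (\<forall>f c. Dom C f \<in> W \<and> Cod C f \<in> W \<and> is_cokernel C f c \<longrightarrow> Cod C c \<in> W) \<and>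
     (\<forall>i p. short_exact C i p \<and> Dom C i \<in> W \<and> Cod C p \<in> W \<longrightarrow> Cod C i \<in> W)"

definition torsion_pair :: "('o, 'm) precat \<Rightarrow> 'o set \<Rightarrow> 'o set \<Rightarrow> bool" where
  "torsion_pair C t f \<longleftrightarrow> subcategory C t \<and> subcategory C f \<and>
     (\<forall>T\<in>t. \<forall>F\<in>f. Hom C T F = {Zer C T F}) \<and>
     (\<forall>M\<in>Obj C. \<exists>i p. short_exact C i p \<and> Dom C i \<in> t \<and> Cod C i = M \<and> Cod C p \<in> f)"

definition torsion_class :: "('o, 'm) precat \<Rightarrow> 'o set \<Rightarrow> bool" where
  "torsion_class C t \<longleftrightarrow> (\<exists>f. torsion_pair C t f)"

definition torsionfree_class :: "('o, 'm) precat \<Rightarrow> 'o set \<Rightarrow> bool" where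
  "torsionfree_class C f \<longleftrightarrow> (\<exists>t. torsion_pair C t f)"

text \<open>
  The smallest torsion (torsionfree) class containing \<open>S\<close>. In an abelian length category the class of
  all objects is both, and torsion (torsionfree) classes are closed under intersections.
\<close>

definition gen_torsion :: "('o, 'm) precat \<Rightarrow> 'o set \<Rightarrow> 'o set" where
  "gen_torsion C S = \<Inter>{t. torsion_class C t \<and> S \<subseteq> t}"

definition gen_torsionfree :: "('o, 'm) precat \<Rightarrow> 'o set \<Rightarrow> 'o set" where
  "gen_torsionfree C S = \<Inter>{f. torsionfree_class C f \<and> S \<subseteq> f}"

end

theory Submission
  imports Defs
begin

text \<open>
Let \<open>t\<close> be a torsion class and \<open>f\<close> its torsionfree class. Call \<open>S \<in> t\<close> torsion simple if every nonzero
map from an object of \<open>t\<close> to \<open>S\<close> is epi with kernel in \<open>t\<close>. Torsion simple objects satisfy Schur's lemma,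
and if \<open>t = T(W)\<close> with \<open>W\<close> wide, then the simple objects of \<open>W\<close> are torsion simple and generate \<open>t\<close>
(\<open>gen_by_torsion_simples\<close>). Dually for \<open>f\<close>. Everything is proved for one side and transported to the
other by passing to the opposite category; the only trace of composition series that is kept is a
length function whose properties are self-dual.

Suppose that \<open>\<A>\<close> is brick-finite. Two different torsion classes are separated by a brick, so there are
finitely many of them. The class \<open>\<alpha>(t)\<close> of those \<open>X \<in> t\<close> for which all maps from \<open>t\<close> to \<open>X\<close> have their
kernel in \<open>t\<close> is wide. If \<open>T(\<alpha>(t))\<close> were smaller than \<open>t\<close>, take a maximal torsion class \<open>t'\<close> with
\<open>T(\<alpha>(t)) \<subseteq> t' \<subset> t\<close>, with torsionfree class \<open>f'\<close>, and a nonzero object \<open>S\<close> of minimal length in \<open>t \<inter> f'\<close>.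
Since \<open>t\<close> is generated by \<open>t'\<close> and \<open>S\<close>, one finds \<open>S \<in> \<alpha>(t) \<subseteq> t'\<close>, a contradiction
(\<open>torsion_class_gen_alpha\<close>).

Conversely, suppose that all torsion pairs come from wide subcategories. The key point is that every
torsion class is then finitely generated (\<open>all_fin_gen\<close>). Otherwise Zorn's lemma gives a maximal torsion
class \<open>t\<close> that is not finitely generated. As there are finitely many simple objects, \<open>t\<close> is not the whole
category, so \<open>f\<close> has a cosimple object \<open>B\<close> (the dual of a torsion simple one), and \<open>u = T(t \<union> {B})\<close> is
finitely generated, say \<open>u = T(F \<union> {B})\<close> with \<open>F\<close> a finite set of torsion simple objects of \<open>t\<close>. All
objects of \<open>u \<inter> f\<close> are iterated extensions of \<open>B\<close>, and extensions of a torsion simple object by an object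
of \<open>u \<inter> f\<close> split. It follows that every torsion simple \<open>S\<close> outside \<open>F\<close> is a quotient of some object of
\<open>u \<inter> f\<close>; let \<open>K\<^sub>S\<close> be the kernel for a smallest such object. These kernels are nonzero, admit no map from
\<open>u\<close>, and are pairwise Hom-orthogonal. The torsion class generated by \<open>u\<close> and all \<open>K\<^sub>S\<close> is finitely
generated by maximality of \<open>t\<close>, so there are only finitely many \<open>S\<close>, and \<open>t\<close>, being generated by its
torsion simple objects, is finitely generated after all.

Applied to both sides this yields chain conditions on torsion classes. If there were infinitely many
bricks, take a minimal torsion class \<open>t\<close> containing infinitely many. It is generated by finitely many
torsion simple objects \<open>S\<close>. A brick \<open>X \<in> t\<close> that maps nontrivially to each \<open>S\<close> generates \<open>t\<close>, and a brick
is determined up to isomorphism by the torsion class that it generates. All other bricks of \<open>t\<close> lie in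
one of the smaller torsion classes of objects of \<open>t\<close> without nonzero map to \<open>S\<close>, so they are finite in
number, a contradiction (\<open>brick_finite_if_fin_gen\<close>).
\<close>

section \<open>The opposite category\<close>

text \<open>
  Kernels, monomorphisms, torsion classes and subobjects in the opposite category are cokernels,
  epimorphisms, torsionfree classes and quotients in the given one. The rewrite rules for \<open>opp C\<close> below
  perform this translation, so that the dual of a lemma is its instance at \<open>opp C\<close>.
\<close>

definition opp :: "('o, 'm) precat \<Rightarrow> ('o, 'm) precat" where
  "opp C = \<lparr>Obj = Obj C, Arr = Arr C, Dom = Cod C, Cod = Dom C, Idt = Idt C,
            Cmp = (\<lambda>g f. f \<cdot>\<^bsub>C\<^esub> g), Add = Add C, Zer = (\<lambda>X Y. Zer C Y X)\<rparr>"

lemma opp_simps [simp]: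
  "Obj (opp C) = Obj C" "Arr (opp C) = Arr C" "Dom (opp C) = Cod C" "Cod (opp C) = Dom C"
  "Idt (opp C) = Idt C" "g \<cdot>\<^bsub>opp C\<^esub> f = f \<cdot>\<^bsub>C\<^esub> g" "Add (opp C) = Add C" "Zer (opp C) X Y = Zer C Y X"
  "opp (opp C) = C"
  by (simp_all add: opp_def)

lemma opp_Hom [simp]: "Hom (opp C) X Y = Hom C Y X"
  by (auto simp: Hom_def)

lemma opp_hom_group [simp]: "hom_group (opp C) X Y = hom_group C Y X"
  by (simp add: hom_group_def)

lemma opp_zero_obj [simp]: "zero_obj (opp C) = zero_obj C"
  by (auto simp: zero_obj_def fun_eq_iff)

lemma opp_is_mono [simp]: "is_mono (opp C) = is_epi C"
  by (auto simp: is_mono_def is_epi_def fun_eq_iff)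

lemma opp_is_epi [simp]: "is_epi (opp C) = is_mono C"
  by (auto simp: is_mono_def is_epi_def fun_eq_iff)

lemma opp_is_iso [simp]: "is_iso (opp C) = is_iso C"
  by (auto simp: is_iso_def fun_eq_iff)

lemma opp_is_kernel [simp]: "is_kernel (opp C) = is_cokernel C"
  by (simp add: is_kernel_def is_cokernel_def fun_eq_iff)

lemma opp_is_cokernel [simp]: "is_cokernel (opp C) = is_kernel C"
  by (simp add: is_kernel_def is_cokernel_def fun_eq_iff)

lemma opp_is_biproduct [simp]: "is_biproduct (opp C) = is_biproduct C"
  by (auto simp: is_biproduct_def fun_eq_iff)

lemma opp_short_exact [simp]: "short_exact (opp C) i p = short_exact C p i"
  by (auto simp: short_exact_def)

lemma preadditive_opp:
  assumes "preadditive_category C"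
  shows "preadditive_category (opp C)"
proof -
  interpret preadditive_category C by fact
  show ?thesis
    by (rule preadditive_category.intro)
      (auto simp: Dom_Obj Cod_Obj Idt_Hom Cmp_Idt Idt_Cmp hom_comm_group
        intro: Cmp_Hom Cmp_assoc Cmp_assoc[symmetric] Cmp_Add Add_Cmp)
qed

lemma abelian_opp:
  assumes "abelian_category C"
  shows "abelian_category (opp C)"
proof -
  interpret abelian_category C by fact
  interpret op: preadditive_category "opp C"
    by (rule preadditive_opp) unfold_locales
  show ?thesis
    by unfold_locales (simp_all add: ex_zero_obj ex_biproduct ex_kernel ex_cokernel
      mono_is_kernel epi_is_cokernel)
qed

section \<open>Short exact sequences in an abelian category\<close>

definition Monos :: "('o, 'm) precat \<Rightarrow> 'o \<Rightarrow> 'o \<Rightarrow> 'm set" where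
  "Monos C X Y = {f \<in> Hom C X Y. is_mono C f}"

definition Epis :: "('o, 'm) precat \<Rightarrow> 'o \<Rightarrow> 'o \<Rightarrow> 'm set" where
  "Epis C X Y = {f \<in> Hom C X Y. is_epi C f}"

definition Isos :: "('o, 'm) precat \<Rightarrow> 'o \<Rightarrow> 'o \<Rightarrow> 'm set" where
  "Isos C X Y = {f \<in> Hom C X Y. is_iso C f}"

definition ses :: "('o, 'm) precat \<Rightarrow> 'm \<Rightarrow> 'm \<Rightarrow> 'o \<Rightarrow> 'o \<Rightarrow> 'o \<Rightarrow> bool" where
  "ses C i p X Y Z \<longleftrightarrow> i \<in> Hom C X Y \<and> p \<in> Hom C Y Z \<and> short_exact C i p"

lemma opp_Monos [simp]: "Monos (opp C) X Y = Epis C Y X"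
  and opp_Epis [simp]: "Epis (opp C) X Y = Monos C Y X"
  and opp_Isos [simp]: "Isos (opp C) X Y = Isos C Y X"
  and opp_ses [simp]: "ses (opp C) i p X Y Z = ses C p i Z Y X"
  by (auto simp: Monos_def Epis_def Isos_def ses_def)

context preadditive_category
begin

lemma Hom_Obj: "f \<in> Hom C X Y \<Longrightarrow> X \<in> Obj C \<and> Y \<in> Obj C"
  using Dom_Obj Cod_Obj by (auto simp: Hom_def)

lemma MonoD: "f \<in> Monos C X Y \<Longrightarrow> f \<in> Hom C X Y"
  and EpiD: "f \<in> Epis C X Y \<Longrightarrow> f \<in> Hom C X Y"
  and IsoD: "f \<in> Isos C X Y \<Longrightarrow> f \<in> Hom C X Y"
  by (auto simp: Monos_def Epis_def Isos_def)

lemma Zer_Hom: assumes "X \<in> Obj C" "Y \<in> Obj C" shows "Zer C X Y \<in> Hom C X Y"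
proof -
  interpret G: comm_group "hom_group C X Y" using hom_comm_group assms .
  show ?thesis using G.one_closed by (simp add: hom_group_def)
qed

lemma Add_Hom: assumes "f \<in> Hom C X Y" "g \<in> Hom C X Y" shows "Add C f g \<in> Hom C X Y"
proof -
  interpret G: comm_group "hom_group C X Y" using hom_comm_group Hom_Obj assms by blast
  show ?thesis using G.m_closed[of f g] assms by (simp add: hom_group_def)
qed

lemma Add_Zer: assumes "f \<in> Hom C X Y" shows "Add C f (Zer C X Y) = f" "Add C (Zer C X Y) f = f"
proof -
  interpret G: comm_group "hom_group C X Y" using hom_comm_group Hom_Obj assms by blast
  show "Add C f (Zer C X Y) = f" "Add C (Zer C X Y) f = f"
    using G.r_one[of f] G.l_one[of f] assms by (simp_all add: hom_group_def)
qed

lemma Add_cancel: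
  assumes "f \<in> Hom C X Y" "g \<in> Hom C X Y" "h \<in> Hom C X Y" "Add C f g = Add C f h" shows "g = h"
proof -
  interpret G: comm_group "hom_group C X Y" using hom_comm_group Hom_Obj assms by blast
  show ?thesis using G.right_cancel[of f g h] G.m_comm[of f] assms by (simp add: hom_group_def)
qed

lemma Add_comm:
  assumes "f \<in> Hom C X Y" "g \<in> Hom C X Y" shows "Add C f g = Add C g f"
proof -
  interpret G: comm_group "hom_group C X Y" using hom_comm_group Hom_Obj assms by blast
  show ?thesis using G.m_comm[of f g] assms by (simp add: hom_group_def)
qed

lemma ex_neg:
  assumes "f \<in> Hom C X Y" obtains g where "g \<in> Hom C X Y" "Add C f g = Zer C X Y"
proof -
  interpret G: comm_group "hom_group C X Y" using hom_comm_group Hom_Obj assms by blast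
  show ?thesis using G.r_inv[of f] G.inv_closed[of f] assms that by (auto simp: hom_group_def)
qed

lemma Cmp_Zer: assumes "g \<in> Hom C Y Z" "X \<in> Obj C" shows "g \<cdot> Zer C X Y = Zer C X Z"
proof -
  let ?z = "Zer C X Y"
  have z: "?z \<in> Hom C X Y" using Zer_Hom assms Hom_Obj by blast
  have h: "g \<cdot> ?z \<in> Hom C X Z" using Cmp_Hom z assms by blast
  have "Add C (g \<cdot> ?z) (g \<cdot> ?z) = g \<cdot> Add C ?z ?z" using Cmp_Add z assms by metis
  also have "\<dots> = Add C (g \<cdot> ?z) (Zer C X Z)" using Add_Zer z h by metis
  finally show ?thesis using Add_cancel h Zer_Hom Hom_Obj by metis
qed

lemma Zer_Cmp: "g \<in> Hom C X Y \<Longrightarrow> Z \<in> Obj C \<Longrightarrow> Zer C Y Z \<cdot> g = Zer C X Z"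
  using preadditive_category.Cmp_Zer[OF preadditive_opp[OF preadditive_category_axioms], of g Y X Z] by simp

lemma Cmp_Arr:
  assumes "f \<in> Arr C" "g \<in> Arr C" "Cod C f = Dom C g"
  shows "g \<cdot> f \<in> Arr C" "Dom C (g \<cdot> f) = Dom C f" "Cod C (g \<cdot> f) = Cod C g"
  using Cmp_Hom[of f "Dom C f" "Dom C g" g "Cod C g"] assms by (auto simp: Hom_def)

lemma Cmp_assoc_right:
  assumes "f \<in> Arr C" "g \<in> Arr C" "h \<in> Arr C" "Cod C f = Dom C g" "Cod C g = Dom C h"
  shows "h \<cdot> g \<cdot> f = h \<cdot> (g \<cdot> f)"
  using Cmp_assoc[of f "Dom C f" "Dom C g" g "Dom C h" h "Cod C h"] assms by (auto simp: Hom_def)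

lemma Idt_Arr:
  assumes "X \<in> Obj C" shows "Idt C X \<in> Arr C" "Dom C (Idt C X) = X" "Cod C (Idt C X) = X"
  using Idt_Hom assms by (auto simp: Hom_def)

lemma Zer_Arr:
  assumes "X \<in> Obj C" "Y \<in> Obj C"
  shows "Zer C X Y \<in> Arr C" "Dom C (Zer C X Y) = X" "Cod C (Zer C X Y) = Y"
  using Zer_Hom assms by (auto simp: Hom_def)

lemma unit_Arr:
  assumes "f \<in> Arr C" shows "Cod C f = X \<Longrightarrow> Idt C X \<cdot> f = f" "Dom C f = X \<Longrightarrow> f \<cdot> Idt C X = f"
  using Idt_Cmp Cmp_Idt assms by (auto simp: Hom_def)

lemma zero_Arr:
  assumes "f \<in> Arr C" "Z \<in> Obj C"
  shows "Cod C f = X \<Longrightarrow> Zer C X Z \<cdot> f = Zer C (Dom C f) Z"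
    "Dom C f = X \<Longrightarrow> f \<cdot> Zer C Z X = Zer C Z (Cod C f)"
  using Zer_Cmp Cmp_Zer assms by (auto simp: Hom_def)

text \<open>
  Rewriting with these rules decides typing and normalizes composites to the right. An equation
  \<open>a \<cdot> b = c\<close> then has to be used also in the form \<open>a \<cdot> (b \<cdot> x) = c \<cdot> x\<close>, which \<open>reassoc\<close> provides.
\<close>

lemmas arrows = Hom_def Cmp_Arr Cmp_assoc_right Idt_Arr Zer_Arr unit_Arr zero_Arr

lemma reassoc:
  assumes "a \<cdot> b = c" "a \<in> Arr C" "b \<in> Arr C" "x \<in> Arr C" "Cod C b = Dom C a" "Cod C x = Dom C b"
  shows "a \<cdot> (b \<cdot> x) = c \<cdot> x"
  using Cmp_assoc_right[of x b a] assms by simp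

lemma mono_iff:
  assumes f: "f \<in> Hom C X Y"
  shows "f \<in> Monos C X Y \<longleftrightarrow> (\<forall>W. \<forall>u\<in>Hom C W X. f \<cdot> u = Zer C W Y \<longrightarrow> u = Zer C W X)"
proof -
  have fD: "f \<in> Arr C" "Dom C f = X" "Cod C f = Y" using f by (auto simp: Hom_def)
  show ?thesis
  proof
    assume m: "f \<in> Monos C X Y"
    show "\<forall>W. \<forall>u\<in>Hom C W X. f \<cdot> u = Zer C W Y \<longrightarrow> u = Zer C W X"
    proof (intro allI ballI impI)
      fix W u assume u: "u \<in> Hom C W X" "f \<cdot> u = Zer C W Y"
      have "f \<cdot> u = f \<cdot> Zer C W X" "Zer C W X \<in> Hom C W X"
        using u Cmp_Zer[OF f] Hom_Obj[OF u(1)] Zer_Hom by auto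
      then show "u = Zer C W X" using m u fD by (auto simp: Monos_def is_mono_def)
    qed
  next
    assume r: "\<forall>W. \<forall>u\<in>Hom C W X. f \<cdot> u = Zer C W Y \<longrightarrow> u = Zer C W X"
    have "u = v" if uv: "u \<in> Hom C W X" "v \<in> Hom C W X" "f \<cdot> u = f \<cdot> v" for W u v
    proof -
      have W: "W \<in> Obj C" using uv Hom_Obj by blast
      obtain w where w: "w \<in> Hom C W X" "Add C v w = Zer C W X" using ex_neg[OF uv(2)] by blast
      have "f \<cdot> Add C u w = f \<cdot> Add C v w" 
        using Cmp_Add[OF uv(1) w(1) f] Cmp_Add[OF uv(2) w(1) f] uv(3) by simp
      also have "\<dots> = Zer C W Y" using w Cmp_Zer[OF f W] by simp
      finally have "Add C u w = Zer C W X" using r Add_Hom[OF uv(1) w(1)] by blast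
      then have "Add C w u = Add C w v" using w(2) Add_comm uv w by simp
      then show ?thesis by (rule Add_cancel[OF w(1) uv(1,2)])
    qed
    then show "f \<in> Monos C X Y" using f fD by (auto simp: Monos_def is_mono_def)
  qed
qed

lemma epi_iff:
  assumes f: "f \<in> Hom C X Y"
  shows "f \<in> Epis C X Y \<longleftrightarrow> (\<forall>W. \<forall>u\<in>Hom C Y W. u \<cdot> f = Zer C X W \<longrightarrow> u = Zer C Y W)"
  using preadditive_category.mono_iff[OF preadditive_opp[OF preadditive_category_axioms], of f Y X] f
  by simp

lemma mono_cancel0: "f \<in> Monos C X Y \<Longrightarrow> u \<in> Hom C W X \<Longrightarrow> f \<cdot> u = Zer C W Y \<Longrightarrow> u = Zer C W X"
  using mono_iff MonoD by blast

lemma epi_cancel0: "f \<in> Epis C X Y \<Longrightarrow> u \<in> Hom C Y W \<Longrightarrow> u \<cdot> f = Zer C X W \<Longrightarrow> u = Zer C Y W"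
  using epi_iff EpiD by blast

lemma mono_cancel:
  "f \<in> Monos C X Y \<Longrightarrow> u \<in> Hom C W X \<Longrightarrow> v \<in> Hom C W X \<Longrightarrow> f \<cdot> u = f \<cdot> v \<Longrightarrow> u = v"
  by (auto simp: Monos_def is_mono_def Hom_def)

lemma epi_cancel:
  "f \<in> Epis C X Y \<Longrightarrow> u \<in> Hom C Y W \<Longrightarrow> v \<in> Hom C Y W \<Longrightarrow> u \<cdot> f = v \<cdot> f \<Longrightarrow> u = v"
  by (auto simp: Epis_def is_epi_def Hom_def)

lemma mono_right: 
  assumes "f \<in> Hom C X Y" "g \<in> Hom C Y Z" "g \<cdot> f \<in> Monos C X Z" shows "f \<in> Monos C X Y"
proof -
  have "u = Zer C W X" if u: "u \<in> Hom C W X" "f \<cdot> u = Zer C W Y" for W u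
  proof -
    have "W \<in> Obj C" using u Hom_Obj by blast
    then have "g \<cdot> f \<cdot> u = Zer C W Z" using u Cmp_assoc[OF u(1) assms(1,2)] Cmp_Zer[OF assms(2)] by simp
    then show ?thesis using mono_cancel0 assms u by blast
  qed
  then show ?thesis using mono_iff assms by blast
qed

lemma epi_left: 
  assumes "f \<in> Hom C X Y" "g \<in> Hom C Y Z" "g \<cdot> f \<in> Epis C X Z" shows "g \<in> Epis C Y Z"
  using preadditive_category.mono_right[OF preadditive_opp[OF preadditive_category_axioms], of g Z Y f X] assms
  by simp

lemma mono_Cmp: 
  assumes "f \<in> Monos C X Y" "g \<in> Monos C Y Z" shows "g \<cdot> f \<in> Monos C X Z"
proof -
  note H = MonoD[OF assms(1)] MonoD[OF assms(2)]
  have "u = Zer C W X" if u: "u \<in> Hom C W X" "g \<cdot> f \<cdot> u = Zer C W Z" for W u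
  proof -
    have "g \<cdot> (f \<cdot> u) = Zer C W Z" using u Cmp_assoc[OF u(1) H] by simp
    then have "f \<cdot> u = Zer C W Y" by (rule mono_cancel0[OF assms(2) Cmp_Hom[OF u(1) H(1)]])
    then show ?thesis by (rule mono_cancel0[OF assms(1) u(1)])
  qed
  then show ?thesis using mono_iff[OF Cmp_Hom[OF H]] by blast
qed

lemma epi_Cmp: 
  assumes "f \<in> Epis C X Y" "g \<in> Epis C Y Z" shows "g \<cdot> f \<in> Epis C X Z"
  using preadditive_category.mono_Cmp[OF preadditive_opp[OF preadditive_category_axioms], of g Z Y f X] assms
  by simp

lemma isoI:
  assumes "f \<in> Hom C X Y" "g \<in> Hom C Y X" "g \<cdot> f = Idt C X" "f \<cdot> g = Idt C Y"
  shows "f \<in> Isos C X Y"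
  using assms by (auto simp: Isos_def is_iso_def Hom_def)

lemma iso_inv:
  assumes "f \<in> Isos C X Y"
  obtains g where "g \<in> Isos C Y X" "g \<cdot> f = Idt C X" "f \<cdot> g = Idt C Y"
proof -
  have f: "f \<in> Hom C X Y" using assms IsoD by blast
  obtain g where "g \<in> Hom C Y X" "g \<cdot> f = Idt C X" "f \<cdot> g = Idt C Y"
    using assms by (auto simp: Isos_def is_iso_def Hom_def)
  then show ?thesis using that isoI f by metis
qed

lemma iso_mono: assumes "f \<in> Isos C X Y" shows "f \<in> Monos C X Y"
proof -
  obtain g where g: "g \<in> Isos C Y X" "g \<cdot> f = Idt C X" "f \<cdot> g = Idt C Y" using iso_inv[OF assms] by blast
  note H = IsoD[OF assms] IsoD[OF g(1)]
  have "u = Zer C W X" if u: "u \<in> Hom C W X" "f \<cdot> u = Zer C W Y" for W u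
  proof -
    have "W \<in> Obj C" using u Hom_Obj by blast
    moreover have "u = g \<cdot> (f \<cdot> u)" using Cmp_assoc[OF u(1) H] g Idt_Cmp[OF u(1)] by simp
    ultimately show ?thesis using Cmp_Zer[OF H(2)] u by simp
  qed
  then show ?thesis using mono_iff[OF H(1)] by blast
qed

lemma iso_epi: assumes "f \<in> Isos C X Y" shows "f \<in> Epis C X Y"
  using preadditive_category.iso_mono[OF preadditive_opp[OF preadditive_category_axioms], of f Y X] assms
  by simp

lemma Idt_iso: "X \<in> Obj C \<Longrightarrow> Idt C X \<in> Isos C X X"
  by (rule isoI) (auto intro: Idt_Hom simp: Cmp_Idt[OF Idt_Hom])

lemma iso_rel_iff: "(X, Y) \<in> iso_rel C \<longleftrightarrow> (\<exists>f. f \<in> Isos C X Y)"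
  using Hom_Obj by (auto simp: iso_rel_def Isos_def)

lemma iso_Cmp: assumes f: "f \<in> Isos C X Y" and g: "g \<in> Isos C Y Z" shows "g \<cdot> f \<in> Isos C X Z"
proof -
  obtain f' where f': "f' \<in> Isos C Y X" "f' \<cdot> f = Idt C X" "f \<cdot> f' = Idt C Y" using iso_inv[OF f] by blast
  obtain g' where g': "g' \<in> Isos C Z Y" "g' \<cdot> g = Idt C Y" "g \<cdot> g' = Idt C Z" using iso_inv[OF g] by blast
  note H = IsoD[OF f] IsoD[OF g] IsoD[OF f'(1)] IsoD[OF g'(1)]
  show ?thesis
    by (rule isoI[of _ _ _ "f' \<cdot> g'"])
      (use H f'(2,3) g'(2,3) in \<open>simp_all add: arrows f'(3)[THEN reassoc] g'(2)[THEN reassoc]\<close>)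
qed

lemma equiv_iso_rel: "equiv (Obj C) (iso_rel C)"
proof (rule equivI)
  show "iso_rel C \<subseteq> Obj C \<times> Obj C" by (auto simp: iso_rel_def)
  show "refl_on (Obj C) (iso_rel C)"
    using Idt_iso iso_rel_iff by (auto simp: refl_on_def) 
  show "sym (iso_rel C)" using iso_rel_iff iso_inv by (metis symI)
  show "trans (iso_rel C)" using iso_rel_iff iso_Cmp by (metis transI)
qed

text \<open>
  A zero object can be recognized without quantifying over other objects, because an arrow factors
  through the identities of its ends.
\<close>

lemma zero_obj_iff: "zero_obj C Z \<longleftrightarrow> Z \<in> Obj C \<and> Idt C Z = Zer C Z Z"
proof
  assume "zero_obj C Z"
  then show "Z \<in> Obj C \<and> Idt C Z = Zer C Z Z"
    using Zer_Hom Idt_Hom unfolding zero_obj_def by blast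
next
  assume z: "Z \<in> Obj C \<and> Idt C Z = Zer C Z Z"
  have "f = Zer C Z X" if "f \<in> Hom C Z X" for f X
    using Cmp_Idt[OF that] z Cmp_Zer[OF that] by simp
  moreover have "f = Zer C X Z" if "f \<in> Hom C X Z" for f X
    using Idt_Cmp[OF that] z Zer_Cmp[OF that] by simp
  ultimately show "zero_obj C Z" using z Zer_Hom unfolding zero_obj_def by metis
qed

lemma zero_objD: assumes "zero_obj C Z"
  shows "f \<in> Hom C Z X \<Longrightarrow> f = Zer C Z X" "f \<in> Hom C X Z \<Longrightarrow> f = Zer C X Z" 
  using assms Zer_Hom Hom_Obj unfolding zero_obj_def by metis+

lemma zero_mono: assumes "zero_obj C Z" "X \<in> Obj C" shows "Zer C Z X \<in> Monos C Z X"
  using mono_iff[OF Zer_Hom] zero_objD(2)[OF assms(1)] assms zero_obj_iff by blast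

lemma mono_to_zero: assumes "f \<in> Monos C X Z" "f = Zer C X Z" shows "zero_obj C X"
proof -
  have X: "X \<in> Obj C" using assms MonoD Hom_Obj by blast
  have "f \<cdot> Idt C X = Zer C X Z" using assms Cmp_Idt MonoD by metis
  then show ?thesis using mono_cancel0[OF assms(1) Idt_Hom[OF X]] zero_obj_iff X by simp
qed

lemma epi_from_zero: "f \<in> Epis C Z X \<Longrightarrow> f = Zer C Z X \<Longrightarrow> zero_obj C X"
  using preadditive_category.mono_to_zero[OF preadditive_opp[OF preadditive_category_axioms], of f X Z]
  by simp

end

context abelian_category
begin

lemmas op = abelian_opp[OF abelian_category_axioms]

lemma kernel_mono: assumes "is_kernel C f k" shows "is_mono C k"
proof -
  obtain X Y K where f: "f \<in> Hom C X Y" and k: "k \<in> Hom C K X" and fk: "f \<cdot> k = Zer C K Y"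
    and univ: "\<And>W h. h \<in> Hom C W X \<Longrightarrow> f \<cdot> h = Zer C W Y \<Longrightarrow> \<exists>!u. u \<in> Hom C W K \<and> k \<cdot> u = h"
    using assms by (auto simp: is_kernel_def Hom_def)
  have "k \<in> Monos C K X"
    unfolding mono_iff[OF k]
  proof (intro allI ballI impI)
    fix W u assume u: "u \<in> Hom C W K" "k \<cdot> u = Zer C W X"
    have W: "W \<in> Obj C" "K \<in> Obj C" "X \<in> Obj C" using u k Hom_Obj by auto
    have z: "Zer C W X \<in> Hom C W X" "f \<cdot> Zer C W X = Zer C W Y" "Zer C W K \<in> Hom C W K"
      "k \<cdot> Zer C W K = Zer C W X" using W Zer_Hom Cmp_Zer f k by auto
    show "u = Zer C W K" using univ[OF z(1,2)] z u by blast
  qed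
  then show ?thesis by (simp add: Monos_def)
qed

lemma is_kernelD:
  assumes "is_kernel C f k" "f \<in> Hom C X Y"
  shows "k \<in> Monos C (Dom C k) X" "f \<cdot> k = Zer C (Dom C k) Y"
    "h \<in> Hom C W X \<Longrightarrow> f \<cdot> h = Zer C W Y \<Longrightarrow> \<exists>u\<in>Hom C W (Dom C k). k \<cdot> u = h"
proof -
  have D: "Dom C f = X" "Cod C f = Y" using assms by (auto simp: Hom_def)
  show "k \<in> Monos C (Dom C k) X" using kernel_mono[OF assms(1)] assms D by (auto simp: Monos_def Hom_def is_kernel_def)
  show "f \<cdot> k = Zer C (Dom C k) Y" using assms D by (auto simp: is_kernel_def)
  assume "h \<in> Hom C W X" "f \<cdot> h = Zer C W Y"
  then have "\<exists>!u. u \<in> Hom C W (Dom C k) \<and> k \<cdot> u = h" using assms(1) D unfolding is_kernel_def by blast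
  then show "\<exists>u\<in>Hom C W (Dom C k). k \<cdot> u = h" by blast
qed

lemma is_cokernelD:
  assumes "is_cokernel C f k" "f \<in> Hom C X Y"
  shows "k \<in> Epis C Y (Cod C k)" "k \<cdot> f = Zer C X (Cod C k)"
    "h \<in> Hom C Y W \<Longrightarrow> h \<cdot> f = Zer C X W \<Longrightarrow> \<exists>u\<in>Hom C (Cod C k) W. u \<cdot> k = h"
  using abelian_category.is_kernelD[OF op, of f k Y X] assms by simp_all

lemma sesD:
  assumes "ses C i p X Y Z"
  shows "i \<in> Monos C X Y" "p \<in> Epis C Y Z" "p \<cdot> i = Zer C X Z"
    "i \<in> Hom C X Y" "p \<in> Hom C Y Z" "X \<in> Obj C" "Y \<in> Obj C" "Z \<in> Obj C"
proof -
  show *: "i \<in> Hom C X Y" "p \<in> Hom C Y Z" using assms by (auto simp: ses_def)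
  show "i \<in> Monos C X Y" using assms kernel_mono by (auto simp: ses_def Monos_def short_exact_def)
  show "p \<in> Epis C Y Z" using assms abelian_category.kernel_mono[OF op, of i p] 
    by (auto simp: ses_def Epis_def short_exact_def)
  show "p \<cdot> i = Zer C X Z"
    using assms by (auto simp: ses_def short_exact_def is_kernel_def Hom_def)
  show "X \<in> Obj C" "Y \<in> Obj C" "Z \<in> Obj C" using * Hom_Obj by auto
qed

lemma ses_lift:
  assumes s: "ses C i p X Y Z" and h: "h \<in> Hom C W Y" "p \<cdot> h = Zer C W Z"
  obtains u where "u \<in> Hom C W X" "i \<cdot> u = h"
proof -
  have "Dom C p = Y" "Cod C p = Z" "Dom C i = X" using s by (auto simp: ses_def Hom_def)
  moreover have "is_kernel C p i" using s by (simp add: ses_def short_exact_def)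
  ultimately have "\<exists>!u. u \<in> Hom C W X \<and> i \<cdot> u = h"
    using h unfolding is_kernel_def by blast
  then show ?thesis using that by blast
qed

lemma ses_desc:
  assumes "ses C i p X Y Z" "h \<in> Hom C Y W" "h \<cdot> i = Zer C X W"
  obtains u where "u \<in> Hom C Z W" "u \<cdot> p = h"
  using abelian_category.ses_lift[OF op, of p i Z Y X h W thesis] assms that by simp

lemma kernel_of:
  assumes f: "f \<in> Hom C X Y"
  obtains K k where "k \<in> Monos C K X" "f \<cdot> k = Zer C K Y" "is_kernel C f k"
    "\<And>W h. h \<in> Hom C W X \<Longrightarrow> f \<cdot> h = Zer C W Y \<Longrightarrow> \<exists>u\<in>Hom C W K. k \<cdot> u = h"
proof -
  have "f \<in> Arr C" using f by (simp add: Hom_def)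
  then obtain k where k: "is_kernel C f k" using ex_kernel by blast
  then show ?thesis using that is_kernelD[OF k f] by blast
qed

lemma is_kernelI:
  assumes f: "f \<in> Hom C X Y" and k: "k \<in> Monos C K X" "f \<cdot> k = Zer C K Y"
    and l: "\<And>W h. h \<in> Hom C W X \<Longrightarrow> f \<cdot> h = Zer C W Y \<Longrightarrow> \<exists>u\<in>Hom C W K. k \<cdot> u = h"
  shows "is_kernel C f k"
proof -
  have "f \<in> Arr C" "k \<in> Arr C" "Cod C k = X" "Dom C k = K" "Dom C f = X" "Cod C f = Y"
    using f MonoD[OF k(1)] by (auto simp: Hom_def)
  then show ?thesis
    using k(2) l mono_cancel[OF k(1)] unfolding is_kernel_def by (simp; blast)
qed

text \<open>
  A monomorphism is a kernel of some arrow \<open>g\<close>, and \<open>g\<close> factors through the cokernel; hence a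
  monomorphism is a kernel of its own cokernel.
\<close>

lemma ses_of_mono:
  assumes i: "i \<in> Monos C X Y"
  obtains Z p where "ses C i p X Y Z"
proof -
  have iH: "i \<in> Hom C X Y" using i MonoD by blast
  obtain g where g: "is_kernel C g i" using mono_is_kernel i by (auto simp: Monos_def)
  then obtain V where gH: "g \<in> Hom C Y V" and gi: "g \<cdot> i = Zer C X V" 
    using iH by (auto simp: is_kernel_def Hom_def)
  have gl: "\<exists>u\<in>Hom C W X. i \<cdot> u = h" if "h \<in> Hom C W Y" "g \<cdot> h = Zer C W V" for W h
    using is_kernelD(3)[OF g gH] that iH by (auto simp: Hom_def)
  obtain c where c: "is_cokernel C i c" using ex_cokernel iH by (auto simp: Hom_def)
  then obtain Z where cH: "c \<in> Hom C Y Z" and ci: "c \<cdot> i = Zer C X Z" 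
    using iH by (auto simp: is_cokernel_def Hom_def)
  obtain g' where g': "g' \<in> Hom C Z V" "g' \<cdot> c = g"
    using is_cokernelD(3)[OF c iH gH gi] cH by (auto simp: Hom_def)
  have "\<exists>u\<in>Hom C W X. i \<cdot> u = h" if h: "h \<in> Hom C W Y" "c \<cdot> h = Zer C W Z" for W h
  proof (rule gl[OF h(1)])
    show "g \<cdot> h = Zer C W V" using g' h cH Cmp_assoc Cmp_Zer Hom_Obj by metis
  qed
  then have "is_kernel C c i" using is_kernelI[OF cH i ci] by blast
  then have "ses C i c X Y Z" using c iH cH by (simp add: ses_def short_exact_def)
  then show ?thesis using that by blast
qed

lemma ses_of_epi:
  assumes "p \<in> Epis C Y Z"
  obtains X i where "ses C i p X Y Z"
  using abelian_category.ses_of_mono[OF op, of p Z Y thesis] assms that by simp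

lemma sesI:
  assumes i: "i \<in> Monos C X Y" and p: "p \<in> Epis C Y Z" and pi: "p \<cdot> i = Zer C X Z"
    and l: "\<And>W h. h \<in> Hom C W Y \<Longrightarrow> p \<cdot> h = Zer C W Z \<Longrightarrow> \<exists>u\<in>Hom C W X. i \<cdot> u = h"
  shows "ses C i p X Y Z"
proof -
  have iH: "i \<in> Hom C X Y" and pH: "p \<in> Hom C Y Z" using i p MonoD EpiD by auto
  obtain J j where j: "ses C j p J Y Z" using ses_of_epi p by blast
  obtain u where u: "u \<in> Hom C J X" "i \<cdot> u = j" using l sesD[OF j] by metis
  have ui: "\<exists>v\<in>Hom C Z W. v \<cdot> p = h" if h: "h \<in> Hom C Y W" "h \<cdot> i = Zer C X W" for h W
  proof -
    have "h \<cdot> j = Zer C J W" using u h iH Cmp_assoc Zer_Cmp Hom_Obj by metis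
    then show ?thesis using ses_desc[OF j h(1)] by metis
  qed
  have "is_cokernel C i p"
    using abelian_category.is_kernelI[OF op, of i Y X p Z] iH p pi ui by simp
  moreover have "is_kernel C p i" using is_kernelI[OF pH i pi l] by blast
  ultimately show ?thesis using iH pH by (simp add: ses_def short_exact_def)
qed

lemma sesI':
  assumes "i \<in> Monos C X Y" and "p \<in> Epis C Y Z" and "p \<cdot> i = Zer C X Z"
    and "\<And>W h. h \<in> Hom C Y W \<Longrightarrow> h \<cdot> i = Zer C X W \<Longrightarrow> \<exists>u\<in>Hom C Z W. u \<cdot> p = h"
  shows "ses C i p X Y Z"
  using abelian_category.sesI[OF op, of p Z Y i X] assms by simp

lemma balanced:
  assumes m: "f \<in> Monos C X Y" and e: "f \<in> Epis C X Y" shows "f \<in> Isos C X Y"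
proof -
  have f: "f \<in> Hom C X Y" and XY: "X \<in> Obj C" "Y \<in> Obj C" using m MonoD Hom_Obj by blast+
  obtain Z c where c: "ses C f c X Y Z" using ses_of_mono m by blast
  note D = sesD[OF c]
  have "c = Zer C Y Z" by (rule epi_cancel0[OF e D(5,3)])
  then have "c \<cdot> Idt C Y = Zer C Y Z" using D(5) by (simp add: arrows)
  then obtain u where u: "u \<in> Hom C Y X" "f \<cdot> u = Idt C Y" using ses_lift[OF c Idt_Hom[OF XY(2)]] by blast
  have "u \<cdot> f = Idt C X"
    by (rule mono_cancel[OF m]) (use f u XY in \<open>simp_all add: arrows u(2)[THEN reassoc]\<close>)
  then show ?thesis using isoI f u by blast
qed

text \<open>
  The coimage factorization: \<open>f\<close> induces an arrow \<open>m\<close> on the cokernel of its kernel, and in an abelian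
  category \<open>m\<close> is mono, so \<open>I\<close> is the image of \<open>f\<close>.
\<close>

lemma factorization:
  assumes f: "f \<in> Hom C X Y"
  obtains K k I e m where "ses C k e K X I" "m \<in> Monos C I Y" "m \<cdot> e = f" 
    "f \<cdot> k = Zer C K Y" "is_kernel C f k"
proof -
  obtain K k where k: "k \<in> Monos C K X" "f \<cdot> k = Zer C K Y" "is_kernel C f k" and
    kl: "\<And>W h. h \<in> Hom C W X \<Longrightarrow> f \<cdot> h = Zer C W Y \<Longrightarrow> \<exists>u\<in>Hom C W K. k \<cdot> u = h"
    using kernel_of[OF f] by metis
  obtain I e where e: "ses C k e K X I" using ses_of_mono k by blast
  note eD = sesD[OF e]
  obtain m where m: "m \<in> Hom C I Y" "m \<cdot> e = f" using ses_desc[OF e f k(2)] by blast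
  have "u = Zer C W I" if u: "u \<in> Hom C W I" "m \<cdot> u = Zer C W Y" for W u
  proof -
    \<comment> \<open>If \<open>q\<close> is a cokernel of \<open>u\<close>, then \<open>q \<cdot> e\<close> has the same kernel as \<open>e\<close>, hence \<open>q\<close> is split mono.\<close>
    obtain q Q where q: "is_cokernel C u q" "q \<in> Hom C I Q" "q \<cdot> u = Zer C W Q"
      using ex_cokernel[of u] u(1) unfolding is_cokernel_def Hom_def by auto
    have WQ: "W \<in> Obj C" "Q \<in> Obj C" "Y \<in> Obj C" using u q f Hom_Obj by blast+
    have "is_epi C q" using abelian_category.kernel_mono[OF op, of u q] q by simp
    then have qe: "q \<in> Epis C I Q" using q by (simp add: Epis_def)
    obtain m' where m': "m' \<in> Hom C Q Y" "m' \<cdot> q = m"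
      using is_cokernelD(3)[OF q(1) u(1) m(1) u(2)] q(2) by (auto simp: Hom_def)
    obtain L l where l: "ses C l (q \<cdot> e) L X Q" using ses_of_epi[OF epi_Cmp[OF eD(2) qe]] by blast
    note lD = sesD[OF l]
    have qel: "q \<cdot> (e \<cdot> l) = Zer C L Q" using lD(3,4) eD(5) q(2) by (simp add: arrows)
    have "f \<cdot> l = m' \<cdot> (q \<cdot> (e \<cdot> l))" using m'(1) q(2) eD(5) lD(4) by (simp add: arrows flip: m(2) m'(2))
    also have "\<dots> = Zer C L Y" using qel m' lD(6) by (simp add: arrows)
    finally obtain l' where l': "l' \<in> Hom C L K" "k \<cdot> l' = l" using kl[OF lD(4)] by blast
    have "e \<cdot> l = Zer C L I" using l' eD(3-8) by (auto simp: arrows eD(3)[THEN reassoc])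
    then obtain v where v: "v \<in> Hom C Q I" "v \<cdot> (q \<cdot> e) = e" using ses_desc[OF l eD(5)] by blast
    have "v \<cdot> q = Idt C I"
      by (rule epi_cancel[OF eD(2)]) (use v q eD(3-8) in \<open>simp_all add: arrows\<close>)
    then have "u = v \<cdot> (q \<cdot> u)" using Idt_Cmp[OF u(1)] Cmp_assoc[OF u(1) q(2) v(1)] by simp
    then show ?thesis using q(3) v u WQ by (simp add: arrows)
  qed
  then have "m \<in> Monos C I Y" using mono_iff m by blast
  then show ?thesis using that e m k by blast
qed

lemma image_unique:
  assumes e: "e \<in> Epis C X I" "m \<in> Monos C I Y" and e': "e' \<in> Epis C X I'" "m' \<in> Monos C I' Y"
    and eq: "m \<cdot> e = m' \<cdot> e'"
  obtains v where "v \<in> Isos C I I'" "v \<cdot> e = e'" "m' \<cdot> v = m"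
proof -
  note H = EpiD[OF e(1)] EpiD[OF e'(1)] MonoD[OF e(2)] MonoD[OF e'(2)]
  have Y: "Y \<in> Obj C" using H Hom_Obj by blast
  obtain K k where k: "ses C k e K X I" using ses_of_epi e by blast
  note kD = sesD[OF k]
  have "m' \<cdot> (e' \<cdot> k) = m \<cdot> (e \<cdot> k)" using eq Cmp_assoc[OF kD(4) H(2) H(4)] Cmp_assoc[OF kD(4) H(1) H(3)] by simp
  then have "m' \<cdot> (e' \<cdot> k) = Zer C K Y" using kD H Y by (simp add: arrows)
  then have "e' \<cdot> k = Zer C K I'" by (rule mono_cancel0[OF e'(2) Cmp_Hom[OF kD(4) H(2)]])
  then obtain v where v: "v \<in> Hom C I I'" "v \<cdot> e = e'" using ses_desc[OF k H(2)] by blast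
  have mv: "m' \<cdot> v = m"
    by (rule epi_cancel[OF e(1)]) (use v eq H in \<open>simp_all add: arrows\<close>)
  have "v \<in> Monos C I I'" by (rule mono_right[OF v(1) H(4)]) (use mv e in simp)
  moreover have "v \<in> Epis C I I'" by (rule epi_left[OF H(1) v(1)]) (use v e' in simp)
  ultimately show ?thesis using balanced that v mv by blast
qed

lemma ses_zero_left:
  assumes s: "ses C i p X Y Z" and z: "zero_obj C X" shows "p \<in> Isos C Y Z"
proof -
  note D = sesD[OF s]
  have "u = Zer C W Y" if u: "u \<in> Hom C W Y" "p \<cdot> u = Zer C W Z" for W u
  proof -
    have W: "W \<in> Obj C" using u Hom_Obj by blast
    obtain v where v: "v \<in> Hom C W X" "i \<cdot> v = u" using ses_lift[OF s u] by blast
    then show ?thesis using zero_objD(2)[OF z v(1)] D(4) W by (auto simp: arrows)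
  qed
  then have "p \<in> Monos C Y Z" using mono_iff D by blast
  then show ?thesis using balanced D by blast
qed

lemma ses_zero_right:
  assumes "ses C i p X Y Z" "zero_obj C Z" shows "i \<in> Isos C X Y"
  using abelian_category.ses_zero_left[OF op, of p i Z Y X] assms by simp

text \<open>
  The biproduct axioms only mention the diagonal composites. The cross terms vanish since \<open>q \<cdot> i\<close> is the
  sum of its two components, both of which turn out to be \<open>q \<cdot> i\<close>.
\<close>

lemma biproduct_cross:
  assumes H: "i \<in> Hom C X D" "j \<in> Hom C Y D" "p \<in> Hom C D X" "q \<in> Hom C D Y"
    and bp: "p \<cdot> i = Idt C X" "q \<cdot> j = Idt C Y" "Add C (i \<cdot> p) (j \<cdot> q) = Idt C D"
  shows "q \<cdot> i = Zer C X Y"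
proof -
  have ob: "X \<in> Obj C" "Y \<in> Obj C" "D \<in> Obj C" using H Hom_Obj by blast+
  have h: "q \<cdot> i \<in> Hom C X Y" and H2: "i \<cdot> p \<in> Hom C D D" "j \<cdot> q \<in> Hom C D D"
    using H by (simp_all add: arrows)
  have ip: "i \<cdot> p \<cdot> i = i" and jq: "q \<cdot> (j \<cdot> q \<cdot> i) = q \<cdot> i"
    using H bp ob by (simp_all add: arrows bp(2)[THEN reassoc])
  have "i = Add C (i \<cdot> p \<cdot> i) (j \<cdot> q \<cdot> i)" using Add_Cmp[OF H(1) H2] bp Idt_Cmp[OF H(1)] by simp
  then have "q \<cdot> i = Add C (q \<cdot> i) (q \<cdot> i)" 
    using Cmp_Add[OF H(1) Cmp_Hom[OF H(1) H2(2)] H(4)] ip jq by simp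
  then have "Add C (q \<cdot> i) (q \<cdot> i) = Add C (q \<cdot> i) (Zer C X Y)" using Add_Zer[OF h] by simp
  then show ?thesis by (rule Add_cancel[OF h h Zer_Hom[OF ob(1,2)]])
qed

text \<open>
  The pullback is the kernel of the difference \<open>X \<oplus> Y \<rightarrow> Z\<close>. If \<open>p\<close> is epi, then so is this difference; it
  is therefore the cokernel of the inclusion of the pullback, and this yields that \<open>a\<close> is epi.
\<close>

lemma pullback:
  assumes p: "p \<in> Hom C X Z" and g: "g \<in> Hom C Y Z"
  obtains P a b where "a \<in> Hom C P Y" "b \<in> Hom C P X" "p \<cdot> b = g \<cdot> a"
    "\<And>W x y. x \<in> Hom C W X \<Longrightarrow> y \<in> Hom C W Y \<Longrightarrow> p \<cdot> x = g \<cdot> y \<Longrightarrow>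
       \<exists>u\<in>Hom C W P. b \<cdot> u = x \<and> a \<cdot> u = y"
    "\<And>W u. u \<in> Hom C W P \<Longrightarrow> a \<cdot> u = Zer C W Y \<Longrightarrow> b \<cdot> u = Zer C W X \<Longrightarrow> u = Zer C W P"
    "p \<in> Epis C X Z \<Longrightarrow> a \<in> Epis C P Y"
proof -
  have ob: "X \<in> Obj C" "Y \<in> Obj C" "Z \<in> Obj C" using p g Hom_Obj by auto
  obtain D where D: "D \<in> Obj C" "is_biproduct C X Y D" using ex_biproduct ob by blast
  then obtain i j p1 p2 where H: "i \<in> Hom C X D" "j \<in> Hom C Y D" "p1 \<in> Hom C D X" "p2 \<in> Hom C D Y"
    and bp: "p1 \<cdot> i = Idt C X" "p2 \<cdot> j = Idt C Y" "Add C (i \<cdot> p1) (j \<cdot> p2) = Idt C D"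
    unfolding is_biproduct_def by blast
  have H2: "i \<cdot> p1 \<in> Hom C D D" "j \<cdot> p2 \<in> Hom C D D" using H by (simp_all add: arrows)
  have p2i: "p2 \<cdot> i = Zer C X Y" by (rule biproduct_cross[OF H bp])
  have p1j: "p1 \<cdot> j = Zer C Y X"
    by (rule biproduct_cross[OF H(2,1,4,3) bp(2,1)]) (use bp Add_comm H2 in simp)
  have pp: "p \<cdot> p1 \<in> Hom C D Z" and gp: "g \<cdot> p2 \<in> Hom C D Z" using H p g by (simp_all add: arrows)
  obtain n where n: "n \<in> Hom C D Z" "Add C (g \<cdot> p2) n = Zer C D Z" using ex_neg[OF gp] by blast
  \<comment> \<open>\<open>\<phi>\<close> is the difference of the two maps to \<open>Z\<close>, and the pullback is its kernel.\<close>
  define \<phi> where "\<phi> = Add C (p \<cdot> p1) n"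
  have \<phi>: "\<phi> \<in> Hom C D Z" using Add_Hom[OF pp n(1)] \<phi>_def by simp
  have \<phi>w: "\<phi> \<cdot> w = Zer C W Z \<longleftrightarrow> p \<cdot> (p1 \<cdot> w) = g \<cdot> (p2 \<cdot> w)" if w: "w \<in> Hom C W D" for W w
  proof -
    have h: "p \<cdot> (p1 \<cdot> w) \<in> Hom C W Z" "g \<cdot> (p2 \<cdot> w) \<in> Hom C W Z" "n \<cdot> w \<in> Hom C W Z"
      using H p g n(1) w by (simp_all add: arrows)
    have 1: "\<phi> \<cdot> w = Add C (p \<cdot> (p1 \<cdot> w)) (n \<cdot> w)" 
      unfolding \<phi>_def using Add_Cmp[OF w pp n(1)] Cmp_assoc[OF w H(3) p] by simp
    have 2: "Add C (g \<cdot> (p2 \<cdot> w)) (n \<cdot> w) = Zer C W Z"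
      using Add_Cmp[OF w gp n(1)] n Cmp_assoc[OF w H(4) g] Zer_Cmp[OF w ob(3)] by simp
    have "p \<cdot> (p1 \<cdot> w) = g \<cdot> (p2 \<cdot> w)" if "\<phi> \<cdot> w = Zer C W Z"
      by (rule Add_cancel[OF h(3,1,2)]) (use that 1 2 Add_comm h in simp)
    then show ?thesis using 1 2 by metis
  qed
  obtain P k where k: "k \<in> Monos C P D" "\<phi> \<cdot> k = Zer C P Z" and
    kl: "\<And>W h. h \<in> Hom C W D \<Longrightarrow> \<phi> \<cdot> h = Zer C W Z \<Longrightarrow> \<exists>u\<in>Hom C W P. k \<cdot> u = h"
    using kernel_of[OF \<phi>] by metis
  have kH: "k \<in> Hom C P D" using k MonoD by blast
  show thesis
  proof (rule that[of "p2 \<cdot> k" P "p1 \<cdot> k"])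
    show "p2 \<cdot> k \<in> Hom C P Y" "p1 \<cdot> k \<in> Hom C P X" using kH H by (simp_all add: arrows)
    show "p \<cdot> (p1 \<cdot> k) = g \<cdot> (p2 \<cdot> k)" using \<phi>w kH k by blast
  next
    fix W x y assume x: "x \<in> Hom C W X" and y: "y \<in> Hom C W Y" and xy: "p \<cdot> x = g \<cdot> y"
    define w where "w = Add C (i \<cdot> x) (j \<cdot> y)"
    have h: "i \<cdot> x \<in> Hom C W D" "j \<cdot> y \<in> Hom C W D" using H x y by (simp_all add: arrows)
    then have w: "w \<in> Hom C W D" using Add_Hom w_def by simp
    have W: "W \<in> Obj C" using x Hom_Obj by blast
    have e: "p1 \<cdot> (i \<cdot> x) = x" "p1 \<cdot> (j \<cdot> y) = Zer C W X" "p2 \<cdot> (i \<cdot> x) = Zer C W Y" "p2 \<cdot> (j \<cdot> y) = y"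
      using H x y ob by (simp_all add: arrows bp(1,2)[THEN reassoc] p2i[THEN reassoc] p1j[THEN reassoc])
    have w12: "p1 \<cdot> w = x" "p2 \<cdot> w = y"
      unfolding w_def using Cmp_Add[OF h H(3)] Cmp_Add[OF h H(4)] e Add_Zer[OF x] Add_Zer[OF y] by simp_all
    then have "\<phi> \<cdot> w = Zer C W Z" using \<phi>w[OF w] xy by simp
    then obtain u where u: "u \<in> Hom C W P" "k \<cdot> u = w" using kl w by blast
    then show "\<exists>u\<in>Hom C W P. p1 \<cdot> k \<cdot> u = x \<and> p2 \<cdot> k \<cdot> u = y"
      using w12 Cmp_assoc[OF u(1) kH H(3)] Cmp_assoc[OF u(1) kH H(4)] by auto
  next
    fix W u assume u: "u \<in> Hom C W P" "p2 \<cdot> k \<cdot> u = Zer C W Y" "p1 \<cdot> k \<cdot> u = Zer C W X"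
    have ku: "k \<cdot> u \<in> Hom C W D" using Cmp_Hom[OF u(1) kH] .
    have W: "W \<in> Obj C" using u Hom_Obj by blast
    have p0: "p1 \<cdot> (k \<cdot> u) = Zer C W X" "p2 \<cdot> (k \<cdot> u) = Zer C W Y"
      using u Cmp_assoc[OF u(1) kH H(3)] Cmp_assoc[OF u(1) kH H(4)] by simp_all
    have "k \<cdot> u = Add C (i \<cdot> p1 \<cdot> (k \<cdot> u)) (j \<cdot> p2 \<cdot> (k \<cdot> u))" 
      using bp Add_Cmp[OF ku H2] Idt_Cmp[OF ku] by simp
    also have "\<dots> = Add C (i \<cdot> Zer C W X) (j \<cdot> Zer C W Y)"
      using Cmp_assoc[OF ku H(3,1)] Cmp_assoc[OF ku H(4,2)] p0 by simp
    also have "\<dots> = Zer C W D" using Cmp_Zer[OF H(1) W] Cmp_Zer[OF H(2) W] Add_Zer[OF Zer_Hom[OF W D(1)]] by simp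
    finally show "u = Zer C W P" by (rule mono_cancel0[OF k(1) u(1)])
  next
    assume pe: "p \<in> Epis C X Z"
    have "n \<cdot> i = Zer C X Z"
    proof -
      have "g \<cdot> p2 \<cdot> i = Zer C X Z" using H g ob p2i by (simp add: arrows)
      moreover have "Add C (g \<cdot> p2 \<cdot> i) (n \<cdot> i) = Zer C X Z" 
        using Add_Cmp[OF H(1) gp n(1)] n Zer_Cmp[OF H(1) ob(3)] by simp
      ultimately show ?thesis using Add_Zer(2)[OF Cmp_Hom[OF H(1) n(1)]] by simp
    qed
    moreover have "p \<cdot> p1 \<cdot> i = p" using H p bp by (simp add: arrows)
    ultimately have p1i: "\<phi> \<cdot> i = p" unfolding \<phi>_def using Add_Cmp[OF H(1) pp n(1)] Add_Zer(1)[OF p] by simp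
    have "\<phi> \<in> Epis C D Z" by (rule epi_left[OF H(1) \<phi>]) (use p1i pe in simp)
    then have s: "ses C k \<phi> P D Z" using sesI k kl by blast
    show "p2 \<cdot> k \<in> Epis C P Y"
      unfolding epi_iff[OF Cmp_Hom[OF kH H(4)]]
    proof (intro allI ballI impI)
      fix W w assume w: "w \<in> Hom C Y W" "w \<cdot> (p2 \<cdot> k) = Zer C P W"
      have wH: "w \<cdot> p2 \<in> Hom C D W" using Cmp_Hom[OF H(4) w(1)] .
      have W: "W \<in> Obj C" using w Hom_Obj by blast
      have "w \<cdot> p2 \<cdot> k = Zer C P W" using w Cmp_assoc[OF kH H(4) w(1)] by simp
      then obtain v where v: "v \<in> Hom C Z W" "v \<cdot> \<phi> = w \<cdot> p2" using ses_desc[OF s wH] by blast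
      have "v \<cdot> p = w \<cdot> p2 \<cdot> i" using p1i v(2) Cmp_assoc[OF H(1) \<phi> v(1)] by simp
      also have "\<dots> = Zer C X W" using w(1) H p2i ob by (simp add: arrows)
      finally have "v = Zer C Z W" using epi_cancel0[OF pe v(1)] by blast
      then have "w \<cdot> p2 = Zer C D W" using v Zer_Cmp[OF \<phi> W] by simp
      then have "w \<cdot> p2 \<cdot> j = Zer C Y W" using Zer_Cmp[OF H(2) W] by simp
      then show "w = Zer C Y W" using w(1) H bp by (simp add: arrows)
    qed
  qed
qed

text \<open>
  Arrows into \<open>Z\<close> serve as generalized elements of \<open>Z\<close>. They have preimages under \<open>p\<close> after passing to an
  epimorphic cover of their domain, which suffices for checking that an arrow is mono.
\<close>

lemma epi_cover:
  assumes "p \<in> Epis C Y Z" "u \<in> Hom C W Z"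
  obtains W' \<epsilon> y where "\<epsilon> \<in> Epis C W' W" "y \<in> Hom C W' Y" "p \<cdot> y = u \<cdot> \<epsilon>"
  using pullback[OF EpiD[OF assms(1)] assms(2)] assms(1) by metis

lemma pullback_ses:
  assumes s: "ses C i p X Y Z" and g: "g \<in> Hom C W Z"
  obtains P i' p' g' where "ses C i' p' X P W" "g' \<in> Hom C P Y" "p \<cdot> g' = g \<cdot> p'" "g' \<cdot> i' = i"
    "\<And>V x y. x \<in> Hom C V Y \<Longrightarrow> y \<in> Hom C V W \<Longrightarrow> p \<cdot> x = g \<cdot> y \<Longrightarrow>
       \<exists>u\<in>Hom C V P. g' \<cdot> u = x \<and> p' \<cdot> u = y"
    "\<And>V u. u \<in> Hom C V P \<Longrightarrow> p' \<cdot> u = Zer C V W \<Longrightarrow> g' \<cdot> u = Zer C V Y \<Longrightarrow> u = Zer C V P"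
proof -
  note D = sesD[OF s]
  have W: "W \<in> Obj C" using g Hom_Obj by blast
  obtain P a b where P: "a \<in> Hom C P W" "b \<in> Hom C P Y" "p \<cdot> b = g \<cdot> a"
    and univ: "\<And>V x y. x \<in> Hom C V Y \<Longrightarrow> y \<in> Hom C V W \<Longrightarrow> p \<cdot> x = g \<cdot> y \<Longrightarrow>
       \<exists>u\<in>Hom C V P. b \<cdot> u = x \<and> a \<cdot> u = y"
    and jm: "\<And>V u. u \<in> Hom C V P \<Longrightarrow> a \<cdot> u = Zer C V W \<Longrightarrow> b \<cdot> u = Zer C V Y \<Longrightarrow> u = Zer C V P"
    and pa: "p \<in> Epis C Y Z \<Longrightarrow> a \<in> Epis C P W"
    using pullback[OF D(5) g] by metis
  have ae: "a \<in> Epis C P W" using pa D by blast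
  have "p \<cdot> i = g \<cdot> Zer C X W" using D(3) Cmp_Zer[OF g D(6)] by simp
  then obtain i' where i': "i' \<in> Hom C X P" "b \<cdot> i' = i" "a \<cdot> i' = Zer C X W"
    using univ[OF D(4) Zer_Hom[OF D(6) W]] by blast
  have "i' \<in> Monos C X P" by (rule mono_right[OF i'(1) P(2)]) (use i' D in simp)
  moreover have "\<exists>u\<in>Hom C V X. i' \<cdot> u = h" if h: "h \<in> Hom C V P" "a \<cdot> h = Zer C V W" for V h
  proof -
    have V: "V \<in> Obj C" and PO: "P \<in> Obj C" using h Hom_Obj by blast+
    have bh: "b \<cdot> h \<in> Hom C V Y" using Cmp_Hom[OF h(1) P(2)] .
    have "p \<cdot> (b \<cdot> h) = g \<cdot> (a \<cdot> h)" using P(3) Cmp_assoc[OF h(1) P(2) D(5)] Cmp_assoc[OF h(1) P(1) g] by simp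
    then have "p \<cdot> (b \<cdot> h) = Zer C V Z" using h Cmp_Zer[OF g V] by simp
    then obtain u where u: "u \<in> Hom C V X" "i \<cdot> u = b \<cdot> h" using ses_lift[OF s bh] by blast
    have iu: "i' \<cdot> u \<in> Hom C V P" using Cmp_Hom[OF u(1) i'(1)] .
    have aiu: "a \<cdot> (i' \<cdot> u) = a \<cdot> h" using Cmp_assoc[OF u(1) i'(1) P(1)] i' h(2) Zer_Cmp[OF u(1) W] by simp
    have biu: "b \<cdot> (i' \<cdot> u) = b \<cdot> h" using Cmp_assoc[OF u(1) i'(1) P(2)] i' u by simp
    obtain n where n: "n \<in> Hom C V P" "Add C (i' \<cdot> u) n = Zer C V P" using ex_neg[OF iu] by blast
    define d where "d = Add C h n"
    have d: "d \<in> Hom C V P" using Add_Hom[OF h(1) n(1)] d_def by simp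
    have "a \<cdot> d = Zer C V W" unfolding d_def
      using Cmp_Add[OF h(1) n(1) P(1)] Cmp_Add[OF iu n(1) P(1)] aiu n Cmp_Zer[OF P(1) V] by simp
    moreover have "b \<cdot> d = Zer C V Y" unfolding d_def
      using Cmp_Add[OF h(1) n(1) P(2)] Cmp_Add[OF iu n(1) P(2)] biu n Cmp_Zer[OF P(2) V] by simp
    ultimately have "d = Zer C V P" using jm d by blast
    then have "Add C n (i' \<cdot> u) = Add C n h" 
      unfolding d_def using n(2) Add_comm[OF n(1) iu] Add_comm[OF n(1) h(1)] by simp
    then have "i' \<cdot> u = h" by (rule Add_cancel[OF n(1) iu h(1)])
    then show ?thesis using u by blast
  qed
  ultimately have "ses C i' a X P W" using sesI ae i' by blast
  then show ?thesis using that[of i' a P b] P i' univ jm by blast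
qed

lemma pushout_ses:
  assumes s: "ses C i p X Y Z" and g: "g \<in> Hom C X W"
  obtains P i' p' g' where "ses C i' p' W P Z" "g' \<in> Hom C Y P" "g' \<cdot> i = i' \<cdot> g" "p' \<cdot> g' = p"
proof -
  have "ses (opp C) p i Z Y X" "g \<in> Hom (opp C) W X" using assms by auto
  then show ?thesis 
    by (rule abelian_category.pullback_ses[OF op]) (rule that, auto)
qed

text \<open>
  The third isomorphism theorem \<open>(E / B) / (Z / B) = E / Z\<close> for \<open>B \<subseteq> Z \<subseteq> E\<close>, with the given quotients.
\<close>

lemma third_iso:
  assumes s1: "ses C b q B Z Z'" and s2: "ses C h c Z E Q" and s3: "ses C (h \<cdot> b) d B E E'"
  obtains h' c' where "ses C h' c' Z' E' Q" "h' \<cdot> q = d \<cdot> h" "c' \<cdot> d = c"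
proof -
  note D1 = sesD[OF s1] and D2 = sesD[OF s2] and D3 = sesD[OF s3]
  have dh: "d \<cdot> h \<in> Hom C Z E'" using Cmp_Hom[OF D2(4) D3(5)] .
  have dhb: "d \<cdot> h \<cdot> b = Zer C B E'" using D3(3) Cmp_assoc[OF D1(4) D2(4) D3(5)] by simp
  obtain h' where h': "h' \<in> Hom C Z' E'" "h' \<cdot> q = d \<cdot> h" using ses_desc[OF s1 dh dhb] by blast
  have "c \<cdot> (h \<cdot> b) = Zer C B Q" using D1(4) D2(3-8) by (simp add: arrows D2(3)[THEN reassoc])
  then obtain c' where c': "c' \<in> Hom C E' Q" "c' \<cdot> d = c" using ses_desc[OF s3 D2(5)] by blast
  have c'e: "c' \<in> Epis C E' Q" by (rule epi_left[OF D3(5) c'(1)]) (use c' D2 in simp)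
  have ch: "c' \<cdot> h' = Zer C Z' Q"
  proof (rule epi_cancel0[OF D1(2) Cmp_Hom[OF h'(1) c'(1)]])
    show "c' \<cdot> h' \<cdot> q = Zer C Z Q" using Cmp_assoc[OF D1(5) h'(1) c'(1)] h'(2)
        Cmp_assoc[OF D2(4) D3(5) c'(1)] c'(2) D2(3) by simp
  qed
  have desc: "\<exists>w\<in>Hom C Q V. w \<cdot> c' = v" if v: "v \<in> Hom C E' V" "v \<cdot> h' = Zer C Z' V" for V v
  proof -
    have V: "V \<in> Obj C" using v Hom_Obj by blast
    have vd: "v \<cdot> d \<in> Hom C E V" using Cmp_Hom[OF D3(5) v(1)] .
    have "v \<cdot> d \<cdot> h = v \<cdot> h' \<cdot> q" using Cmp_assoc[OF D2(4) D3(5) v(1)] Cmp_assoc[OF D1(5) h'(1) v(1)] h' by simp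
    then have "v \<cdot> d \<cdot> h = Zer C Z V" using v Zer_Cmp[OF D1(5) V] by simp
    then obtain w where w: "w \<in> Hom C Q V" "w \<cdot> c = v \<cdot> d" using ses_desc[OF s2 vd] by blast
    have "w \<cdot> c' = v"
      by (rule epi_cancel[OF D3(2) Cmp_Hom[OF c'(1) w(1)] v(1)]) (use w c' Cmp_assoc[OF D3(5) c'(1) w(1)] in simp)
    then show ?thesis using w by blast
  qed
  have "u = Zer C W Z'" if u: "u \<in> Hom C W Z'" "h' \<cdot> u = Zer C W E'" for W u
  proof -
    obtain W' \<epsilon> z where z: "\<epsilon> \<in> Epis C W' W" "z \<in> Hom C W' Z" "q \<cdot> z = u \<cdot> \<epsilon>"
      using epi_cover[OF D1(2) u(1)] by blast
    have eH: "\<epsilon> \<in> Hom C W' W" using z EpiD by blast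
    have W': "W' \<in> Obj C" using z Hom_Obj by blast
    have hz: "h \<cdot> z \<in> Hom C W' E" using Cmp_Hom[OF z(2) D2(4)] .
    have "d \<cdot> (h \<cdot> z) = h' \<cdot> (q \<cdot> z)"
      using h'(2) Cmp_assoc[OF z(2) D2(4) D3(5)] Cmp_assoc[OF z(2) D1(5) h'(1)] by simp
    also have "\<dots> = h' \<cdot> u \<cdot> \<epsilon>" using z Cmp_assoc[OF eH u(1) h'(1)] by simp
    also have "\<dots> = Zer C W' E'" using u Zer_Cmp[OF eH D3(8)] by simp
    finally obtain y where y: "y \<in> Hom C W' B" "h \<cdot> b \<cdot> y = h \<cdot> z" using ses_lift[OF s3 hz] by blast
    have "b \<cdot> y = z"
      by (rule mono_cancel[OF D2(1) Cmp_Hom[OF y(1) D1(4)] z(2)]) (use y Cmp_assoc[OF y(1) D1(4) D2(4)] in simp)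
    then have "q \<cdot> z = Zer C W' Z'" using Cmp_assoc[OF y(1) D1(4,5)] D1(3) Zer_Cmp[OF y(1) D1(8)] by simp
    then have "u \<cdot> \<epsilon> = Zer C W' Z'" using z by simp
    then show ?thesis by (rule epi_cancel0[OF z(1) u(1)])
  qed
  then have "h' \<in> Monos C Z' E'" using mono_iff h' by blast
  then have "ses C h' c' Z' E' Q" using sesI' c'e ch desc by blast
  then show ?thesis using that h' c' by blast
qed

lemma third_iso_op:
  assumes "ses C q b Z' Z B" "ses C c h Q E Z" "ses C d (b \<cdot> h) E' E B"
  obtains h' c' where "ses C c' h' Q E' Z'" "q \<cdot> h' = h \<cdot> d" "d \<cdot> c' = c"
  using abelian_category.third_iso[OF op, of b q B Z Z' h c E Q d E' thesis] assms that by simp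

text \<open>
  The second isomorphism theorem for two subobjects \<open>A\<close> and \<open>K\<close> of \<open>L\<close>: the assumption that \<open>g \<cdot> a\<close> is epi
  says \<open>A + K = L\<close>, the kernel \<open>K1\<close> of \<open>g \<cdot> a\<close> is \<open>A \<inter> K\<close>, and so \<open>K / (A \<inter> K) = L / A\<close>.
\<close>

lemma second_iso:
  assumes s1: "ses C a b A L B" and s2: "ses C k g K L I" and s3: "ses C \<kappa> (g \<cdot> a) K1 A I"
  obtains \<mu> where "ses C \<mu> (b \<cdot> k) K1 K B" "k \<cdot> \<mu> = a \<cdot> \<kappa>"
proof -
  note D1 = sesD[OF s1] and D2 = sesD[OF s2] and D3 = sesD[OF s3]
  have ak: "a \<cdot> \<kappa> \<in> Hom C K1 L" and bk: "b \<cdot> k \<in> Hom C K B"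
    using Cmp_Hom[OF D3(4) D1(4)] Cmp_Hom[OF D2(4) D1(5)] by auto
  have "g \<cdot> (a \<cdot> \<kappa>) = Zer C K1 I" using D3(3) Cmp_assoc[OF D3(4) D1(4) D2(5)] by simp
  then obtain \<mu> where \<mu>: "\<mu> \<in> Hom C K1 K" "k \<cdot> \<mu> = a \<cdot> \<kappa>" using ses_lift[OF s2 ak] by blast
  have \<mu>m: "\<mu> \<in> Monos C K1 K"
    by (rule mono_right[OF \<mu>(1) D2(4)]) (use \<mu> mono_Cmp[OF D3(1) D1(1)] in simp)
  have "b \<cdot> k \<cdot> \<mu> = b \<cdot> a \<cdot> \<kappa>" using \<mu> Cmp_assoc[OF \<mu>(1) D2(4) D1(5)] Cmp_assoc[OF D3(4) D1(4,5)] by simp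
  then have b\<mu>: "b \<cdot> k \<cdot> \<mu> = Zer C K1 B" using D1(3) Zer_Cmp[OF D3(4) D1(8)] by simp
  have "v = Zer C B V" if v: "v \<in> Hom C B V" "v \<cdot> (b \<cdot> k) = Zer C K V" for V v
  proof -
    have V: "V \<in> Obj C" using v Hom_Obj by blast
    have vb: "v \<cdot> b \<in> Hom C L V" using Cmp_Hom[OF D1(5) v(1)] .
    have "v \<cdot> b \<cdot> k = Zer C K V" using v Cmp_assoc[OF D2(4) D1(5) v(1)] by simp
    then obtain v' where v': "v' \<in> Hom C I V" "v' \<cdot> g = v \<cdot> b" using ses_desc[OF s2 vb] by blast
    have "v' \<cdot> (g \<cdot> a) = v \<cdot> (b \<cdot> a)"
      using v'(2) Cmp_assoc[OF D1(4) D2(5) v'(1)] Cmp_assoc[OF D1(4,5) v(1)] by simp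
    then have "v' \<cdot> (g \<cdot> a) = Zer C A V" using D1(3) Cmp_Zer[OF v(1) D1(6)] by simp
    then have "v' = Zer C I V" using epi_cancel0[OF D3(2) v'(1)] by blast
    then have "v \<cdot> b = Zer C L V" using v' Zer_Cmp[OF D2(5) V] by simp
    then show ?thesis using epi_cancel0[OF D1(2) v(1)] by blast
  qed
  then have be: "b \<cdot> k \<in> Epis C K B" using epi_iff bk by blast
  have "\<exists>u\<in>Hom C W K1. \<mu> \<cdot> u = w" if w: "w \<in> Hom C W K" "b \<cdot> k \<cdot> w = Zer C W B" for W w
  proof -
    have kw: "k \<cdot> w \<in> Hom C W L" using Cmp_Hom[OF w(1) D2(4)] .
    have "b \<cdot> (k \<cdot> w) = Zer C W B" using w Cmp_assoc[OF w(1) D2(4) D1(5)] by simp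
    then obtain y where y: "y \<in> Hom C W A" "a \<cdot> y = k \<cdot> w" using ses_lift[OF s1 kw] by blast
    have "g \<cdot> a \<cdot> y = g \<cdot> k \<cdot> w" using y Cmp_assoc[OF y(1) D1(4) D2(5)] Cmp_assoc[OF w(1) D2(4,5)] by simp
    then have "g \<cdot> a \<cdot> y = Zer C W I" using D2(3) Zer_Cmp[OF w(1) D2(8)] by simp
    then obtain x where x: "x \<in> Hom C W K1" "\<kappa> \<cdot> x = y" using ses_lift[OF s3 y(1)] by blast
    have "k \<cdot> (\<mu> \<cdot> x) = k \<cdot> w"
      using \<mu> Cmp_assoc[OF x(1) \<mu>(1) D2(4)] Cmp_assoc[OF x(1) D3(4) D1(4)] x y by simp
    then have "\<mu> \<cdot> x = w" by (rule mono_cancel[OF D2(1) Cmp_Hom[OF x(1) \<mu>(1)] w(1)])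
    then show ?thesis using x by blast
  qed
  then have "ses C \<mu> (b \<cdot> k) K1 K B" using sesI \<mu>m be b\<mu> by blast
  then show ?thesis using that \<mu> by blast
qed

end

section \<open>Length\<close>

text \<open>
  What is used of composition length: it does not increase along subobjects and quotients, and stays
  the same only along isomorphisms. This formulation is self-dual, whereas composition series are not.
\<close>

locale abelian_with_length = abelian_category C for C :: "('o, 'm) precat" (structure) +
  fixes len :: "'o \<Rightarrow> nat"
  assumes len_mono: "f \<in> Monos C X Y \<Longrightarrow> len X \<le> len Y"
    and len_mono_iso: "f \<in> Monos C X Y \<Longrightarrow> len X = len Y \<Longrightarrow> f \<in> Isos C X Y"
    and len_epi: "f \<in> Epis C X Y \<Longrightarrow> len Y \<le> len X"
    and len_epi_iso: "f \<in> Epis C X Y \<Longrightarrow> len X = len Y \<Longrightarrow> f \<in> Isos C X Y"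

lemma (in abelian_with_length) with_length_opp: "abelian_with_length (opp C) len"
  by (rule abelian_with_length.intro[OF op], unfold_locales)
    (simp_all add: len_mono len_mono_iso len_epi len_epi_iso)

primrec comp_series :: "('o, 'm) precat \<Rightarrow> nat \<Rightarrow> 'o \<Rightarrow> bool" where
  "comp_series C 0 M \<longleftrightarrow> zero_obj C M"
| "comp_series C (Suc n) M \<longleftrightarrow> (\<exists>X S i p. comp_series C n X \<and> simple_obj C S \<and> ses C i p X M S)"

lemma comp_series_if_has: assumes "has_composition_series C M" shows "\<exists>n. comp_series C n M"
proof -
  obtain n :: nat and X where X: "zero_obj C (X 0)" "X n = M" and
    s: "\<And>k. k < n \<Longrightarrow> \<exists>S i p. simple_obj C S \<and> i \<in> Hom C (X k) (X (Suc k)) \<and> p \<in> Hom C (X (Suc k)) S \<and>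
                       short_exact C i p"
    using assms unfolding has_composition_series_def by blast
  have "k \<le> n \<Longrightarrow> comp_series C k (X k)" for k
  proof (induction k)
    case (Suc k)
    then obtain S i p where "simple_obj C S" "ses C i p (X k) (X (Suc k)) S"
      using s[of k] by (auto simp: ses_def)
    then show ?case using Suc by auto
  qed (use X in simp)
  then show ?thesis using X by auto
qed

context abelian_category
begin

lemma ses_iso_right:
  assumes s: "ses C i p X Y Z" and v: "v \<in> Isos C Z Z'" shows "ses C i (v \<cdot> p) X Y Z'"
proof (rule sesI)
  note D = sesD[OF s] and vH = IsoD[OF v]
  have Z': "Z' \<in> Obj C" using vH Hom_Obj by blast
  show "i \<in> Monos C X Y" by fact
  show "v \<cdot> p \<in> Epis C Y Z'" by (rule epi_Cmp[OF D(2) iso_epi[OF v]])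
  show "v \<cdot> p \<cdot> i = Zer C X Z'" using Cmp_assoc[OF D(4,5) vH] D(3) Cmp_Zer[OF vH D(6)] by simp
  fix W h assume h: "h \<in> Hom C W Y" "v \<cdot> p \<cdot> h = Zer C W Z'"
  then have "v \<cdot> (p \<cdot> h) = Zer C W Z'" using Cmp_assoc[OF h(1) D(5) vH] by simp
  then have "p \<cdot> h = Zer C W Z" by (rule mono_cancel0[OF iso_mono[OF v] Cmp_Hom[OF h(1) D(5)]])
  then show "\<exists>u\<in>Hom C W X. i \<cdot> u = h" using ses_lift[OF s h(1)] by blast
qed

lemma map_to_simple:
  assumes S: "simple_obj C S" and f: "f \<in> Hom C N S"
  shows "f = Zer C N S \<or> f \<in> Epis C N S"
proof -
  obtain K k I e m where s: "ses C k e K N I" and m: "m \<in> Monos C I S" "m \<cdot> e = f"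
    using factorization[OF f] by metis
  note D = sesD[OF s] and mH = MonoD[OF m(1)]
  have "is_mono C m" "Dom C m = I" "Cod C m = S" using m by (auto simp: Monos_def Hom_def)
  then consider "zero_obj C I" | "is_iso C m" using S unfolding simple_obj_def by blast
  then show ?thesis
  proof cases
    case 1
    then show ?thesis using zero_objD(1)[OF 1 mH] m(2) Zer_Cmp[OF D(5)] Hom_Obj[OF f] by auto
  next
    case 2
    then have "m \<in> Isos C I S" using mH by (simp add: Isos_def)
    then show ?thesis using epi_Cmp[OF D(2) iso_epi] m(2) by blast
  qed
qed

lemma map_from_simple:
  assumes S: "simple_obj C S" and f: "f \<in> Hom C S Q"
  shows "f = Zer C S Q \<or> f \<in> Monos C S Q"
proof -
  obtain K k I e m where s: "ses C k e K S I" and m: "m \<in> Monos C I Q" "m \<cdot> e = f" 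
    and fk: "f \<cdot> k = Zer C K Q"
    using factorization[OF f] by metis
  note D = sesD[OF s]
  have "is_mono C k" "Dom C k = K" "Cod C k = S" using D(1) by (auto simp: Monos_def Hom_def)
  then consider "zero_obj C K" | "is_iso C k" using S unfolding simple_obj_def by blast
  then show ?thesis
  proof cases
    case 1
    then show ?thesis using mono_Cmp[OF iso_mono[OF ses_zero_left[OF s]]] m by blast
  next
    case 2
    then have "k \<in> Isos C K S" using D(4) by (simp add: Isos_def)
    then show ?thesis using epi_cancel0[OF iso_epi f fk] by blast
  qed
qed

text \<open>
  Intersect the last step \<open>X\<close> of the series with the subobject \<open>N\<close>. Either \<open>N \<subseteq> X\<close>, or the quotient \<open>S\<close> of
  \<open>M\<close> is also the quotient of \<open>N\<close> by \<open>N \<inter> X\<close>. In both cases induction applies to a subobject of \<open>X\<close>, and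
  the length can be preserved only if \<open>X \<subseteq> N\<close>.
\<close>

lemma comp_series_sub:
  assumes "comp_series C n M" "j \<in> Monos C N M"
  shows "\<exists>m\<le>n. comp_series C m N \<and> (m = n \<longrightarrow> j \<in> Isos C N M)"
  using assms
proof (induction n arbitrary: M N j)
  case 0
  then have M: "zero_obj C M" by simp
  note jH = MonoD[OF 0(2)]
  have N: "zero_obj C N" by (rule mono_to_zero[OF 0(2) zero_objD(2)[OF M jH]])
  have "j \<in> Isos C N M"
    by (rule isoI[of _ _ _ "Zer C M N"])
      (use zero_objD[OF M] zero_objD[OF N] jH M N Zer_Hom zero_obj_iff in \<open>auto simp: arrows\<close>)
  then show ?case using N by auto
next
  case (Suc n)
  then obtain X S i p where X: "comp_series C n X" and S: "simple_obj C S" and s: "ses C i p X M S"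
    by auto
  note D = sesD[OF s] and jH = MonoD[OF Suc.prems(2)]
  have pj: "p \<cdot> j \<in> Hom C N S" using Cmp_Hom[OF jH D(5)] .
  consider "p \<cdot> j = Zer C N S" | "p \<cdot> j \<in> Epis C N S" using map_to_simple[OF S pj] by blast
  then show ?case
  proof cases
    case 1
    then obtain x where x: "x \<in> Hom C N X" "i \<cdot> x = j" using ses_lift[OF s jH] by blast
    have "x \<in> Monos C N X" by (rule mono_right[OF x(1) D(4)]) (use x Suc.prems in simp)
    then obtain m where "m \<le> n" "comp_series C m N" using Suc.IH[OF X] by blast
    then show ?thesis by (intro exI[of _ m]) auto
  next
    case 2
    then obtain K k where k: "ses C k (p \<cdot> j) K N S" using ses_of_epi by blast
    note kD = sesD[OF k]
    have jk: "j \<cdot> k \<in> Hom C K M" using Cmp_Hom[OF kD(4) jH] .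
    have "p \<cdot> (j \<cdot> k) = Zer C K S" using kD(3) Cmp_assoc[OF kD(4) jH D(5)] by simp
    then obtain x where x: "x \<in> Hom C K X" "i \<cdot> x = j \<cdot> k" using ses_lift[OF s jk] by blast
    have "x \<in> Monos C K X" by (rule mono_right[OF x(1) D(4)]) (use x Suc.prems kD mono_Cmp in simp)
    then obtain m where m: "m \<le> n" "comp_series C m K" "m = n \<longrightarrow> x \<in> Isos C K X"
      using Suc.IH[OF X] by blast
    have "j \<in> Isos C N M" if "x \<in> Isos C K X"
    proof -
      have "w = Zer C M W" if w: "w \<in> Hom C M W" "w \<cdot> j = Zer C N W" for w W
      proof -
        have W: "W \<in> Obj C" using w Hom_Obj by blast
        have "w \<cdot> i \<cdot> x = w \<cdot> j \<cdot> k" using x Cmp_assoc[OF x(1) D(4) w(1)] Cmp_assoc[OF kD(4) jH w(1)] by simp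
        then have "w \<cdot> i \<cdot> x = Zer C K W" using w Zer_Cmp[OF kD(4) W] by simp
        then have "w \<cdot> i = Zer C X W"
          by (rule epi_cancel0[OF iso_epi[OF \<open>x \<in> Isos C K X\<close>] Cmp_Hom[OF D(4) w(1)]])
        then obtain w' where w': "w' \<in> Hom C S W" "w' \<cdot> p = w" using ses_desc[OF s w(1)] by blast
        then have "w' \<cdot> (p \<cdot> j) = Zer C N W" using w Cmp_assoc[OF jH D(5) w'(1)] by simp
        then have "w' = Zer C S W" by (rule epi_cancel0[OF 2 w'(1)])
        then show ?thesis using w' Zer_Cmp[OF D(5) W] by simp
      qed
      then show ?thesis using balanced Suc.prems(2) epi_iff[OF jH] by blast
    qed
    moreover have "comp_series C (Suc m) N" using m(2) S k by auto
    ultimately show ?thesis using m by (intro exI[of _ "Suc m"]) auto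
  qed
qed

text \<open>
  The image \<open>I\<close> of the last step \<open>X\<close> in \<open>Q\<close> has a quotient of \<open>S\<close> as its cokernel, hence zero or \<open>S\<close>, and
  induction applies to \<open>X \<rightarrow> I\<close>.
\<close>

lemma comp_series_quot:
  assumes "comp_series C n M" "q \<in> Epis C M Q"
  shows "\<exists>m\<le>n. comp_series C m Q \<and> (m = n \<longrightarrow> q \<in> Isos C M Q)"
  using assms
proof (induction n arbitrary: M Q q)
  case 0
  then have M: "zero_obj C M" by simp
  note qH = EpiD[OF 0(2)]
  have Q: "zero_obj C Q" by (rule epi_from_zero[OF 0(2) zero_objD(1)[OF M qH]])
  have "q \<in> Isos C M Q"
    by (rule isoI[of _ _ _ "Zer C Q M"])
      (use zero_objD[OF M] zero_objD[OF Q] qH M Q Zer_Hom zero_obj_iff in \<open>auto simp: arrows\<close>)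
  then show ?case using Q by auto
next
  case (Suc n)
  then obtain X S i p where X: "comp_series C n X" and S: "simple_obj C S" and s: "ses C i p X M S"
    by auto
  note D = sesD[OF s] and qH = EpiD[OF Suc.prems(2)]
  have qi: "q \<cdot> i \<in> Hom C X Q" using Cmp_Hom[OF D(4) qH] .
  obtain K k I e m where ke: "ses C k e K X I" and m: "m \<in> Monos C I Q" "m \<cdot> e = q \<cdot> i"
    using factorization[OF qi] by metis
  note eD = sesD[OF ke] and mH = MonoD[OF m(1)]
  obtain R c where c: "ses C m c I Q R" using ses_of_mono m by blast
  note cD = sesD[OF c]
  have cq: "c \<cdot> q \<in> Hom C M R" using Cmp_Hom[OF qH cD(5)] .
  have "c \<cdot> q \<cdot> i = Zer C X R"
    using Cmp_assoc[OF D(4) qH cD(5)] m(2)[symmetric] Cmp_assoc[OF eD(5) mH cD(5)] cD(3) Zer_Cmp[OF eD(5) cD(8)] by simp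
  then obtain t where t: "t \<in> Hom C S R" "t \<cdot> p = c \<cdot> q" using ses_desc[OF s cq] by blast
  have te: "t \<in> Epis C S R" by (rule epi_left[OF D(5) t(1)]) (use t epi_Cmp[OF Suc.prems(2) cD(2)] in simp)
  consider "t = Zer C S R" | "t \<in> Isos C S R" using map_from_simple[OF S t(1)] balanced te by blast
  then show ?case
  proof cases
    case 1
    then have "c \<cdot> q = Zer C M R" using t Zer_Cmp[OF D(5) cD(8)] by simp
    then have "c = Zer C Q R" by (rule epi_cancel0[OF Suc.prems(2) cD(5)])
    then have "zero_obj C R" using epi_from_zero cD by blast
    then have "m \<in> Isos C I Q" using ses_zero_right c by blast
    then have "q \<cdot> i \<in> Epis C X Q" using epi_Cmp[OF eD(2) iso_epi] m by metis
    then obtain l where "l \<le> n" "comp_series C l Q" using Suc.IH[OF X] by blast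
    then show ?thesis by (intro exI[of _ l]) auto
  next
    case 2
    then obtain t' where t': "t' \<in> Isos C R S" using iso_inv by metis
    obtain l where l: "l \<le> n" "comp_series C l I" "l = n \<longrightarrow> e \<in> Isos C X I"
      using Suc.IH[OF X eD(2)] by blast
    have "comp_series C (Suc l) Q" using l(2) S ses_iso_right[OF c t'] by auto
    moreover have "q \<in> Isos C M Q" if ei: "e \<in> Isos C X I"
    proof -
      have "u = Zer C W M" if u: "u \<in> Hom C W M" "q \<cdot> u = Zer C W Q" for u W
      proof -
        have W: "W \<in> Obj C" using u Hom_Obj by blast
        have "t \<cdot> (p \<cdot> u) = c \<cdot> (q \<cdot> u)" using t Cmp_assoc[OF u(1) D(5) t(1)] Cmp_assoc[OF u(1) qH cD(5)] by simp
        then have "t \<cdot> (p \<cdot> u) = Zer C W R" using u Cmp_Zer[OF cD(5) W] by simp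
        then have "p \<cdot> u = Zer C W S" by (rule mono_cancel0[OF iso_mono[OF 2] Cmp_Hom[OF u(1) D(5)]])
        then obtain x where x: "x \<in> Hom C W X" "i \<cdot> x = u" using ses_lift[OF s u(1)] by blast
        have "m \<cdot> e \<cdot> x = Zer C W Q" using m(2) x u(2) Cmp_assoc[OF x(1) D(4) qH] by simp
        then have "x = Zer C W X" by (rule mono_cancel0[OF mono_Cmp[OF iso_mono[OF ei] m(1)] x(1)])
        then show ?thesis using x Cmp_Zer[OF D(4) W] by simp
      qed
      then show ?thesis using balanced[OF _ Suc.prems(2)] mono_iff[OF qH] by blast
    qed
    ultimately show ?thesis using l by (intro exI[of _ "Suc l"]) auto
  qed
qed

end

lemma abelian_length_category_with_length:
  assumes "abelian_length_category C"
  shows "abelian_with_length C (\<lambda>M. LEAST n. comp_series C n M)"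
proof -
  interpret abelian_length_category C by fact
  let ?len = "\<lambda>M. LEAST n. comp_series C n M"
  have len: "comp_series C (?len M) M" if "M \<in> Obj C" for M
    using comp_series_if_has[OF ex_composition_series[OF that]] by (auto intro: LeastI)
  show ?thesis
  proof
    fix f X Y assume f: "f \<in> Monos C X Y"
    then have "Y \<in> Obj C" using MonoD Hom_Obj by blast
    from comp_series_sub[OF len[OF this] f]
    obtain m where m: "m \<le> ?len Y" "comp_series C m X" "m = ?len Y \<longrightarrow> f \<in> Isos C X Y" by blast
    have "?len X \<le> m" using m(2) by (rule Least_le)
    then show "?len X \<le> ?len Y" "?len X = ?len Y \<Longrightarrow> f \<in> Isos C X Y" using m by linarith+
  next
    fix f X Y assume f: "f \<in> Epis C X Y"
    then have "X \<in> Obj C" using EpiD Hom_Obj by blast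
    from comp_series_quot[OF len[OF this] f]
    obtain m where m: "m \<le> ?len X" "comp_series C m Y" "m = ?len X \<longrightarrow> f \<in> Isos C X Y" by blast
    have "?len Y \<le> m" using m(2) by (rule Least_le)
    then show "?len Y \<le> ?len X" "?len X = ?len Y \<Longrightarrow> f \<in> Isos C X Y" using m by linarith+
  qed
qed

section \<open>Torsion classes\<close>

definition orth :: "('o, 'm) precat \<Rightarrow> 'o \<Rightarrow> 'o \<Rightarrow> bool" where
  "orth C X Y \<longleftrightarrow> (\<forall>h\<in>Hom C X Y. h = Zer C X Y)"

definition left_perp :: "('o, 'm) precat \<Rightarrow> 'o set \<Rightarrow> 'o set" where
  "left_perp C f = {X \<in> Obj C. \<forall>Y\<in>f. orth C X Y}"

definition right_perp :: "('o, 'm) precat \<Rightarrow> 'o set \<Rightarrow> 'o set" where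
  "right_perp C t = {Y \<in> Obj C. \<forall>X\<in>t. orth C X Y}"

text \<open>
  The description of torsion classes by closure properties; \<open>torsion_class_iff\<close> below shows that it is
  equivalent to the existence of a torsion pair.
\<close>

definition torsion_closed :: "('o, 'm) precat \<Rightarrow> 'o set \<Rightarrow> bool" where
  "torsion_closed C t \<longleftrightarrow> t \<subseteq> Obj C \<and> (\<forall>Z. zero_obj C Z \<longrightarrow> Z \<in> t) \<and>
     (\<forall>X Y f. f \<in> Epis C X Y \<and> X \<in> t \<longrightarrow> Y \<in> t) \<and>
     (\<forall>i p X Y Z. ses C i p X Y Z \<and> X \<in> t \<and> Z \<in> t \<longrightarrow> Y \<in> t)"

lemma opp_orth [simp]: "orth (opp C) X Y = orth C Y X"
  and opp_left_perp [simp]: "left_perp (opp C) f = right_perp C f"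
  and opp_right_perp [simp]: "right_perp (opp C) f = left_perp C f"
  by (auto simp: orth_def left_perp_def right_perp_def)

lemma opp_iso_rel [simp]: "iso_rel (opp C) = (iso_rel C)\<inverse>"
  by (auto simp: iso_rel_def)

lemma torsion_closedD:
  assumes "torsion_closed C t"
  shows "t \<subseteq> Obj C" "zero_obj C Z \<Longrightarrow> Z \<in> t" "f \<in> Epis C X Y \<Longrightarrow> X \<in> t \<Longrightarrow> Y \<in> t"
    "ses C i p X Y Z \<Longrightarrow> X \<in> t \<Longrightarrow> Z \<in> t \<Longrightarrow> Y \<in> t"
  using assms unfolding torsion_closed_def by blast+

lemma orthD: "orth C X Y \<Longrightarrow> h \<in> Hom C X Y \<Longrightarrow> h = Zer C X Y"
  by (simp add: orth_def)

context preadditive_category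
begin

lemma opp_iso_rel_eq [simp]: "iso_rel (opp C) = iso_rel C"
  using equiv_iso_rel by (simp add: equiv_def sym_conv_converse_eq)

lemma opp_subcategory [simp]: "subcategory (opp C) S = subcategory C S"
  by (simp only: subcategory_def opp_iso_rel_eq opp_simps)

lemma orth_iff: "X \<in> Obj C \<Longrightarrow> Y \<in> Obj C \<Longrightarrow> orth C X Y \<longleftrightarrow> Hom C X Y = {Zer C X Y}"
  using Zer_Hom by (auto simp: orth_def)

lemma torsion_pair_ses:
  "torsion_pair C t f \<longleftrightarrow> subcategory C t \<and> subcategory C f \<and> (\<forall>T\<in>t. \<forall>F\<in>f. orth C T F) \<and>
     (\<forall>M\<in>Obj C. \<exists>T i p F. ses C i p T M F \<and> T \<in> t \<and> F \<in> f)"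
proof -
  have 1: "ses C i p (Dom C i) (Cod C i) (Cod C p)" if "short_exact C i p" for i p
    using that by (simp add: short_exact_def is_kernel_def ses_def Hom_def)
  have 2: "short_exact C i p \<and> Dom C i = T \<and> Cod C i = M \<and> Cod C p = F" if "ses C i p T M F" for i p T M F
    using that by (simp add: ses_def Hom_def)
  have "(\<exists>i p. short_exact C i p \<and> Dom C i \<in> t \<and> Cod C i = M \<and> Cod C p \<in> f) \<longleftrightarrow>
    (\<exists>T i p F. ses C i p T M F \<and> T \<in> t \<and> F \<in> f)" for M
    using 1 2 by metis
  moreover have "(\<forall>T\<in>t. \<forall>F\<in>f. Hom C T F = {Zer C T F}) \<longleftrightarrow> (\<forall>T\<in>t. \<forall>F\<in>f. orth C T F)"
    if "t \<subseteq> Obj C" "f \<subseteq> Obj C" using that orth_iff by blast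
  ultimately show ?thesis unfolding torsion_pair_def subcategory_def by auto
qed

lemma opp_torsion_pair [simp]: "torsion_pair (opp C) f t \<longleftrightarrow> torsion_pair C t f"
proof -
  have "(\<exists>T i p F. ses C p i F M T \<and> T \<in> f \<and> F \<in> t) \<longleftrightarrow> (\<exists>T i p F. ses C i p T M F \<and> T \<in> t \<and> F \<in> f)" for M
    by blast
  moreover have "(\<forall>T\<in>f. \<forall>F\<in>t. orth C F T) \<longleftrightarrow> (\<forall>T\<in>t. \<forall>F\<in>f. orth C T F)" by blast
  ultimately show ?thesis
    unfolding torsion_pair_ses preadditive_category.torsion_pair_ses[OF preadditive_opp[OF preadditive_category_axioms]]
    by (simp add: conj_ac)
qed

lemma opp_torsion_class [simp]: "torsion_class (opp C) t \<longleftrightarrow> torsionfree_class C t"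
  by (simp_all add: torsion_class_def torsionfree_class_def)

lemma opp_gen_torsion [simp]: "gen_torsion (opp C) S = gen_torsionfree C S"
  by (simp_all add: gen_torsion_def gen_torsionfree_def)

lemma orth_epi: assumes "orth C X Y" "q \<in> Epis C X X'" shows "orth C X' Y"
  unfolding orth_def
proof
  fix h assume h: "h \<in> Hom C X' Y"
  have "h \<cdot> q = Zer C X Y" using orthD[OF assms(1) Cmp_Hom[OF EpiD[OF assms(2)] h]] .
  then show "h = Zer C X' Y" using epi_cancel0 assms h by blast
qed

lemma orth_mono: "orth C X Y \<Longrightarrow> m \<in> Monos C Y' Y \<Longrightarrow> orth C X Y'"
  using preadditive_category.orth_epi[OF preadditive_opp[OF preadditive_category_axioms], of Y X m Y'] by simp

lemma orth_self: "X \<in> Obj C \<Longrightarrow> orth C X X \<Longrightarrow> zero_obj C X"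
  using zero_obj_iff orthD[OF _ Idt_Hom] by simp

lemma orth_zero: "zero_obj C X \<Longrightarrow> orth C X Y" "zero_obj C X \<Longrightarrow> orth C Y X"
  using zero_objD unfolding orth_def by blast+

end

context abelian_category
begin

lemma orth_ses: assumes s: "ses C i p X' X X''" and o: "orth C X' Y" "orth C X'' Y" shows "orth C X Y"
  unfolding orth_def
proof
  fix h assume h: "h \<in> Hom C X Y"
  note D = sesD[OF s]
  have Y: "Y \<in> Obj C" using h Hom_Obj by blast
  have "h \<cdot> i = Zer C X' Y" using orthD[OF o(1) Cmp_Hom[OF D(4) h]] .
  then obtain u where u: "u \<in> Hom C X'' Y" "u \<cdot> p = h" using ses_desc[OF s h] by blast
  then show "h = Zer C X Y" using orthD[OF o(2) u(1)] Zer_Cmp[OF D(5) Y] by simp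
qed

lemma left_perp_closed: "torsion_closed C (left_perp C f)"
proof -
  have "Y \<in> left_perp C f" if "g \<in> Epis C X Y" "X \<in> left_perp C f" for g X Y
    using that(2) orth_epi[OF _ that(1)] Hom_Obj[OF EpiD[OF that(1)]] unfolding left_perp_def by blast
  moreover have "Y \<in> left_perp C f" if "ses C i p X Y Z" "X \<in> left_perp C f" "Z \<in> left_perp C f" for i p X Y Z
    using that(2,3) orth_ses[OF that(1)] sesD(7)[OF that(1)] unfolding left_perp_def by blast
  moreover have "Z \<in> left_perp C f" if "zero_obj C Z" for Z
    using that orth_zero zero_obj_iff unfolding left_perp_def by blast
  ultimately show ?thesis unfolding torsion_closed_def left_perp_def by blast
qed

lemma torsion_pair_perp:
  assumes "torsion_pair C t f" shows "t = left_perp C f"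
proof -
  note tp = assms[unfolded torsion_pair_ses]
  have "X \<in> t" if X: "X \<in> left_perp C f" for X
  proof -
    have XO: "X \<in> Obj C" using X by (simp add: left_perp_def)
    obtain T i p F where s: "ses C i p T X F" "T \<in> t" "F \<in> f" using tp XO by blast
    note D = sesD[OF s(1)]
    have "p = Zer C X F" using X s(3) orthD[OF _ D(5)] by (simp add: left_perp_def)
    then have "i \<in> Isos C T X" using ses_zero_right[OF s(1)] epi_from_zero D by blast
    then have "(T, X) \<in> iso_rel C" using iso_rel_iff by blast
    then show ?thesis using tp s unfolding subcategory_def by blast
  qed
  then show ?thesis using tp unfolding left_perp_def subcategory_def by blast
qed

lemma torsion_closed_subcategory: assumes "torsion_closed C t" shows "subcategory C t"
  using torsion_closedD[OF assms] iso_rel_iff iso_epi unfolding subcategory_def by blast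

end

context abelian_with_length
begin

text \<open>
  A subobject \<open>T\<close> of \<open>M\<close> in \<open>t\<close> of maximal length is the torsion part: the image of a nonzero map from \<open>t\<close>
  to \<open>M / T\<close> would have a preimage in \<open>M\<close> that is a longer subobject in \<open>t\<close>.
\<close>

lemma torsion_closed_pair:
  assumes t: "torsion_closed C t" shows "torsion_pair C t (right_perp C t)"
proof -
  note tD = torsion_closedD[OF t]
  have "\<exists>T i p F. ses C i p T M F \<and> T \<in> t \<and> F \<in> right_perp C t" if M: "M \<in> Obj C" for M
  proof -
    define P where "P T = (T \<in> t \<and> (\<exists>i. i \<in> Monos C T M))" for T
    obtain Z where Z: "zero_obj C Z" using ex_zero_obj by blast
    have "P Z" using tD(2)[OF Z] zero_mono[OF Z M] P_def by blast
    moreover have "\<forall>T. P T \<longrightarrow> len T < Suc (len M)" using len_mono by (auto simp: P_def less_Suc_eq_le)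
    ultimately obtain T where T: "P T" and mx: "\<And>T'. P T' \<Longrightarrow> len T' \<le> len T"
      using ex_has_greatest_nat[of P Z len "Suc (len M)"] by auto
    obtain i where i: "i \<in> Monos C T M" using T P_def by blast
    obtain F p where s: "ses C i p T M F" using ses_of_mono i by blast
    note D = sesD[OF s]
    have "h = Zer C X F" if X: "X \<in> t" and h: "h \<in> Hom C X F" for X h
    proof -
      obtain K k I e m where ke: "ses C k e K X I" and m: "m \<in> Monos C I F" "m \<cdot> e = h"
        using factorization[OF h] by metis
      note eD = sesD[OF ke] and mH = MonoD[OF m(1)]
      have I: "I \<in> t" using tD(3) eD X by blast
      obtain Q i' p' g' where q: "ses C i' p' T Q I" "g' \<in> Hom C Q M" "p \<cdot> g' = m \<cdot> p'"
        and jm: "\<And>V u. u \<in> Hom C V Q \<Longrightarrow> p' \<cdot> u = Zer C V I \<Longrightarrow> g' \<cdot> u = Zer C V M \<Longrightarrow> u = Zer C V Q"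
        using pullback_ses[OF s mH] by metis
      note qD = sesD[OF q(1)]
      have "u = Zer C W Q" if u: "u \<in> Hom C W Q" "g' \<cdot> u = Zer C W M" for W u
      proof -
        have W: "W \<in> Obj C" using u Hom_Obj by blast
        have "m \<cdot> (p' \<cdot> u) = p \<cdot> (g' \<cdot> u)" using q(3) Cmp_assoc[OF u(1) q(2) D(5)] Cmp_assoc[OF u(1) qD(5) mH] by simp
        then have "m \<cdot> (p' \<cdot> u) = Zer C W F" using u Cmp_Zer[OF D(5) W] by simp
        then have "p' \<cdot> u = Zer C W I" by (rule mono_cancel0[OF m(1) Cmp_Hom[OF u(1) qD(5)]])
        then show ?thesis using jm u by blast
      qed
      then have g'm: "g' \<in> Monos C Q M" using mono_iff q(2) by blast
      have "Q \<in> t" using tD(4)[OF q(1)] I T P_def by blast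
      then have "len Q \<le> len T" using mx g'm P_def by blast
      then have i'i: "i' \<in> Isos C T Q" using len_mono_iso len_mono qD by (meson le_antisym)
      have "p' = Zer C Q I" by (rule epi_cancel0[OF iso_epi[OF i'i] qD(5)]) (use qD in simp)
      then have "zero_obj C I" using mono_to_zero epi_from_zero qD by blast
      then show ?thesis using zero_objD(1)[OF _ mH] m(2) Zer_Cmp[OF eD(5) D(8)] by simp
    qed
    then have "F \<in> right_perp C t" unfolding right_perp_def orth_def using D by blast
    then show ?thesis using s T P_def by blast
  qed
  moreover have "subcategory C (right_perp C t)"
    using abelian_category.torsion_closed_subcategory[OF op abelian_category.left_perp_closed[OF op]] by simp
  ultimately show ?thesis 
    unfolding torsion_pair_ses using torsion_closed_subcategory[OF t] by (auto simp: right_perp_def)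
qed

lemma torsion_class_iff: "torsion_class C t \<longleftrightarrow> torsion_closed C t"
  using torsion_closed_pair torsion_pair_perp left_perp_closed unfolding torsion_class_def by metis

lemma Obj_closed: "torsion_closed C (Obj C)"
  using EpiD Hom_Obj sesD(7) zero_obj_iff unfolding torsion_closed_def by blast

lemma gen_torsion_closed: assumes "S \<subseteq> Obj C" shows "torsion_closed C (gen_torsion C S)"
proof -
  have *: "\<And>t. torsion_class C t \<and> S \<subseteq> t \<Longrightarrow> torsion_closed C t" using torsion_class_iff by blast
  have "Obj C \<in> {t. torsion_class C t \<and> S \<subseteq> t}" using Obj_closed torsion_class_iff assms by blast
  then have "gen_torsion C S \<subseteq> Obj C" unfolding gen_torsion_def by blast
  then show ?thesis unfolding torsion_closed_def gen_torsion_def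
    using torsion_closedD(2-)[OF *] by (safe; blast)
qed

lemma gen_torsion_subset: "S \<subseteq> gen_torsion C S"
  unfolding gen_torsion_def by blast

lemma gen_torsion_least: "torsion_closed C t \<Longrightarrow> S \<subseteq> t \<Longrightarrow> gen_torsion C S \<subseteq> t"
  unfolding gen_torsion_def using torsion_class_iff by blast

text \<open>
  Otherwise the torsion class of all objects without nonzero maps to \<open>X\<close> contains \<open>S\<close>, hence \<open>X\<close> itself.
\<close>

lemma gen_torsion_nonzero_map:
  assumes S: "S \<subseteq> Obj C" and X: "X \<in> gen_torsion C S" "\<not> zero_obj C X"
  shows "\<exists>s\<in>S. \<exists>g\<in>Hom C s X. g \<noteq> Zer C s X"
proof (rule ccontr)
  assume "\<not> ?thesis"
  then have "S \<subseteq> left_perp C {X}" using S by (auto simp: left_perp_def orth_def)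
  then have "X \<in> left_perp C {X}" using gen_torsion_least[OF left_perp_closed] X by blast
  then show False using X orth_self by (simp add: left_perp_def)
qed

end

section \<open>Wide generation in brick-finite categories\<close>

context preadditive_category
begin

lemma ring_end_ring: assumes X: "X \<in> Obj C" shows "ring (end_ring C X)"
proof (rule ringI)
  have am: "add_monoid (end_ring C X) = hom_group C X X"
    by (simp add: end_ring_def hom_group_def)
  show "abelian_group (end_ring C X)"
    using hom_comm_group[OF X X] unfolding abelian_group_def abelian_monoid_def abelian_group_axioms_def am
    by (simp add: comm_group_def)
  show "monoid (end_ring C X)"
    by (rule monoidI) (use Idt_Hom[OF X] in \<open>auto simp: end_ring_def Cmp_Idt Idt_Cmp intro: Cmp_Hom Cmp_assoc\<close>)
qed (auto simp: end_ring_def intro: Add_Cmp Cmp_Add)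

text \<open>
  In this form the notion of a brick is visibly self-dual.
\<close>

lemma brick_iff:
  "brick C B \<longleftrightarrow> B \<in> Obj C \<and> \<not> zero_obj C B \<and> (\<forall>g\<in>Hom C B B. g \<noteq> Zer C B B \<longrightarrow> g \<in> Isos C B B)"
proof (cases "B \<in> Obj C")
  case B: True
  interpret R: ring "end_ring C B" using ring_end_ring[OF B] .
  have U: "Units (end_ring C B) = Isos C B B"
  proof (intro equalityI subsetI)
    show "g \<in> Isos C B B" if "g \<in> Units (end_ring C B)" for g
      using that isoI[of g B B] by (auto simp: Units_def end_ring_def)
    fix g assume g: "g \<in> Isos C B B"
    then obtain h where "h \<in> Isos C B B" "h \<cdot> g = Idt C B" "g \<cdot> h = Idt C B" using iso_inv by blast
    then show "g \<in> Units (end_ring C B)" using IsoD g by (auto simp: Units_def end_ring_def)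
  qed
  have c: "carrier (end_ring C B) = Hom C B B" "\<zero>\<^bsub>end_ring C B\<^esub> = Zer C B B" by (simp_all add: end_ring_def)
  have "skew_field (end_ring C B) \<longleftrightarrow> Isos C B B = Hom C B B - {Zer C B B}"
    using R.ring_axioms by (simp add: skew_field_def skew_field_axioms_def U c)
  also have "\<dots> \<longleftrightarrow> \<not> zero_obj C B \<and> (\<forall>g\<in>Hom C B B. g \<noteq> Zer C B B \<longrightarrow> g \<in> Isos C B B)"
  proof -
    have "Zer C B B \<in> Isos C B B \<longleftrightarrow> zero_obj C B"
    proof
      show "Zer C B B \<in> Isos C B B \<Longrightarrow> zero_obj C B" using iso_mono mono_to_zero by blast
      show "zero_obj C B \<Longrightarrow> Zer C B B \<in> Isos C B B" using Idt_iso[OF B] zero_obj_iff by simp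
    qed
    then show ?thesis using IsoD by blast
  qed
  finally show ?thesis using B by (simp add: brick_def)
qed (simp add: brick_def)

lemma opp_brick [simp]: "brick (opp C) B \<longleftrightarrow> brick C B"
  by (simp add: brick_iff preadditive_category.brick_iff[OF preadditive_opp[OF preadditive_category_axioms]])

lemma opp_brick_finite [simp]: "brick_finite (opp C) \<longleftrightarrow> brick_finite C"
  by (simp only: brick_finite_def opp_brick opp_iso_rel_eq)

end

context abelian_category
begin

lemma kernel_unique:
  assumes k: "is_kernel C f k" "is_kernel C f k'" shows "\<exists>v. v \<in> Isos C (Dom C k) (Dom C k')"
proof -
  obtain X Y where f: "f \<in> Hom C X Y" using k by (auto simp: is_kernel_def Hom_def)
  note D = is_kernelD[OF k(1) f] and D' = is_kernelD[OF k(2) f]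
  note H = MonoD[OF D(1)] MonoD[OF D'(1)]
  obtain u where u: "u \<in> Hom C (Dom C k) (Dom C k')" "k' \<cdot> u = k" using D'(3)[OF H(1) D(2)] by blast
  obtain v where v: "v \<in> Hom C (Dom C k') (Dom C k)" "k \<cdot> v = k'" using D(3)[OF H(2) D'(2)] by blast
  have ob: "Dom C k \<in> Obj C" "Dom C k' \<in> Obj C" using H Hom_Obj by auto
  have "v \<cdot> u = Idt C (Dom C k)"
    by (rule mono_cancel[OF D(1) Cmp_Hom[OF u(1) v(1)] Idt_Hom[OF ob(1)]])
      (use Cmp_assoc[OF u(1) v(1) H(1)] u v Cmp_Idt[OF H(1)] in simp)
  moreover have "u \<cdot> v = Idt C (Dom C k')"
    by (rule mono_cancel[OF D'(1) Cmp_Hom[OF v(1) u(1)] Idt_Hom[OF ob(2)]])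
      (use Cmp_assoc[OF v(1) u(1) H(2)] u v Cmp_Idt[OF H(2)] in simp)
  ultimately show ?thesis using isoI u v by blast
qed

end

text \<open>
  The wide subcategory that Ingalls and Thomas attach to a torsion class.
\<close>

definition alpha :: "('o, 'm) precat \<Rightarrow> 'o set \<Rightarrow> 'o set" where
  "alpha C t = {X \<in> t. \<forall>Y\<in>t. \<forall>g\<in>Hom C Y X. \<forall>k. is_kernel C g k \<longrightarrow> Dom C k \<in> t}"

context abelian_category
begin

text \<open>
  Kernels are unique up to isomorphism, so it suffices to exhibit one kernel in \<open>t\<close>.
\<close>

lemma alphaI:
  assumes t: "torsion_closed C t" and X: "X \<in> t"
    and ker: "\<And>Y g. Y \<in> t \<Longrightarrow> g \<in> Hom C Y X \<Longrightarrow> \<exists>k. is_kernel C g k \<and> Dom C k \<in> t"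
  shows "X \<in> alpha C t"
proof -
  have "Dom C k \<in> t" if "Y \<in> t" "g \<in> Hom C Y X" "is_kernel C g k" for Y g k
  proof -
    obtain k' where "is_kernel C g k'" "Dom C k' \<in> t" using ker \<open>Y \<in> t\<close> \<open>g \<in> Hom C Y X\<close> by blast
    then show ?thesis using kernel_unique[of g k' k] that(3) iso_epi torsion_closedD(3)[OF t] by blast
  qed
  then show ?thesis using X by (simp add: alpha_def)
qed

text \<open>
  In each case a map \<open>g\<close> from \<open>Y \<in> t\<close> is replaced by a map with the same kernel to an object already known
  to lie in \<open>alpha C t\<close>: for a subobject that belongs to \<open>t\<close>, compose with the inclusion; for a quotient
  \<open>X' / I\<close>, pull back to \<open>X'\<close>, which changes \<open>Y\<close> into an extension of \<open>Y\<close> by \<open>I\<close>; for an extension, restrict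
  \<open>g\<close> to the kernel of \<open>p \<cdot> g\<close>.
\<close>

lemma wide_alpha: assumes t: "torsion_closed C t" shows "wide C (alpha C t)"
proof -
  note tD = torsion_closedD[OF t]
  have aD: "Dom C k \<in> t" if "X \<in> alpha C t" "Y \<in> t" "g \<in> Hom C Y X" "is_kernel C g k" for X Y g k
    using that by (simp add: alpha_def)
  have at: "X \<in> t" if "X \<in> alpha C t" for X using that by (simp add: alpha_def)
  have kerI: "is_kernel C g l" if "f \<in> Hom C Y Z" "is_kernel C f l" "g \<in> Hom C Y X" "g \<cdot> l = Zer C (Dom C l) X"
    "\<And>W h. h \<in> Hom C W Y \<Longrightarrow> g \<cdot> h = Zer C W X \<Longrightarrow> f \<cdot> h = Zer C W Z" for f Y Z g X l
    by (rule is_kernelI[OF that(3) is_kernelD(1)[OF that(2,1)] that(4)]) (use is_kernelD(3)[OF that(2,1)] that(5) in blast)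
  have sub: "Z \<in> alpha C t" if k: "k \<in> Monos C Z X" "X \<in> alpha C t" and Z: "Z \<in> t" for k X Z
  proof (rule alphaI[OF t Z])
    note kH = MonoD[OF k(1)]
    fix Y g assume Y: "Y \<in> t" and g: "g \<in> Hom C Y Z"
    have kg: "k \<cdot> g \<in> Hom C Y X" using Cmp_Hom[OF g kH] .
    obtain l where l: "is_kernel C (k \<cdot> g) l" using ex_kernel kg by (auto simp: Hom_def)
    note lD = is_kernelD[OF l kg]
    note lH = MonoD[OF lD(1)]
    have "is_kernel C g l"
    proof (rule kerI[OF kg l g])
      have "k \<cdot> (g \<cdot> l) = Zer C (Dom C l) X" using lD(2) Cmp_assoc[OF lH g kH] by simp
      then show "g \<cdot> l = Zer C (Dom C l) Z" by (rule mono_cancel0[OF k(1) Cmp_Hom[OF lH g]])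
      fix W h assume h: "h \<in> Hom C W Y" "g \<cdot> h = Zer C W Z"
      then show "k \<cdot> g \<cdot> h = Zer C W X" using Cmp_assoc[OF h(1) g kH] Cmp_Zer[OF kH] Hom_Obj[OF h(1)] by simp
    qed
    then show "\<exists>k. is_kernel C g k \<and> Dom C k \<in> t" using aD[OF k(2) Y kg l] by blast
  qed
  have 1: "Dom C k \<in> alpha C t" if f: "Dom C f \<in> alpha C t" "Cod C f \<in> alpha C t" "is_kernel C f k" for f k
  proof -
    have fH: "f \<in> Hom C (Dom C f) (Cod C f)" using f by (simp add: is_kernel_def Hom_def)
    show ?thesis
      using sub[OF is_kernelD(1)[OF f(3) fH] f(1)] aD[OF f(2) at[OF f(1)] fH f(3)] by blast
  qed
  have 2: "Cod C c \<in> alpha C t" if f: "Dom C f \<in> alpha C t" "Cod C f \<in> alpha C t" "is_cokernel C f c" for f c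
  proof (rule alphaI[OF t])
    define X' where "X' = Cod C f"
    define Q where "Q = Cod C c"
    have fH: "f \<in> Hom C (Dom C f) X'" using f by (simp add: is_cokernel_def Hom_def X'_def)
    have X': "X' \<in> alpha C t" using f X'_def by simp
    note cD = is_cokernelD[OF f(3) fH, folded Q_def]
    note cH = EpiD[OF cD(1)]
    show "Cod C c \<in> t" using tD(3)[OF cD(1) at[OF X']] Q_def by simp
    obtain K k I e m where s: "ses C k e K (Dom C f) I" and m: "m \<in> Monos C I X'" "m \<cdot> e = f"
      using factorization[OF fH] by metis
    note eD = sesD[OF s]
    note mH = MonoD[OF m(1)]
    have I: "I \<in> t" using tD(3)[OF eD(2) at[OF f(1)]] .
    have Qo: "Q \<in> Obj C" using cH Hom_Obj by blast
    have s2: "ses C m c I X' Q"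
    proof (rule sesI'[OF m(1) cD(1)])
      show "c \<cdot> m = Zer C I Q"
        by (rule epi_cancel0[OF eD(2) Cmp_Hom[OF mH cH]]) (use cD(2) m(2) Cmp_assoc[OF eD(5) mH cH] in simp)
      fix W h assume h: "h \<in> Hom C X' W" "h \<cdot> m = Zer C I W"
      have W: "W \<in> Obj C" using h Hom_Obj by blast
      have "h \<cdot> f = Zer C (Dom C f) W" using h m(2) Cmp_assoc[OF eD(5) mH h(1)] Zer_Cmp[OF eD(5) W] by simp
      then show "\<exists>u\<in>Hom C Q W. u \<cdot> c = h" using cD(3)[OF h(1)] by blast
    qed
    fix Y g assume Y: "Y \<in> t" and "g \<in> Hom C Y (Cod C c)"
    then have g: "g \<in> Hom C Y Q" using Q_def by simp
    obtain P i' p' g' where P: "ses C i' p' I P Y" "g' \<in> Hom C P X'" "c \<cdot> g' = g \<cdot> p'" 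
      and univ: "\<And>V x y. x \<in> Hom C V X' \<Longrightarrow> y \<in> Hom C V Y \<Longrightarrow> c \<cdot> x = g \<cdot> y \<Longrightarrow>
       \<exists>u\<in>Hom C V P. g' \<cdot> u = x \<and> p' \<cdot> u = y"
      and jm: "\<And>V u. u \<in> Hom C V P \<Longrightarrow> p' \<cdot> u = Zer C V Y \<Longrightarrow> g' \<cdot> u = Zer C V X' \<Longrightarrow> u = Zer C V P"
      using pullback_ses[OF s2 g] by metis
    note PD = sesD[OF P(1)]
    have "P \<in> t" using tD(4)[OF P(1) I Y] .
    obtain l where l: "is_kernel C g' l" using ex_kernel P(2) by (auto simp: Hom_def)
    note lD = is_kernelD[OF l P(2)]
    note lH = MonoD[OF lD(1)]
    define L where "L = Dom C l"
    have lH: "l \<in> Hom C L P" using lH L_def by simp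
    have pl: "p' \<cdot> l \<in> Hom C L Y" using Cmp_Hom[OF lH PD(5)] .
    have "is_kernel C g (p' \<cdot> l)"
    proof (rule is_kernelI[OF g])
      have "u = Zer C W L" if u: "u \<in> Hom C W L" "p' \<cdot> l \<cdot> u = Zer C W Y" for W u
      proof -
        have W: "W \<in> Obj C" "X' \<in> Obj C" using u P Hom_Obj by blast+
        have "g' \<cdot> (l \<cdot> u) = Zer C W X'"
          using Cmp_assoc[OF u(1) lH P(2)] lD(2) L_def Zer_Cmp[OF u(1) W(2)] by simp
        then have "l \<cdot> u = Zer C W P" using jm[OF Cmp_Hom[OF u(1) lH]] u(2) Cmp_assoc[OF u(1) lH PD(5)] by simp
        then show ?thesis using mono_cancel0[OF lD(1)] u(1) L_def by blast
      qed
      then show "p' \<cdot> l \<in> Monos C L Y" using mono_iff[OF pl] by blast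
      have Lo: "L \<in> Obj C" using lH Hom_Obj by blast
      have "g \<cdot> (p' \<cdot> l) = c \<cdot> (g' \<cdot> l)" using P(3) Cmp_assoc[OF lH PD(5) g] Cmp_assoc[OF lH P(2) cH] by simp
      then show "g \<cdot> (p' \<cdot> l) = Zer C L Q" using lD(2) L_def Cmp_Zer[OF cH Lo] by simp
      fix W h assume h: "h \<in> Hom C W Y" "g \<cdot> h = Zer C W Q"
      have W: "W \<in> Obj C" "X' \<in> Obj C" using h P Hom_Obj by blast+
      have "c \<cdot> Zer C W X' = g \<cdot> h" using h Cmp_Zer[OF cH W(1)] by simp
      then obtain u where u: "u \<in> Hom C W P" "g' \<cdot> u = Zer C W X'" "p' \<cdot> u = h"
        using univ[OF Zer_Hom[OF W] h(1)] by blast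
      obtain w where w: "w \<in> Hom C W L" "l \<cdot> w = u" using lD(3)[OF u(1,2)] L_def by blast
      then show "\<exists>w\<in>Hom C W L. p' \<cdot> l \<cdot> w = h" using u(3) Cmp_assoc[OF w(1) lH PD(5)] by auto
    qed
    moreover have "L \<in> t" using aD[OF X' \<open>P \<in> t\<close> P(2) l] L_def by simp
    ultimately show "\<exists>k. is_kernel C g k \<and> Dom C k \<in> t" using pl by (auto simp: Hom_def)
  qed
  have 3: "X \<in> alpha C t" if s: "ses C i p X1 X X2" and X: "X1 \<in> alpha C t" "X2 \<in> alpha C t" for i p X1 X X2
  proof (rule alphaI[OF t])
    note D = sesD[OF s]
    show "X \<in> t" using tD(4)[OF s] X at by blast
    fix Y g assume Y: "Y \<in> t" and g: "g \<in> Hom C Y X"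
    have pg: "p \<cdot> g \<in> Hom C Y X2" using Cmp_Hom[OF g D(5)] .
    obtain a where a: "is_kernel C (p \<cdot> g) a" using ex_kernel pg by (auto simp: Hom_def)
    note aD' = is_kernelD[OF a pg]
    define Y1 where "Y1 = Dom C a"
    have aH: "a \<in> Hom C Y1 Y" using MonoD[OF aD'(1)] Y1_def by simp
    have Y1: "Y1 \<in> t" using aD[OF X(2) Y pg a] Y1_def by simp
    have "p \<cdot> (g \<cdot> a) = Zer C Y1 X2" using aD'(2) Y1_def Cmp_assoc[OF aH g D(5)] by simp
    then obtain b where b: "b \<in> Hom C Y1 X1" "i \<cdot> b = g \<cdot> a" using ses_lift[OF s Cmp_Hom[OF aH g]] by blast
    obtain l where l: "is_kernel C b l" using ex_kernel b(1) by (auto simp: Hom_def)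
    note lD = is_kernelD[OF l b(1)]
    define L where "L = Dom C l"
    have lH: "l \<in> Hom C L Y1" using MonoD[OF lD(1)] L_def by simp
    have al: "a \<cdot> l \<in> Monos C L Y" using mono_Cmp lD(1) aD'(1) Y1_def L_def by simp
    have Lo: "L \<in> Obj C" using lH Hom_Obj by blast
    have "is_kernel C g (a \<cdot> l)"
    proof (rule is_kernelI[OF g al])
      have "g \<cdot> (a \<cdot> l) = i \<cdot> (b \<cdot> l)" using b(2) Cmp_assoc[OF lH aH g] Cmp_assoc[OF lH b(1) D(4)] by simp
      then show "g \<cdot> (a \<cdot> l) = Zer C L X" using lD(2) L_def Cmp_Zer[OF D(4) Lo] by simp
      fix W h assume h: "h \<in> Hom C W Y" "g \<cdot> h = Zer C W X"
      have W: "W \<in> Obj C" using h Hom_Obj by blast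
      have "p \<cdot> g \<cdot> h = Zer C W X2" using Cmp_assoc[OF h(1) g D(5)] h(2) Cmp_Zer[OF D(5) W] by simp
      then obtain w where w: "w \<in> Hom C W Y1" "a \<cdot> w = h" using aD'(3)[OF h(1)] Y1_def by blast
      have "i \<cdot> (b \<cdot> w) = Zer C W X" using b(2) w h(2) Cmp_assoc[OF w(1) b(1) D(4)] Cmp_assoc[OF w(1) aH g] by simp
      then have "b \<cdot> w = Zer C W X1" by (rule mono_cancel0[OF D(1) Cmp_Hom[OF w(1) b(1)]])
      then obtain w' where w': "w' \<in> Hom C W L" "l \<cdot> w' = w" using lD(3)[OF w(1)] L_def by blast
      then show "\<exists>w\<in>Hom C W L. a \<cdot> l \<cdot> w = h" using w(2) Cmp_assoc[OF w'(1) lH aH] by auto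
    qed
    moreover have "L \<in> t" using aD[OF X(1) Y1 b(1) l] L_def by simp
    ultimately show "\<exists>k. is_kernel C g k \<and> Dom C k \<in> t" using MonoD[OF al] by (auto simp: Hom_def)
  qed
  have 4: "X' \<in> alpha C t" if X: "X \<in> alpha C t" and v: "v \<in> Isos C X X'" for v X X'
  proof -
    obtain w where "w \<in> Isos C X' X" using iso_inv[OF v] by blast
    then show ?thesis using sub[OF iso_mono X] tD(3)[OF iso_epi[OF v] at[OF X]] by blast
  qed
  have "subcategory C (alpha C t)"
    using 4 at tD(1) iso_rel_iff unfolding subcategory_def by blast
  moreover have "Cod C i \<in> alpha C t" if "short_exact C i p" "Dom C i \<in> alpha C t" "Cod C p \<in> alpha C t" for i p
  proof (rule 3[OF _ that(2,3)])
    show "ses C i p (Dom C i) (Cod C i) (Cod C p)"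
      using that(1) by (simp add: short_exact_def is_kernel_def ses_def Hom_def)
  qed
  ultimately show ?thesis unfolding wide_def using 1 2 by blast
qed

end

context abelian_with_length
begin

lemma right_perp_sub: "m \<in> Monos C X Y \<Longrightarrow> Y \<in> right_perp C t \<Longrightarrow> X \<in> right_perp C t"
  using orth_mono Hom_Obj[OF MonoD] unfolding right_perp_def by blast

text \<open>
  An object of minimal length among the nonzero objects of \<open>t \<inter> right_perp C t'\<close>. The image of a map
  from \<open>t\<close> to \<open>right_perp C t'\<close> lies in both classes, so it cannot be properly smaller than \<open>S\<close>.
\<close>

lemma minimal_object:
  assumes t: "torsion_closed C t" and M: "M \<in> t" "M \<in> right_perp C t'" "\<not> zero_obj C M"
  obtains S where "S \<in> t" "S \<in> right_perp C t'" "\<not> zero_obj C S"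
    "\<And>Y g. Y \<in> t \<Longrightarrow> g \<in> Hom C Y S \<Longrightarrow> g \<noteq> Zer C Y S \<Longrightarrow> g \<in> Epis C Y S"
    "\<And>Y h. Y \<in> right_perp C t' \<Longrightarrow> h \<in> Hom C S Y \<Longrightarrow> h \<noteq> Zer C S Y \<Longrightarrow> h \<in> Monos C S Y"
proof -
  define P where "P X = (X \<in> t \<and> X \<in> right_perp C t' \<and> \<not> zero_obj C X)" for X
  obtain S where S: "P S" and min: "\<And>X. P X \<Longrightarrow> len S \<le> len X"
    using exists_least_iff[of "\<lambda>n. \<exists>X. P X \<and> len X = n"] M P_def by (metis not_less)
  have img: "\<exists>e m I. e \<in> Epis C Y I \<and> m \<in> Monos C I Z \<and> m \<cdot> e = g \<and> P I"
    if Y: "Y \<in> t" "Z \<in> right_perp C t'" and g: "g \<in> Hom C Y Z" "g \<noteq> Zer C Y Z" for Y Z g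
  proof -
    obtain K k I e m where s: "ses C k e K Y I" and m: "m \<in> Monos C I Z" "m \<cdot> e = g"
      using factorization[OF g(1)] by metis
    note D = sesD[OF s] and mH = MonoD[OF m(1)]
    have "\<not> zero_obj C I" using zero_objD(1)[OF _ mH] m(2) g Zer_Cmp[OF D(5)] Hom_Obj[OF g(1)] by auto
    then have "P I" using torsion_closedD(3)[OF t D(2) Y(1)] right_perp_sub[OF m(1) Y(2)] P_def by blast
    then show ?thesis using D m by blast
  qed
  show thesis
  proof
    show "S \<in> t" "S \<in> right_perp C t'" "\<not> zero_obj C S" using S P_def by auto
    show "g \<in> Epis C Y S" if Y: "Y \<in> t" and g: "g \<in> Hom C Y S" "g \<noteq> Zer C Y S" for Y g
    proof -
      obtain e m I where e: "e \<in> Epis C Y I" and m: "m \<in> Monos C I S" and me: "m \<cdot> e = g" and I: "P I"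
        using img[OF Y _ g] S P_def by blast
      have "len I = len S" using len_mono[OF m] min[OF I] by simp
      then show ?thesis using epi_Cmp[OF e iso_epi[OF len_mono_iso[OF m]]] me by simp
    qed
    show "h \<in> Monos C S Y" if Y: "Y \<in> right_perp C t'" and h: "h \<in> Hom C S Y" "h \<noteq> Zer C S Y" for Y h
    proof -
      obtain e m I where e: "e \<in> Epis C S I" and m: "m \<in> Monos C I Y" and me: "m \<cdot> e = h" and I: "P I"
        using img[OF _ Y h] S P_def by blast
      have "len S = len I" using len_epi[OF e] min[OF I] by simp
      then show ?thesis using mono_Cmp[OF iso_mono[OF len_epi_iso[OF e]] m] me by simp
    qed
  qed
qed

lemma separating_object:
  assumes t: "torsion_closed C t" and t': "torsion_closed C t'" and M: "M \<in> t" "M \<notin> t'"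
  obtains F where "F \<in> t" "F \<in> right_perp C t'" "\<not> zero_obj C F"
proof -
  have "M \<in> Obj C" using M torsion_closedD(1)[OF t] by blast
  then obtain T i p F where s: "ses C i p T M F" "T \<in> t'" "F \<in> right_perp C t'"
    using torsion_closed_pair[OF t'] unfolding torsion_pair_ses by blast
  have "F \<in> t" using torsion_closedD(3)[OF t] sesD(2)[OF s(1)] M by blast
  moreover have "\<not> zero_obj C F"
    using ses_zero_right[OF s(1)] iso_epi torsion_closedD(3)[OF t'] s(2) M(2) by blast
  ultimately show ?thesis using that s by blast
qed

text \<open>
  The minimal object of \<open>t \<inter> right_perp C t'\<close> is a brick: its nonzero endomorphisms are both mono and epi.
\<close>

lemma separating_brick:
  assumes t: "torsion_closed C t" and t': "torsion_closed C t'" and ne: "\<not> t \<subseteq> t'"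
  shows "\<exists>B. brick C B \<and> B \<in> t \<and> B \<notin> t'"
proof -
  obtain M where "M \<in> t" "M \<notin> t'" using ne by blast
  then obtain F where "F \<in> t" "F \<in> right_perp C t'" "\<not> zero_obj C F"
    using separating_object[OF t t'] by blast
  then obtain S where S: "S \<in> t" "S \<in> right_perp C t'" "\<not> zero_obj C S"
    and e: "\<And>Y g. Y \<in> t \<Longrightarrow> g \<in> Hom C Y S \<Longrightarrow> g \<noteq> Zer C Y S \<Longrightarrow> g \<in> Epis C Y S"
    and m: "\<And>Y h. Y \<in> right_perp C t' \<Longrightarrow> h \<in> Hom C S Y \<Longrightarrow> h \<noteq> Zer C S Y \<Longrightarrow> h \<in> Monos C S Y"
    using minimal_object[OF t] by metis
  have SO: "S \<in> Obj C" using S torsion_closedD(1)[OF t] by blast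
  have "g \<in> Isos C S S" if "g \<in> Hom C S S" "g \<noteq> Zer C S S" for g
    using balanced m[OF S(2) that] e[OF S(1) that] by blast
  then have "brick C S" using brick_iff S SO by blast
  moreover have "S \<notin> t'" using S(2,3) orth_self SO by (auto simp: right_perp_def)
  ultimately show ?thesis using S by blast
qed

definition brick_classes :: "'o set \<Rightarrow> 'o set set" where
  "brick_classes t = {B. brick C B \<and> B \<in> t} // iso_rel C"

lemma brick_classes_strict:
  assumes t: "torsion_closed C t" and t': "torsion_closed C t'" and ne: "t' \<subset> t"
  shows "brick_classes t' \<subset> brick_classes t"
proof -
  obtain B where B: "brick C B" "B \<in> t" "B \<notin> t'" using separating_brick[OF t t'] ne by blast
  have BO: "B \<in> Obj C" using B torsion_closedD(1)[OF t] by blast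
  have "iso_rel C `` {B} \<in> brick_classes t" unfolding brick_classes_def using B by (blast intro: quotientI)
  moreover have "iso_rel C `` {B} \<notin> brick_classes t'"
  proof
    assume "iso_rel C `` {B} \<in> brick_classes t'"
    then obtain B' where B': "B' \<in> t'" "iso_rel C `` {B} = iso_rel C `` {B'}"
      unfolding brick_classes_def by (blast elim!: quotientE)
    have "(B', B) \<in> iso_rel C"
      using B'(2) equiv_iso_rel BO by (metis Image_singleton_iff equiv_class_self)
    then have "B \<in> t'" using B'(1) torsion_closed_subcategory[OF t'] unfolding subcategory_def by blast
    then show False using B by blast
  qed
  moreover have "brick_classes t' \<subseteq> brick_classes t"
    using ne unfolding brick_classes_def quotient_def by blast
  ultimately show ?thesis by blast
qed

text \<open>
  If \<open>T(\<alpha>(t))\<close> were smaller than \<open>t\<close>, there would be a maximal torsion class \<open>t'\<close> in between, different from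
  \<open>t\<close>. A minimal object \<open>S\<close> of \<open>t \<inter> right_perp C t'\<close> then lies in \<open>\<alpha>(t)\<close>, because \<open>t\<close> is generated by \<open>t'\<close>
  and \<open>S\<close>; but \<open>S\<close> is not in \<open>t'\<close>.
\<close>

lemma torsion_class_gen_alpha:
  assumes bf: "brick_finite C" and t: "torsion_closed C t"
  shows "gen_torsion C (alpha C t) = t"
proof (rule ccontr)
  note tD = torsion_closedD[OF t]
  define a where "a = gen_torsion C (alpha C t)"
  assume "gen_torsion C (alpha C t) \<noteq> t"
  then have "a \<noteq> t" by (simp add: a_def)
  have al: "alpha C t \<subseteq> t" by (auto simp: alpha_def)
  then have ac: "torsion_closed C a" unfolding a_def using tD(1) by (intro gen_torsion_closed) blast
  have at: "a \<subseteq> t" "alpha C t \<subseteq> a"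
    unfolding a_def by (rule gen_torsion_least[OF t al], rule gen_torsion_subset)
  \<comment> \<open>Torsion classes are compared by the number of isomorphism classes of bricks in them.\<close>
  define P where "P t' = (torsion_closed C t' \<and> a \<subseteq> t' \<and> t' \<subset> t)" for t'
  have fin: "finite (brick_classes t')" for t'
    by (rule finite_subset[OF _ bf[unfolded brick_finite_def]]) (auto simp: brick_classes_def quotient_def)
  have "P a" using ac at \<open>a \<noteq> t\<close> P_def by blast
  moreover have "\<forall>t'. P t' \<longrightarrow> card (brick_classes t') < Suc (card (brick_classes t))"
    using brick_classes_strict[OF t] psubset_card_mono[OF fin] by (auto simp: P_def less_Suc_eq)
  ultimately obtain t' where t': "P t'" and
    mx: "\<And>t''. P t'' \<Longrightarrow> card (brick_classes t'') \<le> card (brick_classes t')"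
    using ex_has_greatest_nat[of P a "\<lambda>t. card (brick_classes t)"] by blast
  have t'c: "torsion_closed C t'" and t't: "t' \<subset> t" "a \<subseteq> t'" using t' P_def by auto
  obtain M where "M \<in> t" "M \<notin> t'" using t't by blast
  then obtain F where "F \<in> t" "F \<in> right_perp C t'" "\<not> zero_obj C F"
    using separating_object[OF t t'c] by blast
  then obtain S where S: "S \<in> t" "S \<in> right_perp C t'" "\<not> zero_obj C S"
    and Se: "\<And>Y g. Y \<in> t \<Longrightarrow> g \<in> Hom C Y S \<Longrightarrow> g \<noteq> Zer C Y S \<Longrightarrow> g \<in> Epis C Y S"
    and Sm: "\<And>Y h. Y \<in> right_perp C t' \<Longrightarrow> h \<in> Hom C S Y \<Longrightarrow> h \<noteq> Zer C S Y \<Longrightarrow> h \<in> Monos C S Y"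
    using minimal_object[OF t] by metis
  have SO: "S \<in> Obj C" using S tD(1) by blast
  have St': "S \<notin> t'" using S(2,3) orth_self SO by (auto simp: right_perp_def)
  have ins: "insert S t' \<subseteq> t" "insert S t' \<subseteq> Obj C" using S t't tD(1) by auto
  have gen: "gen_torsion C (insert S t') = t"
  proof (rule ccontr)
    assume ne: "gen_torsion C (insert S t') \<noteq> t"
    have c: "torsion_closed C (gen_torsion C (insert S t'))" using gen_torsion_closed ins by blast
    have sub: "insert S t' \<subseteq> gen_torsion C (insert S t')" by (rule gen_torsion_subset)
    have "P (gen_torsion C (insert S t'))"
      using c sub ne gen_torsion_least[OF t ins(1)] t't unfolding P_def by blast
    moreover have "t' \<subset> gen_torsion C (insert S t')" using sub St' by blast
    ultimately show False using mx psubset_card_mono[OF fin brick_classes_strict[OF c t'c]] by fastforce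
  qed
  have "S \<in> alpha C t"
  proof (rule alphaI[OF t S(1)])
    fix Y g assume Y: "Y \<in> t" and g: "g \<in> Hom C Y S"
    have YO: "Y \<in> Obj C" using g Hom_Obj by blast
    show "\<exists>k. is_kernel C g k \<and> Dom C k \<in> t"
    proof (cases "g = Zer C Y S")
      case True
      have "is_kernel C g (Idt C Y)"
        by (rule is_kernelI[OF g iso_mono[OF Idt_iso[OF YO]]])
          (use True Cmp_Idt[OF g] Idt_Cmp in auto)
      then show ?thesis using Y Idt_Arr[OF YO] by auto
    next
      case False
      then obtain K k where k: "ses C k g K Y S" using Se[OF Y g] ses_of_epi by blast
      note kD = sesD[OF k]
      \<comment> \<open>Dividing \<open>Y\<close> by the torsion part \<open>T\<close> of the kernel \<open>K\<close> leaves an extension \<open>Y'\<close> of \<open>S\<close> by \<open>F\<close>.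
        It lies in \<open>t \<inter> f'\<close> and receives a nonzero map \<open>h\<close> from \<open>S\<close>, which splits the extension; so \<open>F\<close> is a
        quotient of \<open>Y'\<close> and vanishes.\<close>
      obtain T i p F where s: "ses C i p T K F" "T \<in> t" "F \<in> right_perp C t"
        using torsion_closed_pair[OF t] kD(6) unfolding torsion_pair_ses by blast
      note sD = sesD[OF s(1)]
      obtain Y' d where d: "ses C (k \<cdot> i) d T Y Y'" using ses_of_mono mono_Cmp[OF sD(1) kD(1)] by blast
      note dD = sesD[OF d]
      obtain k' g' where k': "ses C k' g' F Y' S" using third_iso[OF s(1) k d] by metis
      note k'D = sesD[OF k']
      have Y': "Y' \<in> t" using tD(3) dD Y by blast
      have F': "F \<in> right_perp C t'" using s(3) t't by (auto simp: right_perp_def)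
      have "orth C X Y'" if X: "X \<in> t'" for X
        using abelian_category.orth_ses[OF op, of g' k' S Y' F X] k' F' S(2) X
        by (simp add: right_perp_def)
      then have Y'f: "Y' \<in> right_perp C t'" using dD(8) by (simp add: right_perp_def)
      have "\<not> zero_obj C Y'" using zero_objD(1)[OF _ k'D(5)] epi_from_zero[OF k'D(2)] S(3) by blast
      then obtain x h where x: "x \<in> insert S t'" "h \<in> Hom C x Y'" "h \<noteq> Zer C x Y'"
        using gen_torsion_nonzero_map[OF ins(2)] Y' gen by blast
      have "x \<notin> t'" using x Y'f by (auto simp: right_perp_def orth_def)
      then have h: "h \<in> Hom C S Y'" "h \<noteq> Zer C S Y'" using x by auto
      have hm: "h \<in> Monos C S Y'" using Sm[OF Y'f h] .
      have gh: "g' \<cdot> h \<in> Hom C S S" using Cmp_Hom[OF h(1) k'D(5)] .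
      have "g' \<cdot> h \<noteq> Zer C S S"
      proof
        assume "g' \<cdot> h = Zer C S S"
        then obtain u where u: "u \<in> Hom C S F" "k' \<cdot> u = h" using ses_lift[OF k' h(1)] by blast
        have "u = Zer C S F" using s(3) S(1) u by (auto simp: right_perp_def orth_def)
        then show False using u h Cmp_Zer[OF k'D(4) SO] by simp
      qed
      then have ghe: "g' \<cdot> h \<in> Epis C S S" and ghm: "g' \<cdot> h \<in> Monos C S S"
        using Se[OF S(1) gh] Sm[OF S(2) gh] by blast+
      obtain Q c where c: "ses C h c S Y' Q" using ses_of_mono hm by blast
      obtain \<kappa> K1 where \<kappa>: "ses C \<kappa> (g' \<cdot> h) K1 S S" using ses_of_epi ghe by blast
      have "\<kappa> = Zer C K1 S" using mono_cancel0[OF ghm] sesD[OF \<kappa>] by blast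
      then have K1: "zero_obj C K1" using mono_to_zero sesD[OF \<kappa>] by blast
      obtain \<mu> where "ses C \<mu> (c \<cdot> k') K1 F Q" using second_iso[OF c k' \<kappa>] by blast
      then have "c \<cdot> k' \<in> Isos C F Q" using ses_zero_left K1 by blast
      then obtain v where "v \<in> Isos C Q F" using iso_inv by metis
      then have "F \<in> t" using tD(3) iso_epi sesD(2)[OF c] Y' by blast
      then have "zero_obj C F" using s(3) orth_self by (auto simp: right_perp_def)
      then have "K \<in> t" using ses_zero_right[OF s(1)] iso_epi tD(3) s(2) by blast
      moreover have "is_kernel C g k" using k by (simp add: ses_def short_exact_def)
      ultimately show ?thesis using kD(4) by (auto simp: Hom_def)
    qed
  qed
  then show False using St' at t't by blast
qed

end

section \<open>Widely generated torsion classes\<close>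

text \<open>
  These objects play the role of the simple objects of a wide subcategory generating \<open>t\<close>, but refer to \<open>t\<close>
  only. At the opposite category and a torsionfree class the definition gives the cosimple objects:
  nonzero maps from such an object to the torsionfree class are mono with torsionfree cokernel.
\<close>

definition torsion_simple :: "('o, 'm) precat \<Rightarrow> 'o set \<Rightarrow> 'o \<Rightarrow> bool" where
  "torsion_simple C t S \<longleftrightarrow> S \<in> t \<and> \<not> zero_obj C S \<and>
     (\<forall>Y\<in>t. \<forall>g\<in>Hom C Y S. g \<noteq> Zer C Y S \<longrightarrow>
        g \<in> Epis C Y S \<and> (\<forall>K k. ses C k g K Y S \<longrightarrow> K \<in> t))"

context abelian_with_length
begin

lemma len_quot_less:
  assumes s: "ses C i p X Y Z" and X: "\<not> zero_obj C X" shows "len Z < len Y"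
proof -
  note D = sesD[OF s]
  have False if "len Y = len Z"
  proof -
    have "p \<in> Isos C Y Z" using len_epi_iso[OF D(2) that] .
    then have "i = Zer C X Y" using mono_cancel0[OF iso_mono D(4,3)] by blast
    then show False using mono_to_zero[OF D(1)] X by blast
  qed
  then show ?thesis using len_epi[OF D(2)] by fastforce
qed

text \<open>
  The kernel of \<open>g\<close> lies in \<open>t\<close>, so its inclusion into \<open>S\<close> is zero or epi, and the latter forces \<open>g = 0\<close>.
\<close>

lemma torsion_simple_schur:
  assumes t: "torsion_closed C t" and S: "torsion_simple C t S" and S': "torsion_simple C t S'"
    and g: "g \<in> Hom C S S'" "g \<noteq> Zer C S S'"
  shows "g \<in> Isos C S S'"
proof -
  have St: "S \<in> t" using S by (simp add: torsion_simple_def)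
  have "g \<in> Epis C S S'" using S' g St by (simp add: torsion_simple_def)
  then obtain K k where k: "ses C k g K S S'" using ses_of_epi by blast
  note D = sesD[OF k]
  have K: "K \<in> t" using S' g St k unfolding torsion_simple_def by blast
  have "k = Zer C K S"
  proof (rule ccontr)
    assume "k \<noteq> Zer C K S"
    then have "k \<in> Epis C K S" using S K D(4) by (simp add: torsion_simple_def)
    then show False using epi_cancel0[OF _ g(1) D(3)] g by blast
  qed
  then show ?thesis using ses_zero_left[OF k] mono_to_zero[OF D(1)] by blast
qed

end

locale wide_subcategory = abelian_with_length C len for C :: "('o, 'm) precat" (structure) and len +
  fixes W :: "'o set"
  assumes wide: "wide C W"
begin

lemma kernel_in:
  assumes "is_kernel C f k" "f \<in> Hom C X Y" "X \<in> W" "Y \<in> W" shows "Dom C k \<in> W"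
proof -
  have "Dom C f \<in> W" "Cod C f \<in> W" using assms by (auto simp: Hom_def)
  then show ?thesis using wide assms(1) unfolding wide_def by blast
qed

lemma quotient_in:
  assumes "ses C i p X Y Z" "X \<in> W" "Y \<in> W" shows "Z \<in> W"
proof -
  have "is_cokernel C i p" "Dom C i \<in> W" "Cod C i \<in> W" "Cod C p = Z"
    using assms by (auto simp: ses_def short_exact_def Hom_def)
  then show ?thesis using wide unfolding wide_def by blast
qed

lemma extension_in:
  assumes "ses C i p X Y Z" "X \<in> W" "Z \<in> W" shows "Y \<in> W"
proof -
  have "short_exact C i p" "Dom C i \<in> W" "Cod C p \<in> W" "Cod C i = Y"
    using assms by (auto simp: ses_def Hom_def)
  then show ?thesis using wide unfolding wide_def by blast
qed

lemma iso_in: "v \<in> Isos C X Y \<Longrightarrow> X \<in> W \<Longrightarrow> Y \<in> W"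
  using wide iso_rel_iff unfolding wide_def subcategory_def by blast

lemma W_Obj: "W \<subseteq> Obj C"
  using wide unfolding wide_def subcategory_def by blast

lemma zero_in: assumes X: "X \<in> W" and Z: "zero_obj C Z" shows "Z \<in> W"
proof -
  have XO: "X \<in> Obj C" and ZO: "Z \<in> Obj C" using X W_Obj Z zero_obj_iff by blast+
  have "is_kernel C (Idt C X) (Zer C Z X)"
  proof (rule is_kernelI[OF Idt_Hom[OF XO]])
    show "Zer C Z X \<in> Monos C Z X" by (rule zero_mono[OF Z XO])
    show "Idt C X \<cdot> Zer C Z X = Zer C Z X" by (rule Idt_Cmp[OF Zer_Hom[OF ZO XO]])
    fix V h assume h: "h \<in> Hom C V X" "Idt C X \<cdot> h = Zer C V X"
    have V: "V \<in> Obj C" using h Hom_Obj by blast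
    have "h = Zer C V X" using h Idt_Cmp by metis
    then show "\<exists>u\<in>Hom C V Z. Zer C Z X \<cdot> u = h"
      using Zer_Hom[OF V ZO] Zer_Cmp[OF Zer_Hom[OF V ZO] XO] by blast
  qed
  then have "Dom C (Zer C Z X) \<in> W" using kernel_in Idt_Hom[OF XO] X by blast
  then show ?thesis using Zer_Arr[OF ZO XO] by simp
qed

text \<open>
  Maps from \<open>Y\<close> to \<open>W\<close> have their image in \<open>W\<close> and their kernel in \<open>T(W)\<close>. The objects \<open>Y\<close> with this
  property form a torsion class, so that it suffices to verify it for \<open>Y \<in> W\<close>.
\<close>

definition good :: "'o \<Rightarrow> bool" where
  "good Y \<longleftrightarrow> (\<forall>X\<in>W. \<forall>g\<in>Hom C Y X. \<exists>K k I e m.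
     ses C k e K Y I \<and> m \<in> Monos C I X \<and> m \<cdot> e = g \<and> I \<in> W \<and> K \<in> gen_torsion C W)"

lemma gen_closed: "torsion_closed C (gen_torsion C W)"
  by (rule gen_torsion_closed[OF W_Obj])

lemma good_W: assumes Y: "Y \<in> W" shows "good Y"
  unfolding good_def
proof (intro ballI)
  fix X g assume X: "X \<in> W" and g: "g \<in> Hom C Y X"
  obtain K k I e m where s: "ses C k e K Y I" "m \<in> Monos C I X" "m \<cdot> e = g" "is_kernel C g k"
    using factorization[OF g] by metis
  have "Dom C k \<in> W" using kernel_in[OF s(4) g Y X] .
  then have K: "K \<in> W" using sesD(4)[OF s(1)] by (simp add: Hom_def)
  then have "I \<in> W" using quotient_in[OF s(1)] Y by blast
  then show "\<exists>K k I e m. ses C k e K Y I \<and> m \<in> Monos C I X \<and> m \<cdot> e = g \<and> I \<in> W \<and> K \<in> gen_torsion C W"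
    using s K gen_torsion_subset by blast
qed

lemma good_zero: assumes Y: "zero_obj C Y" shows "good Y"
  unfolding good_def
proof (intro ballI)
  fix X g assume X: "X \<in> W" and g: "g \<in> Hom C Y X"
  have YO: "Y \<in> Obj C" using g Hom_Obj by blast
  have i: "Idt C Y \<in> Isos C Y Y" using Idt_iso[OF YO] .
  have "Idt C Y = Zer C Y Y" using Y zero_obj_iff by blast
  then have "ses C (Idt C Y) (Idt C Y) Y Y Y"
    using sesI[OF iso_mono[OF i] iso_epi[OF i]] Idt_Cmp[OF Idt_Hom[OF YO]] Idt_Cmp by metis
  moreover have "g \<in> Monos C Y X" unfolding mono_iff[OF g] using zero_objD(2)[OF Y] by blast
  ultimately show "\<exists>K k I e m. ses C k e K Y I \<and> m \<in> Monos C I X \<and> m \<cdot> e = g \<and> I \<in> W \<and> K \<in> gen_torsion C W"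
    using zero_in[OF X Y] Cmp_Idt[OF g] torsion_closedD(2)[OF gen_closed Y] by blast
qed

lemma good_quotient: assumes q: "q \<in> Epis C Y Y''" and Y: "good Y" shows "good Y''"
  unfolding good_def
proof (intro ballI)
  fix X g assume X: "X \<in> W" and g: "g \<in> Hom C Y'' X"
  have XO: "X \<in> Obj C" using X W_Obj by blast
  note qH = EpiD[OF q]
  obtain K k I e m where s: "ses C k e K Y I" and m: "m \<in> Monos C I X" "m \<cdot> e = g \<cdot> q"
    and IK: "I \<in> W" "K \<in> gen_torsion C W"
    using Y X Cmp_Hom[OF qH g] unfolding good_def by blast
  note D = sesD[OF s] and mH = MonoD[OF m(1)]
  obtain J j where j: "ses C j q J Y Y''" using ses_of_epi q by blast
  note jD = sesD[OF j]
  have "m \<cdot> (e \<cdot> j) = Zer C J X"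
    using Cmp_assoc[OF jD(4) D(5) mH] m(2) Cmp_assoc[OF jD(4,5) g] jD(3) Cmp_Zer[OF g jD(6)] by simp
  then have "e \<cdot> j = Zer C J I" by (rule mono_cancel0[OF m(1) Cmp_Hom[OF jD(4) D(5)]])
  then obtain e'' where e'': "e'' \<in> Hom C Y'' I" "e'' \<cdot> q = e" using ses_desc[OF j D(5)] by blast
  have e''e: "e'' \<in> Epis C Y'' I" by (rule epi_left[OF qH e''(1)]) (use e'' D in simp)
  have me: "m \<cdot> e'' = g"
    by (rule epi_cancel[OF q Cmp_Hom[OF e''(1) mH] g]) (use Cmp_assoc[OF qH e''(1) mH] e'' m in simp)
  obtain K'' k'' where s'': "ses C k'' e'' K'' Y'' I" using ses_of_epi e''e by blast
  have "ses C k (e'' \<cdot> q) K Y I" using s e'' by simp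
  then obtain h' c' where "ses C c' h' J K K''" using third_iso_op[OF s'' j] by metis
  then have "K'' \<in> gen_torsion C W" using torsion_closedD(3)[OF gen_closed sesD(2)] IK by blast
  then show "\<exists>K k I e m. ses C k e K Y'' I \<and> m \<in> Monos C I X \<and> m \<cdot> e = g \<and> I \<in> W \<and> K \<in> gen_torsion C W"
    using s'' m me IK by blast
qed

text \<open>
  The image \<open>I\<close> of \<open>g\<close> contains the image \<open>I1\<close> of \<open>Y1\<close>, and \<open>I / I1\<close> is the image of the induced map
  \<open>Y2 \<rightarrow> X / I1\<close>; so \<open>I\<close> lies in \<open>W\<close>. The kernel of \<open>g\<close> is an extension of the kernel \<open>K2\<close> of this induced
  map by the kernel \<open>K1\<close> of the restriction to \<open>Y1\<close>. To see this without the snake lemma, let \<open>L\<close> be the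
  preimage of \<open>I1\<close>; inside \<open>L\<close> the subobjects \<open>Y1\<close> and the kernel of \<open>g\<close> span, and the second isomorphism
  theorem applies.
\<close>

lemma good_extension:
  assumes s: "ses C i p Y1 Y Y2" and Y1: "good Y1" and Y2: "good Y2" shows "good Y"
  unfolding good_def
proof (intro ballI)
  fix X g assume X: "X \<in> W" and g: "g \<in> Hom C Y X"
  have XO: "X \<in> Obj C" using X W_Obj by blast
  note D = sesD[OF s]
  have gi: "g \<cdot> i \<in> Hom C Y1 X" using Cmp_Hom[OF D(4) g] .
  obtain K1 k1 I1 e1 m1 where s1: "ses C k1 e1 K1 Y1 I1" and m1: "m1 \<in> Monos C I1 X" "m1 \<cdot> e1 = g \<cdot> i"
    and IK1: "I1 \<in> W" "K1 \<in> gen_torsion C W"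
    using Y1 X gi unfolding good_def by blast
  note D1 = sesD[OF s1] and m1H = MonoD[OF m1(1)]
  obtain X1 c1 where c1: "ses C m1 c1 I1 X X1" using ses_of_mono m1 by blast
  note c1D = sesD[OF c1]
  have X1: "X1 \<in> W" using quotient_in[OF c1 IK1(1) X] .
  have c1g: "c1 \<cdot> g \<in> Hom C Y X1" using Cmp_Hom[OF g c1D(5)] .
  have "c1 \<cdot> g \<cdot> i = Zer C Y1 X1"
    using Cmp_assoc[OF D(4) g c1D(5)] m1(2)[symmetric] Cmp_assoc[OF D1(5) m1H c1D(5)] c1D(3)
      Zer_Cmp[OF D1(5) c1D(8)] by simp
  then obtain g2 where g2: "g2 \<in> Hom C Y2 X1" "g2 \<cdot> p = c1 \<cdot> g" using ses_desc[OF s c1g] by blast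
  obtain K2 k2 I2 e2 m2 where s2: "ses C k2 e2 K2 Y2 I2" and m2: "m2 \<in> Monos C I2 X1" "m2 \<cdot> e2 = g2"
    and IK2: "I2 \<in> W" "K2 \<in> gen_torsion C W"
    using Y2 X1 g2(1) unfolding good_def by blast
  note D2 = sesD[OF s2] and m2H = MonoD[OF m2(1)]
  have e2p: "e2 \<cdot> p \<in> Epis C Y I2" by (rule epi_Cmp[OF D(2) D2(2)])
  have m2e2p: "m2 \<cdot> (e2 \<cdot> p) = c1 \<cdot> g" using m2(2) g2(2) Cmp_assoc[OF D(5) D2(5) m2H] by simp
  \<comment> \<open>\<open>L\<close> is the preimage of \<open>I1\<close> under \<open>g\<close>.\<close>
  obtain L l where l: "ses C l (e2 \<cdot> p) L Y I2" using ses_of_epi e2p by blast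
  note lD = sesD[OF l]
  obtain a b where ab: "ses C a b Y1 L K2" "l \<cdot> a = i" using third_iso_op[OF s2 s l] by metis
  note abD = sesD[OF ab(1)]
  have gl: "g \<cdot> l \<in> Hom C L X" using Cmp_Hom[OF lD(4) g] .
  have "c1 \<cdot> (g \<cdot> l) = m2 \<cdot> (e2 \<cdot> p \<cdot> l)"
    using m2e2p Cmp_assoc[OF lD(4) g c1D(5)] Cmp_assoc[OF lD(4,5) m2H] by simp
  then have "c1 \<cdot> (g \<cdot> l) = Zer C L X1" using lD(3) Cmp_Zer[OF m2H lD(6)] by simp
  then obtain gL where gL: "gL \<in> Hom C L I1" "m1 \<cdot> gL = g \<cdot> l" using ses_lift[OF c1 gl] by blast
  have gLa: "gL \<cdot> a = e1"
    by (rule mono_cancel[OF m1(1) Cmp_Hom[OF abD(4) gL(1)] D1(5)])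
      (use Cmp_assoc[OF abD(4) gL(1) m1H] gL(2) Cmp_assoc[OF abD(4) lD(4) g] ab(2) m1(2) in simp)
  have "gL \<in> Epis C L I1" by (rule epi_left[OF abD(4) gL(1)]) (use gLa D1 in simp)
  then obtain K' k' where k': "ses C k' gL K' L I1" using ses_of_epi by blast
  note k'D = sesD[OF k']
  obtain \<mu> where "ses C \<mu> (b \<cdot> k') K1 K' K2" using second_iso[OF ab(1) k'] s1 gLa by metis
  then have K': "K' \<in> gen_torsion C W" using torsion_closedD(4)[OF gen_closed] IK1 IK2 by blast
  obtain K k I e m where ke: "ses C k e K Y I" and m: "m \<in> Monos C I X" "m \<cdot> e = g"
    using factorization[OF g] by metis
  note eD = sesD[OF ke] and mH = MonoD[OF m(1)]
  have lk': "l \<cdot> k' \<in> Hom C K' Y" using Cmp_Hom[OF k'D(4) lD(4)] .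
  have "ses C (l \<cdot> k') e K' Y I"
  proof (rule sesI[OF mono_Cmp[OF k'D(1) lD(1)] eD(2)])
    have "m \<cdot> (e \<cdot> (l \<cdot> k')) = g \<cdot> l \<cdot> k'"
      using m(2) Cmp_assoc[OF lk' eD(5) mH] Cmp_assoc[OF k'D(4) lD(4) g] by simp
    also have "\<dots> = Zer C K' X"
      using gL(2)[symmetric] Cmp_assoc[OF k'D(4) gL(1) m1H] k'D(3) Cmp_Zer[OF m1H k'D(6)] by simp
    finally show "e \<cdot> (l \<cdot> k') = Zer C K' I" by (rule mono_cancel0[OF m(1) Cmp_Hom[OF lk' eD(5)]])
    fix V h assume h: "h \<in> Hom C V Y" "e \<cdot> h = Zer C V I"
    have V: "V \<in> Obj C" using h Hom_Obj by blast
    have gh: "g \<cdot> h = Zer C V X" using m(2) Cmp_assoc[OF h(1) eD(5) mH] h(2) Cmp_Zer[OF mH V] by simp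
    have "m2 \<cdot> (e2 \<cdot> p \<cdot> h) = Zer C V X1"
      using m2e2p Cmp_assoc[OF h(1) lD(5) m2H] Cmp_assoc[OF h(1) g c1D(5)] gh Cmp_Zer[OF c1D(5) V] by simp
    then have "e2 \<cdot> p \<cdot> h = Zer C V I2" by (rule mono_cancel0[OF m2(1) Cmp_Hom[OF h(1) lD(5)]])
    then obtain w where w: "w \<in> Hom C V L" "l \<cdot> w = h" using ses_lift[OF l h(1)] by blast
    have "m1 \<cdot> (gL \<cdot> w) = Zer C V X"
      using gL(2) Cmp_assoc[OF w(1) gL(1) m1H] Cmp_assoc[OF w(1) lD(4) g] w(2) gh by simp
    then have "gL \<cdot> w = Zer C V I1" by (rule mono_cancel0[OF m1(1) Cmp_Hom[OF w(1) gL(1)]])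
    then obtain w' where w': "w' \<in> Hom C V K'" "k' \<cdot> w' = w" using ses_lift[OF k' w(1)] by blast
    then show "\<exists>u\<in>Hom C V K'. l \<cdot> k' \<cdot> u = h" using w Cmp_assoc[OF w'(1) k'D(4) lD(4)] by auto
  qed
  moreover have "I \<in> W"
  proof -
    have ei: "e \<cdot> i \<in> Hom C Y1 I" using Cmp_Hom[OF D(4) eD(5)] .
    have mei: "m \<cdot> (e \<cdot> i) = m1 \<cdot> e1" using m(2) Cmp_assoc[OF D(4) eD(5) mH] m1(2) by simp
    have "m \<cdot> (e \<cdot> i \<cdot> k1) = Zer C K1 X"
      using mei Cmp_assoc[OF D1(4) ei mH] Cmp_assoc[OF D1(4,5) m1H] D1(3) Cmp_Zer[OF m1H D1(6)] by simp
    then have "e \<cdot> i \<cdot> k1 = Zer C K1 I" by (rule mono_cancel0[OF m(1) Cmp_Hom[OF D1(4) ei]])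
    then obtain \<iota> where \<iota>: "\<iota> \<in> Hom C I1 I" "\<iota> \<cdot> e1 = e \<cdot> i" using ses_desc[OF s1 ei] by blast
    have m\<iota>: "m \<cdot> \<iota> = m1"
      by (rule epi_cancel[OF D1(2) Cmp_Hom[OF \<iota>(1) mH] m1H]) (use Cmp_assoc[OF D1(5) \<iota>(1) mH] \<iota> mei in simp)
    have "\<iota> \<in> Monos C I1 I" by (rule mono_right[OF \<iota>(1) mH]) (use m\<iota> m1 in simp)
    then obtain C' c where c: "ses C \<iota> c I1 I C'" using ses_of_mono by blast
    note cD = sesD[OF c]
    obtain N d where d: "ses C m d I X N" using ses_of_mono m by blast
    have "ses C (m \<cdot> \<iota>) c1 I1 X X1" using c1 m\<iota> by simp
    then obtain h' c' where h': "ses C h' c' C' X1 N" "h' \<cdot> c = c1 \<cdot> m" using third_iso[OF c d] by metis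
    have "h' \<cdot> (c \<cdot> e) = m2 \<cdot> (e2 \<cdot> p)"
      using h'(2) m2e2p m(2) Cmp_assoc[OF eD(5) cD(5) sesD(4)[OF h'(1)]] Cmp_assoc[OF eD(5) mH c1D(5)] by simp
    then obtain v where "v \<in> Isos C C' I2"
      using image_unique[OF epi_Cmp[OF eD(2) cD(2)] sesD(1)[OF h'(1)] e2p m2(1)] by metis
    then obtain v' where "v' \<in> Isos C I2 C'" using iso_inv by metis
    then have "C' \<in> W" using iso_in IK2 by blast
    then show ?thesis using extension_in[OF c] IK1 by blast
  qed
  ultimately show "\<exists>K k I e m. ses C k e K Y I \<and> m \<in> Monos C I X \<and> m \<cdot> e = g \<and> I \<in> W \<and> K \<in> gen_torsion C W"
    using m K' by blast
qed

lemma good_gen: assumes "Y \<in> gen_torsion C W" shows "good Y"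
proof -
  let ?P = "{Y \<in> Obj C. good Y}"
  have "torsion_closed C ?P"
    unfolding torsion_closed_def
  proof (intro conjI allI impI)
    show "?P \<subseteq> Obj C" by blast
    show "Z \<in> ?P" if "zero_obj C Z" for Z using that good_zero zero_obj_iff by blast
    show "Y \<in> ?P" if "f \<in> Epis C X Y \<and> X \<in> ?P" for f X Y
      using that good_quotient[of f X Y] Hom_Obj[OF EpiD, of f X Y] by blast
    show "Y \<in> ?P" if "ses C i p X Y Z \<and> X \<in> ?P \<and> Z \<in> ?P" for i p X Y Z
      using that good_extension[of i p X Y Z] sesD(7)[of i p X Y Z] by blast
  qed
  moreover have "W \<subseteq> ?P" using good_W W_Obj by blast
  ultimately show ?thesis using gen_torsion_least assms by blast
qed

text \<open>
  A nonzero object \<open>S\<close> of \<open>W\<close> of minimal length among the subobjects of some \<open>X \<in> W\<close> is torsion simple, as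
  images of maps from \<open>T(W)\<close> to \<open>S\<close> lie in \<open>W\<close>. Induction on \<open>X / S\<close> gives the result.
\<close>

lemma gen_by_torsion_simples: "gen_torsion C {S. torsion_simple C (gen_torsion C W) S} = gen_torsion C W"
proof
  let ?t = "gen_torsion C W"
  let ?s = "gen_torsion C {S. torsion_simple C ?t S}"
  have sub: "{S. torsion_simple C ?t S} \<subseteq> ?t" by (auto simp: torsion_simple_def)
  then show "?s \<subseteq> ?t" by (rule gen_torsion_least[OF gen_closed])
  have sc: "torsion_closed C ?s" using gen_torsion_closed sub torsion_closedD(1)[OF gen_closed] by blast
  have "X \<in> ?s" if "X \<in> W" for X
    using that
  proof (induction "len X" arbitrary: X rule: less_induct)
    case less
    have XO: "X \<in> Obj C" using less W_Obj by blast
    show ?case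
    proof (cases "zero_obj C X")
      case True
      then show ?thesis using torsion_closedD(2)[OF sc] by blast
    next
      case False
      define P where "P S = (S \<in> W \<and> \<not> zero_obj C S \<and> (\<exists>j. j \<in> Monos C S X))" for S
      have "P X" using less False iso_mono[OF Idt_iso[OF XO]] P_def by blast
      then obtain S where S: "P S" and min: "\<And>S'. P S' \<Longrightarrow> len S \<le> len S'"
        using exists_least_iff[of "\<lambda>n. \<exists>X. P X \<and> len X = n"] by (metis not_less)
      obtain j where j: "j \<in> Monos C S X" using S P_def by blast
      have SW: "S \<in> W" "\<not> zero_obj C S" using S P_def by auto
      have "g \<in> Epis C Y S \<and> (\<forall>K k. ses C k g K Y S \<longrightarrow> K \<in> ?t)"
        if Y: "Y \<in> ?t" and g: "g \<in> Hom C Y S" "g \<noteq> Zer C Y S" for Y g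
      proof -
        obtain K k I e m where s: "ses C k e K Y I" and m: "m \<in> Monos C I S" "m \<cdot> e = g"
          and IK: "I \<in> W" "K \<in> ?t"
          using good_gen[OF Y] SW(1) g(1) unfolding good_def by blast
        note D = sesD[OF s] and mH = MonoD[OF m(1)]
        have "\<not> zero_obj C I" using zero_objD(1)[OF _ mH] m(2) g Zer_Cmp[OF D(5)] Hom_Obj[OF g(1)] by auto
        then have "P I" using IK mono_Cmp[OF m(1) j] P_def by blast
        then have "len I = len S" using len_mono[OF m(1)] min by (simp add: le_antisym)
        then have mi: "m \<in> Isos C I S" using len_mono_iso m by blast
        then have kg: "ses C k g K Y S" using ses_iso_right[OF s] m by metis
        have "K' \<in> ?t" if "ses C k' g K' Y S" for K' k'
        proof -
          have "is_kernel C g k" "is_kernel C g k'" "Dom C k = K" "Dom C k' = K'"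
            using kg that by (auto simp: ses_def short_exact_def Hom_def)
          then show ?thesis using kernel_unique iso_epi torsion_closedD(3)[OF gen_closed] IK by blast
        qed
        then show ?thesis using sesD(2)[OF kg] by blast
      qed
      then have "torsion_simple C ?t S" using SW gen_torsion_subset unfolding torsion_simple_def by blast
      then have Ss: "S \<in> ?s" using gen_torsion_subset by blast
      obtain X' p where p: "ses C j p S X X'" using ses_of_mono j by blast
      have "X' \<in> W" using quotient_in[OF p] SW less by blast
      then have "X' \<in> ?s" using less(1)[OF len_quot_less[OF p SW(2)]] by blast
      then show ?thesis using torsion_closedD(4)[OF sc p Ss] by blast
    qed
  qed
  then show "?t \<subseteq> ?s" using gen_torsion_least[OF sc] by blast
qed

end

section \<open>Finitely generated torsion classes\<close>

definition fin_gen :: "('o, 'm) precat \<Rightarrow> 'o set \<Rightarrow> bool" where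
  "fin_gen C t \<longleftrightarrow> (\<exists>G. finite G \<and> G \<subseteq> Obj C \<and> t = gen_torsion C G)"

context abelian_with_length
begin

lemma directed_Union_closed:
  assumes c: "\<And>t. t \<in> \<T> \<Longrightarrow> torsion_closed C t" and ne: "\<T> \<noteq> {}"
    and dir: "\<And>a b. a \<in> \<T> \<Longrightarrow> b \<in> \<T> \<Longrightarrow> \<exists>c\<in>\<T>. a \<subseteq> c \<and> b \<subseteq> c"
  shows "torsion_closed C (\<Union>\<T>)"
  unfolding torsion_closed_def
proof (intro conjI allI impI)
  note cD = torsion_closedD[OF c]
  show "\<Union>\<T> \<subseteq> Obj C" using cD(1) by blast
  show "Z \<in> \<Union>\<T>" if "zero_obj C Z" for Z using that cD(2) ne by blast
  show "Y \<in> \<Union>\<T>" if f: "f \<in> Epis C X Y \<and> X \<in> \<Union>\<T>" for X Y f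
  proof -
    obtain a where "a \<in> \<T>" "X \<in> a" using f by blast
    then show ?thesis using cD(3)[of a f X Y] f by blast
  qed
  show "Y \<in> \<Union>\<T>" if s: "ses C i p X Y Z \<and> X \<in> \<Union>\<T> \<and> Z \<in> \<Union>\<T>" for i p X Y Z
  proof -
    obtain a b where "a \<in> \<T>" "b \<in> \<T>" "X \<in> a" "Z \<in> b" using s by blast
    then obtain c where "c \<in> \<T>" "X \<in> c" "Z \<in> c" using dir[of a b] by blast
    then show ?thesis using cD(4)[of c i p X Y Z] s by blast
  qed
qed

lemma finite_subset_directed_Union:
  assumes "finite H" "H \<subseteq> \<Union>\<T>" "\<T> \<noteq> {}"
    and dir: "\<And>a b. a \<in> \<T> \<Longrightarrow> b \<in> \<T> \<Longrightarrow> \<exists>c\<in>\<T>. a \<subseteq> c \<and> b \<subseteq> c"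
  shows "\<exists>t\<in>\<T>. H \<subseteq> t"
  using assms(1,2)
proof (induction H rule: finite_induct)
  case empty
  then show ?case using assms(3) by blast
next
  case (insert x H)
  then obtain a b where "a \<in> \<T>" "H \<subseteq> a" "b \<in> \<T>" "x \<in> b" by blast
  then show ?case using dir[of a b] by blast
qed

lemma gen_torsion_mono: "S \<subseteq> S' \<Longrightarrow> S' \<subseteq> Obj C \<Longrightarrow> gen_torsion C S \<subseteq> gen_torsion C S'"
  using gen_torsion_least[OF gen_torsion_closed, of S' S] gen_torsion_subset[of S'] by blast

text \<open>
  A torsion class is the directed union of the torsion classes generated by the finite parts of a
  generating set, so finitely many objects of it already lie in one of these.
\<close>

lemma fin_gen_refine:
  assumes SG: "S \<subseteq> Obj C" "G \<subseteq> Obj C" and fg: "fin_gen C (gen_torsion C (S \<union> G))"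
  obtains F where "finite F" "F \<subseteq> S" "gen_torsion C (S \<union> G) = gen_torsion C (F \<union> G)"
proof -
  define \<T> where "\<T> = {gen_torsion C (F \<union> G) |F. finite F \<and> F \<subseteq> S}"
  have SGO: "S \<union> G \<subseteq> Obj C" using SG by blast
  have dir: "\<exists>c\<in>\<T>. a \<subseteq> c \<and> b \<subseteq> c" if "a \<in> \<T>" "b \<in> \<T>" for a b
  proof -
    have "\<exists>F. x = gen_torsion C (F \<union> G) \<and> finite F \<and> F \<subseteq> S" if "x \<in> \<T>" for x
      using that unfolding \<T>_def by (rule CollectD)
    then obtain F F' where F: "finite F" "F \<subseteq> S" "a = gen_torsion C (F \<union> G)"
      and F': "finite F'" "F' \<subseteq> S" "b = gen_torsion C (F' \<union> G)"
      using \<open>a \<in> \<T>\<close> \<open>b \<in> \<T>\<close> by metis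
    have O: "F \<union> F' \<union> G \<subseteq> Obj C" using F F' SGO by blast
    have "a \<subseteq> gen_torsion C (F \<union> F' \<union> G)" "b \<subseteq> gen_torsion C (F \<union> F' \<union> G)"
      unfolding F F' by (rule gen_torsion_mono[OF _ O], blast)+
    moreover have "gen_torsion C (F \<union> F' \<union> G) \<in> \<T>" unfolding \<T>_def using F F' by blast
    ultimately show ?thesis by blast
  qed
  have "gen_torsion C ({} \<union> G) \<in> \<T>" unfolding \<T>_def by blast
  then have ne: "\<T> \<noteq> {}" by blast
  have "torsion_closed C t" if "t \<in> \<T>" for t
  proof -
    obtain F where F: "F \<subseteq> S" "t = gen_torsion C (F \<union> G)" using \<open>t \<in> \<T>\<close> unfolding \<T>_def by blast
    show ?thesis unfolding F(2) by (rule gen_torsion_closed) (use F SGO in blast)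
  qed
  then have "torsion_closed C (\<Union>\<T>)" using directed_Union_closed ne dir by blast
  moreover have "S \<union> G \<subseteq> \<Union>\<T>"
  proof
    fix x assume "x \<in> S \<union> G"
    then have "x \<in> gen_torsion C ((if x \<in> S then {x} else {}) \<union> G)"
      using gen_torsion_subset[of "(if x \<in> S then {x} else {}) \<union> G"] by (auto split: if_splits)
    moreover have "gen_torsion C ((if x \<in> S then {x} else {}) \<union> G) \<in> \<T>"
      unfolding \<T>_def by (intro CollectI exI[of _ "if x \<in> S then {x} else {}"]) auto
    ultimately show "x \<in> \<Union>\<T>" by blast
  qed
  ultimately have sub: "gen_torsion C (S \<union> G) \<subseteq> \<Union>\<T>" by (rule gen_torsion_least)
  obtain H where H: "finite H" "H \<subseteq> Obj C" "gen_torsion C (S \<union> G) = gen_torsion C H"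
    using fg unfolding fin_gen_def by blast
  have "H \<subseteq> \<Union>\<T>" using sub H(3) gen_torsion_subset[of H] by blast
  then obtain t where t: "t \<in> \<T>" "H \<subseteq> t" using finite_subset_directed_Union[OF H(1) _ ne dir] by blast
  then obtain F where F: "finite F" "F \<subseteq> S" "t = gen_torsion C (F \<union> G)" unfolding \<T>_def by blast
  have FGO: "F \<union> G \<subseteq> Obj C" using F SGO by blast
  have "gen_torsion C (S \<union> G) \<subseteq> gen_torsion C (F \<union> G)"
    unfolding H(3) using gen_torsion_least[OF gen_torsion_closed[OF FGO]] t F by blast
  moreover have "gen_torsion C (F \<union> G) \<subseteq> gen_torsion C (S \<union> G)"
    by (rule gen_torsion_mono[OF _ SGO]) (use F in blast)
  ultimately show ?thesis using that F by blast
qed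

lemma chain_Union:
  assumes ch: "\<C> \<noteq> {}" "subset.chain {t. torsion_closed C t} \<C>"
  shows "torsion_closed C (\<Union>\<C>)" "fin_gen C (\<Union>\<C>) \<Longrightarrow> \<Union>\<C> \<in> \<C>"
proof -
  have c: "torsion_closed C t" if "t \<in> \<C>" for t using ch that unfolding subset.chain_def by blast
  have dir: "\<exists>c\<in>\<C>. a \<subseteq> c \<and> b \<subseteq> c" if ab: "a \<in> \<C>" "b \<in> \<C>" for a b
  proof -
    have "a \<subseteq> b \<or> b \<subseteq> a" using ch ab unfolding subset.chain_def by blast
    then show ?thesis using ab by blast
  qed
  show "torsion_closed C (\<Union>\<C>)" by (rule directed_Union_closed[OF c ch(1) dir])
  assume "fin_gen C (\<Union>\<C>)"
  then obtain H where H: "finite H" "\<Union>\<C> = gen_torsion C H" unfolding fin_gen_def by blast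
  then have "H \<subseteq> \<Union>\<C>" using gen_torsion_subset[of H] by blast
  then obtain t where t: "t \<in> \<C>" "H \<subseteq> t" using finite_subset_directed_Union[OF H(1) _ ch(1) dir] by blast
  then have "\<Union>\<C> \<subseteq> t" unfolding H(2) using gen_torsion_least[OF c] by blast
  then show "\<Union>\<C> \<in> \<C>" using t by (metis Union_upper subset_antisym)
qed

end

section \<open>Enlarging a torsion class by a cosimple torsionfree object\<close>

text \<open>
  The setting for comparing \<open>t\<close> with the torsion class \<open>u\<close> obtained by adding a cosimple object \<open>B\<close> of the
  torsionfree class \<open>f\<close> of \<open>t\<close>.
\<close>

locale upper_cover = abelian_with_length C len for C :: "('o, 'm) precat" (structure) and len +
  fixes t :: "'o set" and B :: 'o
  assumes t: "torsion_closed C t"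
    and B: "torsion_simple (opp C) (right_perp C t) B"
begin

definition f :: "'o set" where "f = right_perp C t"

definition u :: "'o set" where "u = gen_torsion C (insert B t)"

lemma B_f: "B \<in> f" "\<not> zero_obj C B" "B \<in> Obj C"
proof -
  show "B \<in> f" "\<not> zero_obj C B" using B by (simp_all add: torsion_simple_def f_def)
  then show "B \<in> Obj C" by (simp add: f_def right_perp_def)
qed

lemma B_map:
  assumes "Y \<in> f" "g \<in> Hom C B Y" "g \<noteq> Zer C B Y"
  shows "g \<in> Monos C B Y" "ses C g k B Y K \<Longrightarrow> K \<in> f"
  using assms B unfolding torsion_simple_def f_def opp_simps opp_Hom opp_Epis opp_ses by blast+

lemma f_sub: "m \<in> Monos C X Y \<Longrightarrow> Y \<in> f \<Longrightarrow> X \<in> f"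
  unfolding f_def by (rule right_perp_sub)

lemma f_ext: assumes s: "ses C i p X Y Z" "X \<in> f" "Z \<in> f" shows "Y \<in> f"
  using torsion_closedD(4)[OF abelian_category.left_perp_closed[OF op, of t], of p i Z Y X] assms
  by (simp add: f_def)

lemma t_f: "X \<in> t \<Longrightarrow> Y \<in> f \<Longrightarrow> h \<in> Hom C X Y \<Longrightarrow> h = Zer C X Y"
  by (auto simp: f_def right_perp_def orth_def)

lemma t_f_zero: "X \<in> t \<Longrightarrow> X \<in> f \<Longrightarrow> zero_obj C X"
  using orth_self by (auto simp: f_def right_perp_def)

lemma Bt_Obj: "insert B t \<subseteq> Obj C"
  using B_f torsion_closedD(1)[OF t] by blast

lemma u_closed: "torsion_closed C u"
  unfolding u_def by (rule gen_torsion_closed[OF Bt_Obj])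

lemma t_u: "t \<subseteq> u" "B \<in> u"
  using gen_torsion_subset[of "insert B t"] unfolding u_def by auto

lemma t_neq_u: "B \<notin> t"
  using t_f_zero B_f by blast

lemma torsion_seq:
  assumes "M \<in> Obj C" shows "\<exists>T i p F. ses C i p T M F \<and> T \<in> t \<and> F \<in> f"
  using torsion_closed_pair[OF t] assms unfolding torsion_pair_ses f_def by blast

text \<open>
  Objects of \<open>u \<inter> f\<close> are iterated extensions of \<open>B\<close>: a nonzero one receives a nonzero map from \<open>B\<close>, since
  it receives none from \<open>t\<close>, and the cokernel of this map lies again in \<open>u \<inter> f\<close>.
\<close>

lemma uf_filtered:
  assumes X: "X \<in> u" "X \<in> f" "\<not> zero_obj C X"
  obtains b q Z where "ses C b q B X Z" "Z \<in> u" "Z \<in> f"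
proof -
  obtain s g where s: "s \<in> insert B t" "g \<in> Hom C s X" "g \<noteq> Zer C s X"
    using gen_torsion_nonzero_map[OF Bt_Obj] X unfolding u_def by blast
  then have g: "g \<in> Hom C B X" "g \<noteq> Zer C B X" using t_f X by blast+
  note bm = B_map[OF X(2) g]
  obtain q Z where q: "ses C g q B X Z" using ses_of_mono[OF bm(1)] by blast
  then show ?thesis using that[OF q torsion_closedD(3)[OF u_closed sesD(2)[OF q] X(1)] bm(2)[OF q]] by blast
qed

text \<open>
  For \<open>Z = B\<close> this holds because \<open>B\<close> is cosimple; the general case follows by peeling off copies of \<open>B\<close>.
\<close>

lemma f_quotient:
  assumes "Z \<in> u" "Z \<in> f" "ses C h c Z E Q" "E \<in> f"
  shows "Q \<in> f"
  using assms
proof (induction "len Z" arbitrary: Z h c E rule: less_induct)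
  case less
  note s = less.prems(3)
  note D = sesD[OF s]
  show ?case
  proof (cases "zero_obj C Z")
    case True
    then obtain v where "v \<in> Isos C Q E" using ses_zero_left[OF s] iso_inv by metis
    then show ?thesis using f_sub iso_mono less.prems by blast
  next
    case False
    then obtain b q Z' where b: "ses C b q B Z Z'" "Z' \<in> u" "Z' \<in> f"
      using uf_filtered less.prems by blast
    note bD = sesD[OF b(1)]
    have hb: "h \<cdot> b \<in> Monos C B E" by (rule mono_Cmp[OF bD(1) D(1)])
    have "h \<cdot> b \<noteq> Zer C B E" using mono_to_zero[OF hb] B_f by blast
    note hb' = B_map[OF less.prems(4) MonoD[OF hb] this]
    obtain d E' where d: "ses C (h \<cdot> b) d B E E'" using ses_of_mono hb by blast
    obtain h' c' where "ses C h' c' Z' E' Q" using third_iso[OF b(1) s d] by metis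
    then show ?thesis using less.hyps[OF len_quot_less[OF b(1) B_f(2)] b(2,3)] hb'(2)[OF d] by blast
  qed
qed

text \<open>
  If the torsion part \<open>T\<close> of \<open>E\<close> maps nontrivially to \<open>S\<close>, then it maps isomorphically, since the kernel
  lies both in \<open>t\<close> and in \<open>Z\<close>. Otherwise \<open>T\<close> lies in \<open>Z\<close> and vanishes; then \<open>E\<close> is in \<open>f\<close>, and so is its
  quotient \<open>S\<close> by \<open>f_quotient\<close>, which is impossible.
\<close>

lemma split_extension:
  assumes S: "torsion_simple C t S" and Z: "Z \<in> u" "Z \<in> f" and s: "ses C i p Z E S"
  shows "\<exists>\<sigma>\<in>Hom C S E. p \<cdot> \<sigma> = Idt C S" "\<exists>\<rho>\<in>Hom C E Z. \<rho> \<cdot> i = Idt C Z"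
proof -
  note D = sesD[OF s]
  have St: "S \<in> t" "\<not> zero_obj C S" using S by (auto simp: torsion_simple_def)
  obtain T j r F where tr: "ses C j r T E F" "T \<in> t" "F \<in> f" using torsion_seq[OF D(7)] by blast
  note rD = sesD[OF tr(1)]
  have pj: "p \<cdot> j \<in> Hom C T S" using Cmp_Hom[OF rD(4) D(5)] .
  have pj0: "p \<cdot> j \<noteq> Zer C T S"
  proof
    assume "p \<cdot> j = Zer C T S"
    then obtain x where x: "x \<in> Hom C T Z" "i \<cdot> x = j" using ses_lift[OF s rD(4)] by blast
    then have "j = Zer C T E" using t_f[OF tr(2) Z(2)] Cmp_Zer[OF D(4) rD(6)] by auto
    then have "zero_obj C T" using mono_to_zero rD(1) by blast
    then have "E \<in> f" using f_sub[OF iso_mono[OF ses_zero_left[OF tr(1)]] tr(3)] by blast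
    then have "S \<in> f" using f_quotient[OF Z s] by blast
    then show False using t_f_zero St by blast
  qed
  then have pje: "p \<cdot> j \<in> Epis C T S" using S tr(2) pj by (simp add: torsion_simple_def)
  obtain K k where k: "ses C k (p \<cdot> j) K T S" using ses_of_epi pje by blast
  note kD = sesD[OF k]
  have K: "K \<in> t" using S tr(2) pj pj0 k unfolding torsion_simple_def by blast
  have jk: "j \<cdot> k \<in> Hom C K E" using Cmp_Hom[OF kD(4) rD(4)] .
  have "p \<cdot> (j \<cdot> k) = Zer C K S" using kD(3) Cmp_assoc[OF kD(4) rD(4) D(5)] by simp
  then obtain x where x: "x \<in> Hom C K Z" "i \<cdot> x = j \<cdot> k" using ses_lift[OF s jk] by blast
  then have "j \<cdot> k = Zer C K E" using t_f[OF K Z(2)] Cmp_Zer[OF D(4) kD(6)] by auto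
  then have K0: "zero_obj C K" using mono_to_zero mono_Cmp[OF kD(1) rD(1)] by blast
  then have pji: "p \<cdot> j \<in> Isos C T S" using ses_zero_left[OF k] by blast
  then obtain v where v: "v \<in> Hom C S T" "p \<cdot> j \<cdot> v = Idt C S" using iso_inv IsoD by metis
  then have "p \<cdot> (j \<cdot> v) = Idt C S" using Cmp_assoc[OF v(1) rD(4) D(5)] by simp
  then show "\<exists>\<sigma>\<in>Hom C S E. p \<cdot> \<sigma> = Idt C S" using Cmp_Hom[OF v(1) rD(4)] by blast
  obtain \<mu> where "ses C \<mu> (r \<cdot> i) K Z F" using second_iso[OF tr(1) s k] by blast
  then have "r \<cdot> i \<in> Isos C Z F" using ses_zero_left K0 by blast
  then obtain y where y: "y \<in> Hom C F Z" "y \<cdot> (r \<cdot> i) = Idt C Z" using iso_inv IsoD by metis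
  then have "y \<cdot> r \<cdot> i = Idt C Z" using Cmp_assoc[OF D(4) rD(5) y(1)] by simp
  then show "\<exists>\<rho>\<in>Hom C E Z. \<rho> \<cdot> i = Idt C Z" using Cmp_Hom[OF rD(5) y(1)] by blast
qed

text \<open>
  The obstruction is the pushout of the given sequence along \<open>\<phi>\<close>, an extension of \<open>S\<close> by \<open>Z\<close>, and it splits.
\<close>

lemma extend_map:
  assumes S: "torsion_simple C t S" and Z: "Z \<in> u" "Z \<in> f" and s: "ses C i p K Y S" and \<phi>: "\<phi> \<in> Hom C K Z"
  shows "\<exists>\<psi>\<in>Hom C Y Z. \<psi> \<cdot> i = \<phi>"
proof -
  obtain P i' p' g' where P: "ses C i' p' Z P S" "g' \<in> Hom C Y P" "g' \<cdot> i = i' \<cdot> \<phi>"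
    using pushout_ses[OF s \<phi>] by metis
  obtain \<rho> where \<rho>: "\<rho> \<in> Hom C P Z" "\<rho> \<cdot> i' = Idt C Z" using split_extension(2)[OF S Z P(1)] by blast
  have "\<rho> \<cdot> g' \<cdot> i = \<phi>"
    using Cmp_assoc[OF sesD(4)[OF s] P(2) \<rho>(1)] P(3) Cmp_assoc[OF \<phi> sesD(4)[OF P(1)] \<rho>(1)] \<rho>(2) Idt_Cmp[OF \<phi>] by simp
  then show ?thesis using Cmp_Hom[OF P(2) \<rho>(1)] by blast
qed

lemma lift_map:
  assumes S: "torsion_simple C t S" and N: "N \<in> u" "N \<in> f" and s: "ses C n q N Y Q" and g: "g \<in> Hom C S Q"
  shows "\<exists>x\<in>Hom C S Y. q \<cdot> x = g"
proof -
  obtain P i' p' g' where P: "ses C i' p' N P S" "g' \<in> Hom C P Y" "q \<cdot> g' = g \<cdot> p'"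
    using pullback_ses[OF s g] by metis
  obtain \<sigma> where \<sigma>: "\<sigma> \<in> Hom C S P" "p' \<cdot> \<sigma> = Idt C S" using split_extension(1)[OF S N P(1)] by blast
  have "q \<cdot> (g' \<cdot> \<sigma>) = g"
    using Cmp_assoc[OF \<sigma>(1) P(2) sesD(5)[OF s]] P(3) Cmp_assoc[OF \<sigma>(1) sesD(5)[OF P(1)] g] \<sigma>(2) Cmp_Idt[OF g] by simp
  then show ?thesis using Cmp_Hom[OF \<sigma>(1) P(2)] by blast
qed

text \<open>
  If \<open>S\<close> is no quotient of an object of \<open>u \<inter> f\<close>, divide \<open>S\<close> by a largest subobject \<open>N\<close> in \<open>u \<inter> f\<close>. The
  quotient \<open>Q\<close> is a nonzero object of \<open>u\<close>, but receives no nonzero map from the generators of \<open>u\<close>: a map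
  from \<open>s \<in> F\<close> lifts to \<open>S\<close> and is zero by Schur's lemma, and a map from \<open>B\<close> would enlarge \<open>N\<close>.
\<close>

lemma torsion_simple_is_quotient:
  assumes F: "\<And>s. s \<in> F \<Longrightarrow> torsion_simple C t s" and gen: "u = gen_torsion C (insert B F)"
    and S: "torsion_simple C t S" and ni: "\<And>s. s \<in> F \<Longrightarrow> Isos C s S = {}"
  shows "\<exists>Z e. Z \<in> u \<and> Z \<in> f \<and> e \<in> Epis C Z S"
proof (rule ccontr)
  assume no: "\<not> ?thesis"
  have St: "S \<in> t" "\<not> zero_obj C S" using S by (auto simp: torsion_simple_def)
  have SO: "S \<in> Obj C" using St torsion_closedD(1)[OF t] by blast
  \<comment> \<open>\<open>N\<close> is a largest subobject of \<open>S\<close> in \<open>u \<inter> f\<close>, and \<open>Q = S / N\<close>.\<close>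
  define P where "P N = (N \<in> u \<and> N \<in> f \<and> (\<exists>n. n \<in> Monos C N S))" for N
  obtain O' where O': "zero_obj C O'" using ex_zero_obj by blast
  have O'O: "O' \<in> Obj C" using O' zero_obj_iff by blast
  have "Zer C O' S \<in> Monos C O' S" by (rule zero_mono[OF O' SO])
  moreover have "O' \<in> u" using torsion_closedD(2)[OF u_closed O'] .
  moreover have "O' \<in> f" using orth_zero(2)[OF O'] O'O by (simp add: f_def right_perp_def)
  ultimately have "P O'" using P_def by blast
  moreover have "\<forall>N. P N \<longrightarrow> len N < Suc (len S)" using len_mono by (auto simp: P_def less_Suc_eq_le)
  ultimately obtain N where N: "P N" and mx: "\<And>N'. P N' \<Longrightarrow> len N' \<le> len N"
    using ex_has_greatest_nat[of P O' len "Suc (len S)"] by auto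
  have Nuf: "N \<in> u" "N \<in> f" using N P_def by auto
  obtain n where n: "n \<in> Monos C N S" using N P_def by blast
  obtain Q q where q: "ses C n q N S Q" using ses_of_mono n by blast
  note D = sesD[OF q]
  have "Q \<in> t" using torsion_closedD(3)[OF t D(2) St(1)] .
  then have Qu: "Q \<in> gen_torsion C (insert B F)" using t_u gen by blast
  have Qn: "\<not> zero_obj C Q" using ses_zero_right[OF q] iso_epi no Nuf by blast
  have FO: "insert B F \<subseteq> Obj C" using F torsion_closedD(1)[OF t] B_f unfolding torsion_simple_def by blast
  obtain s g where s: "s \<in> insert B F" "g \<in> Hom C s Q" "g \<noteq> Zer C s Q"
    using gen_torsion_nonzero_map[OF FO Qu Qn] by blast
  consider "s \<in> F" | "s = B" using s by blast
  then show False
  proof cases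
    case 1
    obtain x where x: "x \<in> Hom C s S" "q \<cdot> x = g" using lift_map[OF F[OF 1] Nuf q s(2)] by blast
    have sO: "s \<in> Obj C" using x Hom_Obj by blast
    have "x \<noteq> Zer C s S" using x s(3) Cmp_Zer[OF D(5) sO] by auto
    then have "x \<in> Isos C s S" using torsion_simple_schur[OF t F[OF 1] S x(1)] by blast
    then show False using ni 1 by blast
  next
    case 2
    then have g: "g \<in> Hom C B Q" "g \<noteq> Zer C B Q" using s by auto
    \<comment> \<open>The preimage in \<open>S\<close> of the image of \<open>g\<close> is the image \<open>I\<close> of the pullback \<open>E\<close>. It again lies in
      \<open>u \<inter> f\<close>, so it equals \<open>N\<close> by maximality and \<open>g\<close> vanishes.\<close>
    obtain E i p a where E: "ses C i p N E B" "a \<in> Hom C E S" "q \<cdot> a = g \<cdot> p" "a \<cdot> i = n"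
      using pullback_ses[OF q g(1)] by metis
    note ED = sesD[OF E(1)]
    have Euf: "E \<in> u" "E \<in> f"
      using torsion_closedD(4)[OF u_closed E(1) Nuf(1) t_u(2)] f_ext[OF E(1) Nuf(2) B_f(1)] by auto
    obtain K k I e m where ke: "ses C k e K E I" and m: "m \<in> Monos C I S" "m \<cdot> e = a"
      using factorization[OF E(2)] by metis
    note eD = sesD[OF ke] and mH = MonoD[OF m(1)]
    have Iu: "I \<in> u" using torsion_closedD(3)[OF u_closed eD(2) Euf(1)] .
    obtain T j r F' where tr: "ses C j r T I F'" "T \<in> t" "F' \<in> f" using torsion_seq[OF eD(8)] by blast
    note rD = sesD[OF tr(1)]
    have "m \<cdot> j = Zer C T S"
    proof (rule ccontr)
      assume "m \<cdot> j \<noteq> Zer C T S"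
      then have "m \<cdot> j \<in> Epis C T S" using S tr(2) Cmp_Hom[OF rD(4) mH] by (simp add: torsion_simple_def)
      then have "m \<in> Epis C I S" using epi_left[OF rD(4) mH] by blast
      then have "a \<in> Epis C E S" using epi_Cmp[OF eD(2)] m by blast
      then show False using no Euf by blast
    qed
    then have "j = Zer C T I" by (rule mono_cancel0[OF m(1) rD(4)])
    then have "zero_obj C T" using mono_to_zero rD(1) by blast
    then have If: "I \<in> f" using f_sub[OF iso_mono[OF ses_zero_left[OF tr(1)]] tr(3)] by blast
    have ei: "e \<cdot> i \<in> Hom C N I" using Cmp_Hom[OF ED(4) eD(5)] .
    have mei: "m \<cdot> (e \<cdot> i) = n" using Cmp_assoc[OF ED(4) eD(5) mH] m E(4) by simp
    have "e \<cdot> i \<in> Monos C N I" by (rule mono_right[OF ei mH]) (use mei n in simp)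
    moreover have "P I" using Iu If m P_def by blast
    ultimately have eii: "e \<cdot> i \<in> Isos C N I" using len_mono len_mono_iso mx by (metis le_antisym)
    have qm: "q \<cdot> m = Zer C I Q"
      by (rule epi_cancel0[OF iso_epi[OF eii] Cmp_Hom[OF mH D(5)]])
        (use Cmp_assoc[OF ei mH D(5)] mei D(3) in simp)
    have "g \<cdot> p = Zer C E Q" using E(3) m(2) Cmp_assoc[OF eD(5) mH D(5)] qm Zer_Cmp[OF eD(5) D(8)] by simp
    then show False using epi_cancel0[OF ED(2) g(1)] g(2) by blast
  qed
qed

text \<open>
  Take \<open>Z\<close> of minimal length. A nonzero map from \<open>B\<close> to the kernel \<open>K\<close> would allow to replace \<open>Z\<close> by \<open>Z / B\<close>,
  and maps from \<open>t\<close> to \<open>K\<close> vanish as \<open>K\<close> is in \<open>f\<close>. So \<open>K\<close> receives no map from the generators of \<open>u\<close>.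
\<close>

lemma minimal_presentation:
  assumes S: "torsion_simple C t S" and ex: "\<exists>Z e. Z \<in> u \<and> Z \<in> f \<and> e \<in> Epis C Z S"
  shows "\<exists>K k Z e. ses C k e K Z S \<and> Z \<in> u \<and> Z \<in> f \<and> K \<in> right_perp C u \<and> \<not> zero_obj C K"
proof -
  have St: "S \<in> t" "\<not> zero_obj C S" using S by (auto simp: torsion_simple_def)
  define P where "P Z = (Z \<in> u \<and> Z \<in> f \<and> (\<exists>e. e \<in> Epis C Z S))" for Z
  obtain Z where Z: "P Z" and min: "\<And>Z'. P Z' \<Longrightarrow> len Z \<le> len Z'"
    using exists_least_iff[of "\<lambda>n. \<exists>X. P X \<and> len X = n"] ex P_def by (metis not_less)
  have Zuf: "Z \<in> u" "Z \<in> f" using Z P_def by auto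
  obtain e where e: "e \<in> Epis C Z S" using Z P_def by blast
  obtain K k where k: "ses C k e K Z S" using ses_of_epi e by blast
  note D = sesD[OF k]
  have Kf: "K \<in> f" using f_sub D(1) Zuf by blast
  have BK: "b = Zer C B K" if b: "b \<in> Hom C B K" for b
  proof (rule ccontr)
    assume bn: "b \<noteq> Zer C B K"
    have kb: "k \<cdot> b \<in> Hom C B Z" using Cmp_Hom[OF b D(4)] .
    have kbn: "k \<cdot> b \<noteq> Zer C B Z" using mono_cancel0[OF D(1) b] bn by blast
    note bm = B_map[OF Zuf(2) kb kbn]
    obtain d Z' where d: "ses C (k \<cdot> b) d B Z Z'" using ses_of_mono bm(1) by blast
    note dD = sesD[OF d]
    have "e \<cdot> (k \<cdot> b) = Zer C B S" using Cmp_assoc[OF b D(4,5)] D(3) Zer_Cmp[OF b D(8)] by simp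
    then obtain e' where e': "e' \<in> Hom C Z' S" "e' \<cdot> d = e" using ses_desc[OF d D(5)] by blast
    have "e' \<in> Epis C Z' S" by (rule epi_left[OF dD(5) e'(1)]) (use e' e in simp)
    then have "P Z'" using bm(2)[OF d] torsion_closedD(3)[OF u_closed dD(2) Zuf(1)] P_def by blast
    then show False using min len_quot_less[OF d B_f(2)] by fastforce
  qed
  have "orth C X K" if "X \<in> u" for X
  proof -
    have "insert B t \<subseteq> left_perp C {K}" using BK t_f[OF _ Kf] Bt_Obj by (auto simp: left_perp_def orth_def)
    then have "u \<subseteq> left_perp C {K}" unfolding u_def by (rule gen_torsion_least[OF left_perp_closed])
    then show ?thesis using that by (auto simp: left_perp_def)
  qed
  then have "K \<in> right_perp C u" using D(6) by (simp add: right_perp_def)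
  moreover have "\<not> zero_obj C K"
  proof
    assume "zero_obj C K"
    then obtain v where "v \<in> Isos C S Z" using ses_zero_left[OF k] iso_inv by metis
    then have "S \<in> f" using f_sub iso_mono Zuf by blast
    then show False using t_f_zero St by blast
  qed
  ultimately show ?thesis using k Zuf by blast
qed

text \<open>
  A map \<open>\<phi>\<close> between the kernels extends to a map of presentations, which induces a map \<open>S \<rightarrow> S'\<close>. This is
  zero by Schur's lemma, so \<open>Z \<rightarrow> Z'\<close> factors through \<open>K'\<close>, and hence vanishes because \<open>Z\<close> is in \<open>u\<close>.
\<close>

lemma presentation_kernels_orth:
  assumes S: "torsion_simple C t S" "torsion_simple C t S'" and ni: "Isos C S S' = {}"
    and k: "ses C k e K Z S" "Z \<in> u" and k': "ses C k' e' K' Z' S'" "Z' \<in> u" "Z' \<in> f" "K' \<in> right_perp C u"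
  shows "orth C K K'"
  unfolding orth_def
proof
  fix \<phi> assume \<phi>: "\<phi> \<in> Hom C K K'"
  note D = sesD[OF k(1)] and D' = sesD[OF k'(1)]
  have k'\<phi>: "k' \<cdot> \<phi> \<in> Hom C K Z'" using Cmp_Hom[OF \<phi> D'(4)] .
  obtain \<psi> where \<psi>: "\<psi> \<in> Hom C Z Z'" "\<psi> \<cdot> k = k' \<cdot> \<phi>" using extend_map[OF S(1) k'(2,3) k(1) k'\<phi>] by blast
  have e\<psi>: "e' \<cdot> \<psi> \<in> Hom C Z S'" using Cmp_Hom[OF \<psi>(1) D'(5)] .
  have "e' \<cdot> \<psi> \<cdot> k = Zer C K S'"
    using Cmp_assoc[OF D(4) \<psi>(1) D'(5)] \<psi>(2) Cmp_assoc[OF \<phi> D'(4,5)] D'(3) Zer_Cmp[OF \<phi> D'(8)] by simp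
  then obtain \<sigma> where \<sigma>: "\<sigma> \<in> Hom C S S'" "\<sigma> \<cdot> e = e' \<cdot> \<psi>" using ses_desc[OF k(1) e\<psi>] by blast
  have "\<sigma> = Zer C S S'" using torsion_simple_schur[OF t S \<sigma>(1)] ni by blast
  then have "e' \<cdot> \<psi> = Zer C Z S'" using \<sigma> Zer_Cmp[OF D(5) D'(8)] by simp
  then obtain \<chi> where \<chi>: "\<chi> \<in> Hom C Z K'" "k' \<cdot> \<chi> = \<psi>" using ses_lift[OF k'(1) \<psi>(1)] by blast
  have "\<chi> = Zer C Z K'" using k'(4) k(2) \<chi>(1) by (auto simp: right_perp_def orth_def)
  then have "\<psi> = Zer C Z Z'" using \<chi> Cmp_Zer[OF D'(4) D(7)] by simp
  then have "k' \<cdot> \<phi> = Zer C K Z'" using \<psi> Zer_Cmp[OF D(4) D'(7)] by simp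
  then show "\<phi> = Zer C K K'" by (rule mono_cancel0[OF D'(1) \<phi>])
qed

end

context abelian_with_length
begin

text \<open>
  Finite generation of \<open>u\<close> leaves a finite set \<open>F\<close> of torsion simple objects aside; all others have a
  minimal presentation, with kernels that are orthogonal to \<open>u\<close> and to each other. Finite generation of
  the torsion class generated by \<open>u\<close> and these kernels bounds their number.
\<close>

lemma fin_gen_below_upper_cover:
  assumes t: "torsion_closed C t" and gen: "gen_torsion C {S. torsion_simple C t S} = t"
    and B: "torsion_simple (opp C) (right_perp C t) B"
    and above: "\<And>t'. torsion_closed C t' \<Longrightarrow> t \<subset> t' \<Longrightarrow> fin_gen C t'"
  shows "fin_gen C t"
proof -
  interpret upper_cover C len t B by (unfold_locales; fact)
  let ?S = "{S. torsion_simple C t S}"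
  have St: "?S \<subseteq> t" by (auto simp: torsion_simple_def)
  have SO: "?S \<subseteq> Obj C" using St torsion_closedD(1)[OF t] by blast
  have uO: "u \<subseteq> Obj C" using torsion_closedD(1)[OF u_closed] .
  have tu: "t \<subset> u" using t_u t_neq_u by blast
  have BO: "{B} \<subseteq> Obj C" using B_f by blast
  have u_gen: "u = gen_torsion C (?S \<union> {B})"
  proof
    have SBO: "?S \<union> {B} \<subseteq> Obj C" using SO BO by blast
    show "gen_torsion C (?S \<union> {B}) \<subseteq> u"
      by (rule gen_torsion_least[OF u_closed]) (use St t_u in blast)
    have "t \<subseteq> gen_torsion C (?S \<union> {B})" using gen_torsion_mono[OF _ SBO, of ?S] gen by blast
    then have "insert B t \<subseteq> gen_torsion C (?S \<union> {B})" using gen_torsion_subset[of "?S \<union> {B}"] by blast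
    then show "u \<subseteq> gen_torsion C (?S \<union> {B})"
      unfolding u_def by (rule gen_torsion_least[OF gen_torsion_closed[OF SBO]])
  qed
  then have "fin_gen C (gen_torsion C (?S \<union> {B}))" using above[OF u_closed tu] by simp
  then obtain F where F: "finite F" "F \<subseteq> ?S" "gen_torsion C (?S \<union> {B}) = gen_torsion C (F \<union> {B})"
    by (rule fin_gen_refine[OF SO BO])
  have uF: "u = gen_torsion C (insert B F)" using u_gen F(3) by simp
  \<comment> \<open>The torsion simple objects outside \<open>F\<close>, each with a minimal presentation by \<open>u \<inter> f\<close>.\<close>
  define J where "J = {S. torsion_simple C t S \<and> (\<forall>s\<in>F. Isos C s S = {})}"
  have "\<forall>S\<in>J. \<exists>K k Z e. ses C k e K Z S \<and> Z \<in> u \<and> Z \<in> f \<and> K \<in> right_perp C u \<and> \<not> zero_obj C K"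
    using minimal_presentation torsion_simple_is_quotient[OF _ uF] F(2) unfolding J_def by blast
  then obtain \<kappa> k Z e where pres: "\<And>S. S \<in> J \<Longrightarrow> ses C (k S) (e S) (\<kappa> S) (Z S) S \<and> Z S \<in> u \<and> Z S \<in> f
      \<and> \<kappa> S \<in> right_perp C u \<and> \<not> zero_obj C (\<kappa> S)"
    by metis
  have \<kappa>O: "\<kappa> ` J \<subseteq> Obj C" using pres by (auto simp: right_perp_def)
  have "torsion_closed C (gen_torsion C (\<kappa> ` J \<union> u))" using gen_torsion_closed \<kappa>O uO by simp
  moreover have "t \<subset> gen_torsion C (\<kappa> ` J \<union> u)" using tu gen_torsion_subset[of "\<kappa> ` J \<union> u"] by blast
  ultimately have "fin_gen C (gen_torsion C (\<kappa> ` J \<union> u))" by (rule above)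
  then obtain G where G: "finite G" "G \<subseteq> \<kappa> ` J" "gen_torsion C (\<kappa> ` J \<union> u) = gen_torsion C (G \<union> u)"
    using fin_gen_refine[OF \<kappa>O uO] by blast
  obtain F' where F': "finite F'" "F' \<subseteq> J" "G = \<kappa> ` F'" using finite_subset_image[OF G(1,2)] by blast
  have JF': "\<exists>s\<in>F'. Isos C s S \<noteq> {}" if S: "S \<in> J" for S
  proof (rule ccontr)
    assume no: "\<not> ?thesis"
    have \<kappa>S: "\<kappa> S \<in> gen_torsion C (G \<union> u)" using S gen_torsion_subset[of "\<kappa> ` J \<union> u"] G(3) by blast
    have GO: "G \<union> u \<subseteq> Obj C" using G \<kappa>O uO by blast
    obtain x g where x: "x \<in> G \<union> u" "g \<in> Hom C x (\<kappa> S)" "g \<noteq> Zer C x (\<kappa> S)"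
      using gen_torsion_nonzero_map[OF GO \<kappa>S] pres[OF S] by blast
    have "x \<notin> u" using x pres[OF S] by (auto simp: right_perp_def orth_def)
    then obtain s where s: "s \<in> F'" "x = \<kappa> s" using x F' by blast
    have sJ: "s \<in> J" using s F' by blast
    have "orth C (\<kappa> s) (\<kappa> S)"
      using presentation_kernels_orth[of s S "k s" "e s" "\<kappa> s" "Z s" "k S" "e S" "\<kappa> S" "Z S"]
        pres[OF S] pres[OF sJ] S sJ no s(1) unfolding J_def by blast
    then show False using x s by (simp add: orth_def)
  qed
  have FF': "F \<union> F' \<subseteq> ?S" using F F' unfolding J_def by blast
  have FO: "F \<union> F' \<subseteq> Obj C" using FF' SO by blast
  note c = gen_torsion_closed[OF FO]
  have "S \<in> gen_torsion C (F \<union> F')" if S: "torsion_simple C t S" for S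
  proof -
    obtain s v where "s \<in> F \<union> F'" "v \<in> Isos C s S" using JF'[of S] S unfolding J_def by blast
    then show ?thesis using torsion_closedD(3)[OF c iso_epi] gen_torsion_subset[of "F \<union> F'"] by blast
  qed
  then have "t \<subseteq> gen_torsion C (F \<union> F')" using gen_torsion_least[OF c, of ?S] gen by blast
  moreover have "gen_torsion C (F \<union> F') \<subseteq> t" using gen_torsion_least[OF t] FF' St by blast
  ultimately show ?thesis unfolding fin_gen_def using F(1) F'(1) FO by blast
qed

text \<open>
  The union of a chain of torsion classes that are not finitely generated is of the same kind, since
  finitely many generators of it lie in a member of the chain. Zorn's lemma thus provides a maximal torsion
  class to which \<open>fin_gen_below_upper_cover\<close> applies.
\<close>

lemma all_fin_gen:
  assumes top: "fin_gen C (Obj C)"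
    and gen: "\<And>t. torsion_closed C t \<Longrightarrow> gen_torsion C {S. torsion_simple C t S} = t"
    and cov: "\<And>t. torsion_closed C t \<Longrightarrow> t \<noteq> Obj C \<Longrightarrow> \<exists>B. torsion_simple (opp C) (right_perp C t) B"
    and t: "torsion_closed C t"
  shows "fin_gen C t"
proof (rule ccontr)
  let ?N = "{t. torsion_closed C t \<and> \<not> fin_gen C t}"
  assume "\<not> fin_gen C t"
  then have ne: "?N \<noteq> {}" using t by blast
  have "\<Union>\<C> \<in> ?N" if ch: "\<C> \<noteq> {}" "subset.chain ?N \<C>" for \<C>
  proof -
    have "subset.chain {t. torsion_closed C t} \<C>" using ch(2) unfolding subset.chain_def by blast
    note c = chain_Union[OF ch(1) this]
    have "\<C> \<subseteq> ?N" using ch(2) unfolding subset.chain_def by blast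
    then show ?thesis using c by blast
  qed
  from subset_Zorn_nonempty[OF ne this]
  obtain m where m: "m \<in> ?N" and mx: "\<And>X. X \<in> ?N \<Longrightarrow> m \<subseteq> X \<Longrightarrow> X = m" by blast
  have mc: "torsion_closed C m" using m by blast
  obtain B where "torsion_simple (opp C) (right_perp C m) B" using cov[OF mc] top m by blast
  then have "fin_gen C m" using fin_gen_below_upper_cover[OF mc gen[OF mc]] mx by blast
  then show False using m by blast
qed

end

section \<open>Finiteness of the set of bricks\<close>

lemma (in preadditive_category) opp_wide [simp]: "wide (opp C) W \<longleftrightarrow> wide C W"
proof -
  have "(\<forall>i p. short_exact C p i \<and> Cod C i \<in> W \<and> Dom C p \<in> W \<longrightarrow> Dom C i \<in> W) \<longleftrightarrow>
    (\<forall>i p. short_exact C i p \<and> Dom C i \<in> W \<and> Cod C p \<in> W \<longrightarrow> Cod C i \<in> W)"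
    by (auto simp: short_exact_def is_kernel_def)
  then show ?thesis unfolding wide_def by (simp; blast)
qed

context abelian_with_length
begin

text \<open>
  Stated for an arbitrary class closed under extensions, since it is applied to a torsion class and to a
  torsionfree class.
\<close>

lemma objects_filtered_by_simples:
  assumes t: "\<And>Z. zero_obj C Z \<Longrightarrow> Z \<in> t" "\<And>S. simple_obj C S \<Longrightarrow> S \<in> t"
    "\<And>i p X Y Z. ses C i p X Y Z \<Longrightarrow> X \<in> t \<Longrightarrow> Z \<in> t \<Longrightarrow> Y \<in> t"
  shows "Obj C \<subseteq> t"
proof
  fix X assume "X \<in> Obj C"
  then show "X \<in> t"
  proof (induction "len X" arbitrary: X rule: less_induct)
    case less
    show ?case
    proof (cases "zero_obj C X")
      case True
      then show ?thesis by (rule t)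
    next
      case False
      define P where "P S = (\<not> zero_obj C S \<and> (\<exists>j. j \<in> Monos C S X))" for S
      have "P X" using False iso_mono[OF Idt_iso[OF less(2)]] P_def by blast
      then obtain S where S: "P S" and min: "\<And>S'. P S' \<Longrightarrow> len S \<le> len S'"
        using exists_least_iff[of "\<lambda>n. \<exists>X. P X \<and> len X = n"] by (metis not_less)
      obtain j where j: "j \<in> Monos C S X" using S P_def by blast
      have "zero_obj C (Dom C i) \<or> is_iso C i" if i: "is_mono C i" "Cod C i = S" for i
      proof -
        have "i \<in> Monos C (Dom C i) S" using i by (auto simp: Monos_def Hom_def is_mono_def)
        then show ?thesis using min[of "Dom C i"] mono_Cmp[OF _ j] len_mono len_mono_iso unfolding P_def
          by (metis (mono_tags, lifting) Isos_def le_antisym mem_Collect_eq)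
      qed
      moreover have "S \<in> Obj C" using j MonoD Hom_Obj by blast
      ultimately have "simple_obj C S" using S unfolding simple_obj_def P_def by blast
      then have "S \<in> t" by (rule t)
      moreover obtain p X' where p: "ses C j p S X X'" using ses_of_mono j by blast
      moreover have "X' \<in> t"
        using less.hyps[OF len_quot_less[OF p]] S sesD(8)[OF p] P_def by blast
      ultimately show ?thesis using t(3) by blast
    qed
  qed
qed

text \<open>
  Representatives of the simple objects generate the whole category as a torsion class and as a
  torsionfree class.
\<close>

lemma fin_gen_Obj:
  assumes "finitely_many_simples C" shows "fin_gen C (Obj C)" "fin_gen (opp C) (Obj C)"
proof -
  interpret op: abelian_with_length "opp C" len by (rule with_length_opp)
  let ?R = "(\<lambda>c. SOME x. x \<in> c) ` ({S. simple_obj C S} // iso_rel C)"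
  have fin: "finite ?R" using assms unfolding finitely_many_simples_def by (rule finite_imageI)
  have some: "(SOME x. x \<in> iso_rel C `` {S}) \<in> iso_rel C `` {S}" if "simple_obj C S" for S
    by (rule someI[of _ S]) (use equiv_class_self[OF equiv_iso_rel] that in \<open>auto simp: simple_obj_def\<close>)
  have rep: "\<exists>r\<in>?R. (S, r) \<in> iso_rel C" if S: "simple_obj C S" for S
  proof -
    have "iso_rel C `` {S} \<in> {S. simple_obj C S} // iso_rel C" using S by (blast intro: quotientI)
    then show ?thesis using some[OF S] by blast
  qed
  have RO: "?R \<subseteq> Obj C"
  proof
    fix r assume "r \<in> ?R"
    then obtain S where "simple_obj C S" "r = (SOME x. x \<in> iso_rel C `` {S})" by (auto elim!: quotientE)
    then have "(S, r) \<in> iso_rel C" using some[of S] by simp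
    then show "r \<in> Obj C" by (auto simp: iso_rel_def)
  qed
  have c: "torsion_closed C (gen_torsion C ?R)" by (rule gen_torsion_closed[OF RO])
  note cD = torsion_closedD[OF c]
  have "S \<in> gen_torsion C ?R" if S: "simple_obj C S" for S
  proof -
    obtain r where r: "r \<in> ?R" "(S, r) \<in> iso_rel C" using rep[OF S] by blast
    have "(r, S) \<in> iso_rel C" using r equiv_iso_rel by (meson equiv_def symD)
    then obtain v where "v \<in> Isos C r S" using iso_rel_iff by blast
    then show ?thesis using cD(3)[OF iso_epi] r gen_torsion_subset[of ?R] by blast
  qed
  then have "Obj C \<subseteq> gen_torsion C ?R"
    using objects_filtered_by_simples[of "gen_torsion C ?R"] cD(2,4) by blast
  then have "Obj C = gen_torsion C ?R" using cD(1) by blast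
  then show "fin_gen C (Obj C)" unfolding fin_gen_def using fin RO by blast
  have c': "torsion_closed (opp C) (gen_torsion (opp C) ?R)" by (rule op.gen_torsion_closed) (use RO in simp)
  note c'D = torsion_closedD[OF c']
  have "S \<in> gen_torsion (opp C) ?R" if S: "simple_obj C S" for S
  proof -
    obtain r where r: "r \<in> ?R" "(S, r) \<in> iso_rel C" using rep[OF S] by blast
    then obtain v where "v \<in> Isos C S r" using iso_rel_iff by blast
    then have "v \<in> Epis (opp C) r S" using iso_mono by simp
    then show ?thesis using c'D(3) r op.gen_torsion_subset[of ?R] by blast
  qed
  moreover have "Z \<in> gen_torsion (opp C) ?R" if "zero_obj C Z" for Z using c'D(2)[of Z] that by simp
  moreover have "Y \<in> gen_torsion (opp C) ?R"
    if "ses C i p X Y Z" "X \<in> gen_torsion (opp C) ?R" "Z \<in> gen_torsion (opp C) ?R" for i p X Y Z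
    using c'D(4)[of p i Z Y X] that by simp
  ultimately have "Obj C \<subseteq> gen_torsion (opp C) ?R"
    using objects_filtered_by_simples[of "gen_torsion (opp C) ?R"] by blast
  then have "Obj C = gen_torsion (opp C) ?R" using c'D(1) by simp
  then show "fin_gen (opp C) (Obj C)" unfolding fin_gen_def using fin RO opp_simps(1) by metis
qed

text \<open>
  If there were none, the torsionfree class would be generated by the empty set, hence be zero.
\<close>

lemma ex_cosimple:
  assumes t: "torsion_closed C t" and ne: "t \<noteq> Obj C"
    and gen: "gen_torsion (opp C) {S. torsion_simple (opp C) (right_perp C t) S} = right_perp C t"
  shows "\<exists>B. torsion_simple (opp C) (right_perp C t) B"
proof (rule ccontr)
  assume "\<not> ?thesis"
  then have r: "right_perp C t = gen_torsion (opp C) {}" using gen by simp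
  have z: "zero_obj C Y" if "Y \<in> right_perp C t" for Y
    using abelian_with_length.gen_torsion_nonzero_map[OF with_length_opp, of "{}" Y] that r by auto
  have "X \<in> left_perp C (right_perp C t)" if "X \<in> Obj C" for X
    using that orth_zero(2)[OF z] by (auto simp: left_perp_def)
  then show False using torsion_pair_perp[OF torsion_closed_pair[OF t]] torsion_closedD(1)[OF t] ne by blast
qed

text \<open>
  There is a nonzero map \<open>Y \<rightarrow> X\<close>, and a nonzero map from \<open>X\<close> to its image \<open>I\<close>. The composite \<open>X \<rightarrow> I \<rightarrow> X\<close> is
  nonzero, hence invertible, so \<open>Y \<rightarrow> X\<close> is epi. By symmetry there is an epi \<open>X \<rightarrow> Y\<close> too, and \<open>X\<close> and \<open>Y\<close>
  have the same length.
\<close>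

lemma brick_generators_iso:
  assumes C: "brick C X" "brick C Y" and gen: "gen_torsion C {X} = gen_torsion C {Y}"
  shows "(X, Y) \<in> iso_rel C"
proof -
  have epi: "\<exists>g. g \<in> Epis C Y X" if b: "brick C X" "brick C Y" "gen_torsion C {X} = gen_torsion C {Y}" for X Y
  proof -
    have X: "X \<in> Obj C" "\<not> zero_obj C X" and Xiso: "\<And>g. g \<in> Hom C X X \<Longrightarrow> g \<noteq> Zer C X X \<Longrightarrow> g \<in> Isos C X X"
      and Y: "Y \<in> Obj C"
      using b by (auto simp: brick_iff)
    have XO: "{X} \<subseteq> Obj C" and YO: "{Y} \<subseteq> Obj C" using X Y by auto
    have "X \<in> gen_torsion C {Y}" using b(3) gen_torsion_subset[of "{X}"] by auto
    then obtain g where g: "g \<in> Hom C Y X" "g \<noteq> Zer C Y X"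
      using gen_torsion_nonzero_map[OF YO] X by blast
    obtain K k I e m where s: "ses C k e K Y I" and m: "m \<in> Monos C I X" "m \<cdot> e = g"
      using factorization[OF g(1)] by metis
    note D = sesD[OF s] and mH = MonoD[OF m(1)]
    have nz: "\<not> zero_obj C I" using zero_objD(1)[OF _ mH] m(2) g Zer_Cmp[OF D(5) X(1)] by auto
    have "Y \<in> gen_torsion C {X}" using b(3) gen_torsion_subset[of "{Y}"] by auto
    then have "I \<in> gen_torsion C {X}" using torsion_closedD(3)[OF gen_torsion_closed[OF XO] D(2)] by blast
    then obtain h where h: "h \<in> Hom C X I" "h \<noteq> Zer C X I" using gen_torsion_nonzero_map[OF XO _ nz] by blast
    have mh: "m \<cdot> h \<in> Hom C X X" using Cmp_Hom[OF h(1) mH] .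
    have "m \<cdot> h \<noteq> Zer C X X" using mono_cancel0[OF m(1) h(1)] h(2) by blast
    then have "m \<cdot> h \<in> Epis C X X" using Xiso mh iso_epi by blast
    then have "m \<in> Epis C I X" by (rule epi_left[OF h(1) mH])
    then show ?thesis using epi_Cmp[OF D(2)] m by blast
  qed
  obtain g where g: "g \<in> Epis C Y X" using epi[OF C gen] by blast
  obtain h where h: "h \<in> Epis C X Y" using epi[OF C(2,1) gen[symmetric]] by blast
  have "len X = len Y" using len_epi[OF g] len_epi[OF h] by simp
  then show ?thesis using len_epi_iso[OF h] iso_rel_iff by blast
qed

lemma left_perp_right_perp: "torsion_closed C t \<Longrightarrow> left_perp C (right_perp C t) = t"
  using torsion_pair_perp[OF torsion_closed_pair] by simp

lemma right_perp_left_perp: "torsion_closed (opp C) f \<Longrightarrow> right_perp C (left_perp C f) = f"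
  using abelian_with_length.left_perp_right_perp[OF with_length_opp, of f] by simp

text \<open>
  The union of a chain is finitely generated, and a member of the chain contains the generators; so the
  union is a member, and Zorn's lemma applies to any property of torsion classes.
\<close>

lemma maximal_torsion_class:
  assumes fg: "\<And>t. torsion_closed C t \<Longrightarrow> fin_gen C t" and t: "torsion_closed C t" "P t"
  obtains m where "torsion_closed C m" "P m" "\<And>t. torsion_closed C t \<Longrightarrow> P t \<Longrightarrow> m \<subseteq> t \<Longrightarrow> t = m"
proof -
  let ?N = "{t. torsion_closed C t \<and> P t}"
  have ne: "?N \<noteq> {}" using t by blast
  have "\<Union>\<C> \<in> ?N" if ch: "\<C> \<noteq> {}" "subset.chain ?N \<C>" for \<C>
  proof -
    have "subset.chain {t. torsion_closed C t} \<C>" using ch(2) unfolding subset.chain_def by blast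
    note c = chain_Union[OF ch(1) this]
    have "\<C> \<subseteq> ?N" using ch(2) unfolding subset.chain_def by blast
    then show ?thesis using c(2)[OF fg[OF c(1)]] by blast
  qed
  from subset_Zorn_nonempty[OF ne this] show ?thesis using that by blast
qed

text \<open>
  The torsionfree class \<open>f\<close> is chosen maximal such that \<open>t = left_perp C f\<close> contains infinitely many bricks;
  so smaller torsion classes contain finitely many. A brick of \<open>t\<close> with a nonzero map to each of the
  finitely many torsion simple generators \<open>S\<close> has all of them as quotients and generates \<open>t\<close>.
\<close>

lemma brick_finite_if_fin_gen:
  assumes fg: "\<And>t. torsion_closed C t \<Longrightarrow> fin_gen C t"
    and fg': "\<And>f. torsion_closed (opp C) f \<Longrightarrow> fin_gen (opp C) f"
    and gen: "\<And>t. torsion_closed C t \<Longrightarrow> gen_torsion C {S. torsion_simple C t S} = t"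
  shows "brick_finite C"
proof (rule ccontr)
  interpret op: abelian_with_length "opp C" len by (rule with_length_opp)
  assume inf: "\<not> brick_finite C"
  have op_closed: "torsion_closed (opp C) (right_perp C t)" for t
    using abelian_category.left_perp_closed[OF op, of t] by simp
  have "{B. brick C B} = {B. brick C B \<and> B \<in> Obj C}" by (auto simp: brick_iff)
  then have "infinite (brick_classes (Obj C))" using inf by (simp add: brick_classes_def brick_finite_def)
  then have "infinite (brick_classes (left_perp C (right_perp C (Obj C))))"
    using left_perp_right_perp[OF Obj_closed] by simp
  then obtain f where f: "torsion_closed (opp C) f" "infinite (brick_classes (left_perp C f))"
    and mx: "\<And>g. torsion_closed (opp C) g \<Longrightarrow> infinite (brick_classes (left_perp C g)) \<Longrightarrow> f \<subseteq> g \<Longrightarrow> g = f"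
    using op.maximal_torsion_class[OF fg' op_closed, of "\<lambda>f. infinite (brick_classes (left_perp C f))" "Obj C"]
    by blast
  define t where "t = left_perp C f"
  have t: "torsion_closed C t" unfolding t_def by (rule left_perp_closed)
  have min: "finite (brick_classes t')" if t': "torsion_closed C t'" "t' \<subset> t" for t'
  proof (rule ccontr)
    assume i: "infinite (brick_classes t')"
    have "f \<subseteq> right_perp C t'" using right_perp_left_perp[OF f(1)] t' by (auto simp: t_def right_perp_def)
    then have "right_perp C t' = f" using mx[OF op_closed] i left_perp_right_perp[OF t'(1)] by simp
    then show False using left_perp_right_perp[OF t'(1)] t' t_def by simp
  qed
  let ?S = "{S. torsion_simple C t S}"
  have SO: "?S \<subseteq> Obj C" using torsion_closedD(1)[OF t] by (auto simp: torsion_simple_def)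
  have "fin_gen C (gen_torsion C (?S \<union> {}))" using fg[OF t] gen[OF t] by simp
  then obtain F where F: "finite F" "F \<subseteq> ?S" "gen_torsion C (?S \<union> {}) = gen_torsion C (F \<union> {})"
    by (rule fin_gen_refine[OF SO empty_subsetI])
  then have tF: "t = gen_torsion C F" using gen[OF t] by simp
  define tS where "tS S = t \<inter> left_perp C {S}" for S
  have tS: "finite (brick_classes (tS S))" if S: "S \<in> F" for S
  proof (rule min)
    have l: "torsion_closed C (left_perp C {S})" by (rule left_perp_closed)
    show "torsion_closed C (tS S)" unfolding tS_def torsion_closed_def
      using torsion_closedD[OF t] torsion_closedD[OF l] by blast
    have "S \<in> t" "\<not> zero_obj C S" "S \<in> Obj C" using S F(2) SO by (auto simp: torsion_simple_def)
    then show "tS S \<subset> t" using orth_self by (auto simp: tS_def left_perp_def)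
  qed
  \<comment> \<open>the class of the brick that generates \<open>t\<close>, if there is one\<close>
  define D where "D = {X. brick C X \<and> gen_torsion C {X} = t} // iso_rel C"
  have "finite D"
  proof (cases "\<exists>X. brick C X \<and> gen_torsion C {X} = t")
    case True
    then obtain X where X: "brick C X" "gen_torsion C {X} = t" by blast
    have "c = iso_rel C `` {X}" if c: "c \<in> D" for c
    proof -
      obtain Y where Y: "brick C Y" "gen_torsion C {Y} = t" "c = iso_rel C `` {Y}"
        using c unfolding D_def by (auto elim!: quotientE)
      have "(Y, X) \<in> iso_rel C" using brick_generators_iso[OF Y(1) X(1)] X Y by simp
      then show ?thesis using Y(3) equiv_class_eq[OF equiv_iso_rel] by blast
    qed
    then have "D \<subseteq> {iso_rel C `` {X}}" by blast
    then show ?thesis by (rule finite_subset) simp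
  next
    case False
    then have "D = {}" unfolding D_def quotient_def by blast
    then show ?thesis by simp
  qed
  moreover have "brick_classes t \<subseteq> D \<union> (\<Union>S\<in>F. brick_classes (tS S))"
  proof
    fix c assume "c \<in> brick_classes t"
    then obtain X where X: "brick C X" "X \<in> t" "c = iso_rel C `` {X}"
      unfolding brick_classes_def by (auto elim!: quotientE)
    have XO: "X \<in> Obj C" "{X} \<subseteq> Obj C" using X by (auto simp: brick_iff)
    show "c \<in> D \<union> (\<Union>S\<in>F. brick_classes (tS S))"
    proof (cases "\<exists>S\<in>F. X \<in> tS S")
      case True
      then obtain S where "S \<in> F" "X \<in> tS S" by blast
      then have "c \<in> brick_classes (tS S)" unfolding brick_classes_def X(3) using X(1) by (blast intro: quotientI)
      then show ?thesis using \<open>S \<in> F\<close> by blast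
    next
      case False
      note gc = gen_torsion_closed[OF XO(2)]
      have "S \<in> gen_torsion C {X}" if S: "S \<in> F" for S
      proof -
        have "\<not> orth C X S" using False S X(2) XO by (auto simp: tS_def left_perp_def)
        then obtain g where g: "g \<in> Hom C X S" "g \<noteq> Zer C X S" by (auto simp: orth_def)
        have "g \<in> Epis C X S" using F(2) S X(2) g unfolding torsion_simple_def by blast
        then show ?thesis using torsion_closedD(3)[OF gc] gen_torsion_subset[of "{X}"] by blast
      qed
      then have "t \<subseteq> gen_torsion C {X}" unfolding tF using gen_torsion_least[OF gc, of F] by blast
      moreover have "gen_torsion C {X} \<subseteq> t" using gen_torsion_least[OF t, of "{X}"] X(2) by simp
      ultimately have "gen_torsion C {X} = t" by blast
      then have "c \<in> D" unfolding D_def X(3) using X(1) by (blast intro: quotientI)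
      then show ?thesis by blast
    qed
  qed
  ultimately have "finite (brick_classes t)" using F(1) tS by (meson finite_UN finite_Un finite_subset)
  then show False using f(2) by (simp add: t_def)
qed

end

theorem theorem1p1:
  fixes A :: "('o, 'm) precat"
  assumes "abelian_length_category A"
    and "finitely_many_simples A"
  shows "brick_finite A \<longleftrightarrow>
    (\<forall>t f. torsion_pair A t f \<longrightarrow>
       (\<exists>W W'. wide A W \<and> wide A W' \<and> t = gen_torsion A W \<and> f = gen_torsionfree A W'))"
proof -
  define len where "len = (\<lambda>M. LEAST n. comp_series A n M)"
  interpret abelian_with_length A len
    unfolding len_def by (rule abelian_length_category_with_length[OF assms(1)])
  interpret op: abelian_with_length "opp A" len by (rule with_length_opp)
  show ?thesis
  proof (intro iffI allI impI)
    fix t f assume bf: "brick_finite A" and tf: "torsion_pair A t f"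
    have t: "torsion_closed A t" using tf torsion_class_iff unfolding torsion_class_def by blast
    have f: "torsion_closed (opp A) f"
      using tf op.torsion_class_iff opp_torsion_pair unfolding torsion_class_def by blast
    have "wide A (alpha A t)" "t = gen_torsion A (alpha A t)"
      using wide_alpha[OF t] torsion_class_gen_alpha[OF bf t] by auto
    moreover have "wide A (alpha (opp A) f)" "f = gen_torsionfree A (alpha (opp A) f)"
      using op.wide_alpha[OF f] op.torsion_class_gen_alpha[OF _ f] bf by auto
    ultimately show "\<exists>W W'. wide A W \<and> wide A W' \<and> t = gen_torsion A W \<and> f = gen_torsionfree A W'" by blast
  next
    assume wg: "\<forall>t f. torsion_pair A t f \<longrightarrow>
       (\<exists>W W'. wide A W \<and> wide A W' \<and> t = gen_torsion A W \<and> f = gen_torsionfree A W')"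
    have gen: "gen_torsion A {S. torsion_simple A t S} = t" if t: "torsion_closed A t" for t
    proof -
      obtain W where W: "wide A W" "t = gen_torsion A W" using wg torsion_closed_pair[OF t] by blast
      interpret wide_subcategory A len W by unfold_locales fact
      show ?thesis using gen_by_torsion_simples W by simp
    qed
    have gen': "gen_torsion (opp A) {S. torsion_simple (opp A) f S} = f" if f: "torsion_closed (opp A) f" for f
    proof -
      have "torsion_pair A (left_perp A f) f" using op.torsion_closed_pair[OF f] by simp
      then obtain W where W: "wide A W" "f = gen_torsion (opp A) W" using wg by fastforce
      interpret wide_subcategory "opp A" len W by unfold_locales (use W in simp)
      show ?thesis using gen_by_torsion_simples W by simp
    qed
    have op_closed: "torsion_closed (opp A) (right_perp A t)" for t
      using abelian_category.left_perp_closed[OF op, of t] by simp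
    have fg: "fin_gen A t" if "torsion_closed A t" for t
    proof (rule all_fin_gen[OF fin_gen_Obj(1)[OF assms(2)] gen _ that])
      fix t assume "torsion_closed A t" "t \<noteq> Obj A"
      then show "\<exists>B. torsion_simple (opp A) (right_perp A t) B" by (rule ex_cosimple[OF _ _ gen'[OF op_closed]])
    qed
    have fg': "fin_gen (opp A) f" if "torsion_closed (opp A) f" for f
    proof (rule op.all_fin_gen[OF _ gen' _ that])
      show "fin_gen (opp A) (Obj (opp A))" using fin_gen_Obj(2)[OF assms(2)] by simp
      fix f assume f: "torsion_closed (opp A) f" "f \<noteq> Obj (opp A)"
      show "\<exists>B. torsion_simple (opp (opp A)) (right_perp (opp A) f) B"
        by (rule op.ex_cosimple[OF f]) (use gen[OF left_perp_closed] in simp)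
    qed
    show "brick_finite A" by (rule brick_finite_if_fin_gen[OF fg fg' gen])
  qed
qed

end
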